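(* Let $G$ be a nilpotent group admitting an endomorphism $\gamma$ with a good identity $r(t) \in \mathbb{Z}[t]$ of degree $d$. Then either $G$ has $(\operatorname{Discr}_\ast(r(t)) \cdot \operatorname{Prod}_\ast(r(t)))$-torsion or $G$ is nilpotent of class $\operatorname{c}(G) \le d^{2^d}$.
   Context: For a group endomorphism $\gamma$ and $s(t) = b_0 + \cdots + b_e t^e \in \mathbb{Z}[t]$, write $x^{s(\gamma)} := x^{b_0}\gamma(x^{b_1})\cdots\gamma^e(x^{b_e})$. $r(t)$ is an identity of $\gamma$ if there is a decomposition $r = r_1+\cdots+r_k$ in $\mathbb{Z}[t]$ with $x^{r_1(\gamma)}\cdots x^{r_k(\gamma)} = 1_G$ for all $x\in G$. With $\mathbb{N}=\{1,2,\dots\}$, $r(t)$ is bad if there exist $u\in\mathbb{N}$ and $s(t)\in\mathbb{Z}[t]\setminus\mathbb{Z}$ with $s(t^{u+1})\mid r(0)r(1)r(t)$ in $\mathbb{Z}[t]$; otherwise good. If $r$ is constant, $\operatorname{Discr}_\ast(r) := r$, $\operatorname{Prod}_\ast(r) := 1$. Otherwise with $d=\deg r$, leading coefficient $a$, distinct roots $\lambda_1,\dots,\lambda_l\in\overline{\mathbb{Q}}$ of multiplicities $m_1,\dots,m_l$, $m=\max m_i$: $\operatorname{Discr}_\ast(r) := a^{1+2d^2}(m-1)!\prod_{i\ne j}(\lambda_i-\lambda_j)^m$ and $\operatorname{Prod}_\ast(r) := a^{2d^3}\prod_{1\le i,j\le l,\ r(\lambda_i\lambda_j)\ne0} r(\lambda_i\lambda_j)$.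 A group $H$ has $n$-torsion if some $h\ne 1_H$ satisfies $h^n=1_H$. *)

theory Defs
  imports Complex_Main "HOL-Algebra.Generated_Groups" "HOL-Computational_Algebra.Polynomial"
begin

text \<open>lcs G 0 = G, lcs G (n+1) = [G, lcs G n]; i.e. lcs G n is gamma_{n+1}(G).\<close>
primrec lcs :: "('a, 'b) monoid_scheme \<Rightarrow> nat \<Rightarrow> 'a set" where
  "lcs G 0 = carrier G"
| "lcs G (Suc n) = generate G
     {x \<otimes>\<^bsub>G\<^esub> y \<otimes>\<^bsub>G\<^esub> inv\<^bsub>G\<^esub> x \<otimes>\<^bsub>G\<^esub> inv\<^bsub>G\<^esub> y | x y. x \<in> carrier G \<and> y \<in> lcs G n}"

definition nilpotent_class_le :: "('a, 'b) monoid_scheme \<Rightarrow> nat \<Rightarrow> bool" where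
  "nilpotent_class_le G c \<longleftrightarrow> lcs G c = {\<one>\<^bsub>G\<^esub>}"

definition nilpotent_group :: "('a, 'b) monoid_scheme \<Rightarrow> bool" where
  "nilpotent_group G \<longleftrightarrow> group G \<and> (\<exists>c. nilpotent_class_le G c)"

definition has_torsion :: "('a, 'b) monoid_scheme \<Rightarrow> int \<Rightarrow> bool" where
  "has_torsion G n \<longleftrightarrow> (\<exists>h \<in> carrier G. h \<noteq> \<one>\<^bsub>G\<^esub> \<and> h [^]\<^bsub>G\<^esub> n = \<one>\<^bsub>G\<^esub>)"

primrec list_prod :: "('a, 'b) monoid_scheme \<Rightarrow> 'a list \<Rightarrow> 'a" where
  "list_prod G [] = \<one>\<^bsub>G\<^esub>"
| "list_prod G (a # l) = a \<otimes>\<^bsub>G\<^esub> list_prod G l"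

definition poly_pow :: "('a, 'b) monoid_scheme \<Rightarrow> ('a \<Rightarrow> 'a) \<Rightarrow> int poly \<Rightarrow> 'a \<Rightarrow> 'a" where
  "poly_pow G \<gamma> s x = list_prod G (map (\<lambda>i. (\<gamma> ^^ i) (x [^]\<^bsub>G\<^esub> coeff s i)) [0..<Suc (degree s)])"

definition is_identity :: "('a, 'b) monoid_scheme \<Rightarrow> ('a \<Rightarrow> 'a) \<Rightarrow> int poly \<Rightarrow> bool" where
  "is_identity G \<gamma> r \<longleftrightarrow> (\<exists>rs. rs \<noteq> [] \<and> sum_list rs = r \<and>
      (\<forall>x \<in> carrier G. list_prod G (map (\<lambda>ri. poly_pow G \<gamma> ri x) rs) = \<one>\<^bsub>G\<^esub>))"

definition bad_poly :: "int poly \<Rightarrow> bool" where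
  "bad_poly r \<longleftrightarrow> (\<exists>(u::nat) (s::int poly). u \<ge> 1 \<and> degree s > 0 \<and>
      pcompose s (monom 1 (u + 1)) dvd smult (poly r 0 * poly r 1) r)"

definition good_poly :: "int poly \<Rightarrow> bool" where
  "good_poly r \<longleftrightarrow> \<not> bad_poly r"

definition cpoly :: "int poly \<Rightarrow> complex poly" where
  "cpoly r = map_poly of_int r"

definition croots :: "int poly \<Rightarrow> complex set" where
  "croots r = {z. poly (cpoly r) z = 0}"

definition max_mult :: "int poly \<Rightarrow> nat" where
  "max_mult r = Max ((\<lambda>z. order z (cpoly r)) ` croots r)"

definition discr_star :: "int poly \<Rightarrow> complex" where
  "discr_star r = (if degree r = 0 then of_int (coeff r 0) else
     of_int (lead_coeff r) ^ (1 + 2 * degree r ^ 2) * of_nat (fact (max_mult r - 1)) *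
     (\<Prod>p \<in> {p \<in> croots r \<times> croots r. fst p \<noteq> snd p}. (fst p - snd p) ^ max_mult r))"

definition prod_star :: "int poly \<Rightarrow> complex" where
  "prod_star r = (if degree r = 0 then 1 else
     of_int (lead_coeff r) ^ (2 * degree r ^ 3) *
     (\<Prod>p \<in> {p \<in> croots r \<times> croots r. poly (cpoly r) (fst p * snd p) \<noteq> 0}.
        poly (cpoly r) (fst p * snd p)))"

end

theory Submission
  imports Defs
    "HOL-Computational_Algebra.Group_Closure"
    "HOL-Computational_Algebra.Polynomial_Factorial"
    "HOL-Computational_Algebra.Fundamental_Theorem_Algebra"
    "HOL-Computational_Algebra.Polynomial_FPS"
    "HOL-Computational_Algebra.Field_as_Ring"
    "HOL-Library.Multiset"
    "HOL-Library.Poly_Mapping"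
    "HOL-Algebra.FiniteProduct"
begin

text \<open>Suppose that the class of \<open>G\<close> is \<open>c\<close> and that \<open>G\<close> has no \<open>n\<close>-torsion for the number \<open>n\<close> in question.
  On the Lie ring associated with the lower central series, modulo the part that does not contribute
  to commutators in the last nontrivial term, the endomorphism satisfies \<open>r(\<gamma>) = 0\<close>. The leading
  coefficient \<open>a\<close>, the differences of the numbers \<open>a \<lambda>\<close> for roots \<open>\<lambda>\<close>, and the nonzero values
  \<open>r(\<lambda> \<mu>)\<close> (times a power of \<open>a\<close>) divide \<open>n\<close> in the ring \<open>R\<close> generated by the \<open>a \<lambda>\<close>. Since
  \<open>R\<close> is additively finitely generated and meets the rationals in the integers, \<open>\<int>\<close> is a direct summand
  of \<open>R\<close>, so that tensoring with \<open>R\<close> loses nothing. After that, and up to powers of \<open>n\<close>, the Lie ring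
  is the sum of the generalized eigenspaces of \<open>\<gamma>\<close>, which grade it by the set \<open>X\<close> of roots.

  Goodness of \<open>r\<close> implies that \<open>X\<close> contains no set \<open>{\<lambda> \<mu>\<^sup>j | j}\<close> with \<open>\<lambda>, \<mu> \<in> X\<close>. For such a grading
  Kreknin's argument, applied to the elements of \<open>X\<close> in a cyclic order cut open at \<open>1\<close>, bounds the
  derived length by \<open>2\<^sup>d - 1\<close>. Each step of the derived series is then killed by long enough
  commutators: the factors may be permuted modulo shorter words, and some partial product of their
  weights leaves \<open>X\<close>. The resulting class bounds satisfy \<open>f(j + 1) = d f(j) + 1\<close>.\<close>

subsection \<open>Additive subgroups\<close>

text \<open>The obstacle is torsion. The factors of the lower central series of \<open>G\<close> can
  have \<open>n\<close>-torsion although \<open>G\<close> has none, so \<open>n\<close> cannot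
  simply be inverted in the associated Lie ring. Discarding all that does not contribute to the last
  term repairs this: what survives is detected by elements of \<open>G\<close> itself, so an element
  that a power of \<open>n\<close> carries into the null subgroup is already null. Hence every
  divisor of \<open>n\<close> in \<open>R\<close> can be cancelled. No localization is formed;
  statements familiar over a field hold after multiplication by powers of \<open>n\<close>, which
  are carried along.

  The powers of \<open>a\<close> in the torsion number are denominators. Their total exponent
  \<open>1 + 2 d^2 + 2 d^3\<close> makes all differences of roots and all values
  \<open>r(\<lambda> \<mu>)\<close> integral and leaves one factor \<open>a\<close>, which is needed
  to cancel \<open>a\<close> itself.

  Only the last term is attacked: if the class is at most \<open>top + 1\<close> and
  \<open>top\<close> is at least the bound, then the class is at most \<open>top\<close>.
  Commutators ending in the last term are multiplicative in their first entry, so there the identity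
  of \<open>\<gamma>\<close> loses its order of factors and its decomposition.\<close>

definition add_subgroup :: "'v::ab_group_add set \<Rightarrow> bool" where
  "add_subgroup A \<longleftrightarrow> 0 \<in> A \<and> (\<forall>x\<in>A. \<forall>y\<in>A. x - y \<in> A)"

lemma add_subgroup_zero: "add_subgroup A \<Longrightarrow> 0 \<in> A"
  by (simp add: add_subgroup_def)

lemma add_subgroup_diff: "add_subgroup A \<Longrightarrow> x \<in> A \<Longrightarrow> y \<in> A \<Longrightarrow> x - y \<in> A"
  by (simp add: add_subgroup_def)

lemma add_subgroup_uminus: "add_subgroup A \<Longrightarrow> x \<in> A \<Longrightarrow> - x \<in> A"
  using add_subgroup_diff[of A 0 x] by (simp add: add_subgroup_zero)

lemma add_subgroup_add: "add_subgroup A \<Longrightarrow> x \<in> A \<Longrightarrow> y \<in> A \<Longrightarrow> x + y \<in> A"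
  using add_subgroup_diff[of A x "- y"] by (simp add: add_subgroup_uminus)

lemma add_subgroup_sum:
  "add_subgroup A \<Longrightarrow> (\<And>i. i \<in> I \<Longrightarrow> f i \<in> A) \<Longrightarrow> sum f I \<in> A"
  by (induction I rule: infinite_finite_induct) (auto simp: add_subgroup_zero add_subgroup_add)

lemma add_subgroup_group_closure: "add_subgroup (group_closure S)"
  by (simp add: add_subgroup_def group_closure.diff)

lemma group_closure_base: "x \<in> S \<Longrightarrow> x \<in> group_closure S"
  by (simp add: group_closure.base)

lemma group_closure_least:
  assumes "S \<subseteq> A" "add_subgroup A"
  shows "group_closure S \<subseteq> A"
proof
  fix x assume "x \<in> group_closure S"
  then show "x \<in> A"
    by induction (use assms in \<open>auto simp: add_subgroup_def\<close>)
qed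

lemma group_closure_mono: "S \<subseteq> T \<Longrightarrow> group_closure S \<subseteq> group_closure T"
  by (rule group_closure_least) (auto intro: group_closure_base simp: add_subgroup_group_closure)

section \<open>Lists up to permutation\<close>

lemma prod_list_map_mset: "prod_list (map f xs) = prod_mset (image_mset f (mset xs))"
  by (simp add: prod_mset_prod_list flip: mset_map)

lemma sum_list_map_mset: "sum_list (map f xs) = sum_mset (image_mset f (mset xs))"
  by (simp add: sum_mset_sum_list flip: mset_map)

text \<open>Bubble sort: the head of the target list is carried to the front and then joins the
  settled prefix \<open>p\<close>. Fixing the multiset \<open>M\<close> restricts
  \<open>swap\<close> to rearrangements of one given word, for which
  \<open>long_words_descend\<close> has an induction hypothesis.\<close>

lemma mset_eq_swap_related:
  fixes R :: "'a list \<Rightarrow> 'a list \<Rightarrow> bool"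
  assumes refl: "\<And>xs. R xs xs"
    and trans: "\<And>xs ys zs. R xs ys \<Longrightarrow> R ys zs \<Longrightarrow> R xs zs"
    and swap: "\<And>p a b s. mset (p @ a # b # s) = M \<Longrightarrow> R (p @ a # b # s) (p @ b # a # s)"
  shows "mset (p @ xs) = M \<Longrightarrow> mset xs = mset ys \<Longrightarrow> R (p @ xs) (p @ ys)"
proof (induction ys arbitrary: xs p)
  case Nil
  then show ?case by (simp add: refl)
next
  case (Cons y ys)
  have "y \<in> set xs" using Cons.prems(2) by (metis list.set_intros(1) set_mset_mset)
  then obtain us vs where xs: "xs = us @ y # vs" by (metis split_list)
  have move: "mset (p @ us @ y # vs) = M \<Longrightarrow> R (p @ us @ y # vs) (p @ y # us @ vs)" for vs
  proof (induction us arbitrary: vs rule: rev_induct)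
    case Nil
    then show ?case by (simp add: refl)
  next
    case (snoc u us)
    have "R (p @ us @ u # y # vs) (p @ us @ y # u # vs)"
      using swap[of "p @ us" u y vs] snoc.prems by simp
    moreover have "R (p @ us @ y # u # vs) (p @ y # us @ u # vs)"
      using snoc.IH[of "u # vs"] snoc.prems by (simp add: add_mset_commute[of u y])
    ultimately have "R (p @ us @ u # y # vs) (p @ y # us @ u # vs)" by (rule trans)
    then show ?case by simp
  qed
  have 1: "R (p @ xs) ((p @ [y]) @ us @ vs)"
    using move[of vs] Cons.prems(1) unfolding xs by simp
  have "R ((p @ [y]) @ us @ vs) ((p @ [y]) @ ys)"
    by (rule Cons.IH) (use Cons.prems xs in auto)
  then show ?case using trans[OF 1] by simp
qed

subsection \<open>Lie rings graded by an arithmetically free set\<close>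

text \<open>Everything is taken modulo the null subgroup \<open>Z\<close>, so that the Lie ring itself is the
  quotient of the span of the \<open>L x\<close> by \<open>Z\<close>. The function \<open>\<theta>\<close> is a cyclic order on the
  grading set, cut open at the identity.\<close>

locale graded_lie =
  fixes br :: "'v::ab_group_add \<Rightarrow> 'v \<Rightarrow> 'v" and Z :: "'v set" and L :: "complex \<Rightarrow> 'v set"
    and X :: "complex set" and \<theta> :: "complex \<Rightarrow> real"
  assumes br_add_left: "br (a + b) c = br a c + br b c"
    and br_add_right: "br c (a + b) = br c a + br c b"
    and Z_sub: "add_subgroup Z"
    and L_sub: "add_subgroup (L x)"
    and Z_le_L: "Z \<subseteq> L x"
    and L_off: "x \<notin> X \<Longrightarrow> L x = Z"
    and br_L: "a \<in> L x \<Longrightarrow> b \<in> L y \<Longrightarrow> br a b \<in> L (x * y)"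
    and br_Z_left: "a \<in> Z \<Longrightarrow> b \<in> L x \<Longrightarrow> br a b \<in> Z"
    and br_Z_right: "a \<in> L x \<Longrightarrow> b \<in> Z \<Longrightarrow> br a b \<in> Z"
    and antisym: "a \<in> L x \<Longrightarrow> b \<in> L y \<Longrightarrow> br a b + br b a \<in> Z"
    and jacobi: "a \<in> L x \<Longrightarrow> b \<in> L y \<Longrightarrow> c \<in> L z \<Longrightarrow>
                   br (br a b) c - br (br a c) b - br a (br b c) \<in> Z"
    and finite_X: "finite X" and zero_X: "0 \<notin> X" and one_X: "1 \<notin> X"
    and arith_free: "x \<in> X \<Longrightarrow> y \<in> X \<Longrightarrow> \<exists>j. x * y ^ j \<notin> X"
    and theta_range: "x \<in> X \<Longrightarrow> 0 < \<theta> x \<and> \<theta> x < 1"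
    and theta_mult: "x \<in> X \<Longrightarrow> y \<in> X \<Longrightarrow> x * y \<in> X \<Longrightarrow>
                       \<theta> (x * y) = \<theta> x + \<theta> y \<or> \<theta> (x * y) = \<theta> x + \<theta> y - 1"
begin

section \<open>Bracket calculus and graded subrings\<close>

lemma br_zero_left [simp]: "br 0 c = 0"
  using br_add_left[of 0 0 c] by simp

lemma br_zero_right [simp]: "br c 0 = 0"
  using br_add_right[of c 0 0] by simp

lemma br_diff_left: "br (a - b) c = br a c - br b c"
  using br_add_left[of "a - b" b c] by (simp add: algebra_simps)

lemma br_diff_right: "br c (a - b) = br c a - br c b"
  using br_add_right[of c "a - b" b] by (simp add: algebra_simps)

lemma foldl_br_diff: "foldl br (a - b) cs = foldl br a cs - foldl br b cs"
  by (induction cs arbitrary: a b) (simp_all add: br_diff_left)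

text \<open>The preimages of graded subrings under the quotient by \<open>Z\<close>.\<close>

definition subfamily :: "(complex \<Rightarrow> 'v set) \<Rightarrow> bool" where
  "subfamily H \<longleftrightarrow> (\<forall>x. add_subgroup (H x) \<and> Z \<subseteq> H x \<and> H x \<subseteq> L x) \<and>
     (\<forall>x y a b. a \<in> H x \<longrightarrow> b \<in> H y \<longrightarrow> br a b \<in> H (x * y))"

lemma subfamilyD:
  assumes "subfamily H"
  shows "add_subgroup (H x)" "Z \<subseteq> H x" "H x \<subseteq> L x" "a \<in> H x \<Longrightarrow> b \<in> H y \<Longrightarrow> br a b \<in> H (x * y)"
  using assms unfolding subfamily_def by blast+

lemma subfamily_L: "subfamily L"
  unfolding subfamily_def using L_sub Z_le_L br_L by blast

text \<open>The homogeneous components of the commutator of \<open>H\<close> and \<open>K\<close>,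
  again as preimages under the quotient by \<open>Z\<close>.\<close>

definition prodfam :: "(complex \<Rightarrow> 'v set) \<Rightarrow> (complex \<Rightarrow> 'v set) \<Rightarrow> complex \<Rightarrow> 'v set" where
  "prodfam H K x = group_closure (Z \<union> {br a b | a b. \<exists>y z. y * z = x \<and> a \<in> H y \<and> b \<in> K z})"

lemma prodfam_sub: "add_subgroup (prodfam H K x)"
  unfolding prodfam_def by (rule add_subgroup_group_closure)

lemma Z_le_prodfam: "Z \<subseteq> prodfam H K x"
  unfolding prodfam_def by (auto intro: group_closure_base)

lemma br_prodfam: "a \<in> H y \<Longrightarrow> b \<in> K z \<Longrightarrow> br a b \<in> prodfam H K (y * z)"
  unfolding prodfam_def by (rule group_closure_base) blast

lemma prodfam_least:
  assumes "Z \<subseteq> A" "add_subgroup A"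
    and "\<And>a b y z. y * z = x \<Longrightarrow> a \<in> H y \<Longrightarrow> b \<in> K z \<Longrightarrow> br a b \<in> A"
  shows "prodfam H K x \<subseteq> A"
  unfolding prodfam_def by (rule group_closure_least) (use assms in auto)

lemma prodfam_mono:
  assumes "\<And>x. H x \<subseteq> H' x" "\<And>x. K x \<subseteq> K' x"
  shows "prodfam H K x \<subseteq> prodfam H' K' x"
  unfolding prodfam_def by (rule group_closure_mono) (use assms in blast)

definition der :: "(complex \<Rightarrow> 'v set) \<Rightarrow> complex \<Rightarrow> 'v set" where
  "der H = prodfam H H"

lemma br_der: "a \<in> H y \<Longrightarrow> b \<in> H z \<Longrightarrow> br a b \<in> der H (y * z)"
  unfolding der_def by (rule br_prodfam)

lemma der_le: "subfamily H \<Longrightarrow> der H x \<subseteq> H x"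
  unfolding der_def by (rule prodfam_least) (auto dest: subfamilyD)

lemma subfamily_der:
  assumes H: "subfamily H"
  shows "subfamily (der H)"
  unfolding subfamily_def
proof (intro conjI allI impI)
  fix x y a b assume "a \<in> der H x" "b \<in> der H y"
  then show "br a b \<in> der H (x * y)"
    using der_le[OF H] unfolding der_def by (metis br_prodfam subsetD)
next
  fix x
  show "add_subgroup (der H x)" "Z \<subseteq> der H x" "der H x \<subseteq> L x"
    using der_le[OF H, of x] subfamilyD(3)[OF H, of x]
    by (auto simp: der_def prodfam_sub dest: Z_le_prodfam[THEN subsetD])
qed

lemma subfamily_der_funpow: "subfamily H \<Longrightarrow> subfamily ((der ^^ k) H)"
  by (induction k) (simp_all add: subfamily_der)

lemma der_funpow_le: "subfamily H \<Longrightarrow> (der ^^ k) H x \<subseteq> H x"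
  by (induction k) (auto dest: der_le[OF subfamily_der_funpow, THEN subsetD])

lemma der_mono: "(\<And>x. H x \<subseteq> K x) \<Longrightarrow> der H x \<subseteq> der K x"
  unfolding der_def by (rule prodfam_mono)

subsection \<open>Kreknin's theorem\<close>

text \<open>The degree \<open>x\<close> part of the subring generated by the \<open>H y\<close> with
  \<open>y\<close> in \<open>Y\<close>, described by left-normed products: \<open>gen_br\<close>
  multiplies by one generator at a time. Closure under all brackets is then a consequence of the
  Jacobi identity.\<close>

inductive gen :: "(complex \<Rightarrow> 'v set) \<Rightarrow> complex set \<Rightarrow> complex \<Rightarrow> 'v \<Rightarrow> bool" for H Y where
  gen_Z: "v \<in> Z \<Longrightarrow> gen H Y x v"
| gen_base: "y \<in> Y \<Longrightarrow> v \<in> H y \<Longrightarrow> gen H Y y v"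
| gen_diff: "gen H Y x u \<Longrightarrow> gen H Y x v \<Longrightarrow> gen H Y x (u - v)"
| gen_br: "gen H Y x u \<Longrightarrow> y \<in> Y \<Longrightarrow> v \<in> H y \<Longrightarrow> gen H Y (x * y) (br u v)"

lemma gen_in:
  assumes "subfamily H" "gen H Y x v"
  shows "v \<in> H x"
  using assms(2) by induction (use subfamilyD[OF assms(1)] add_subgroup_diff in blast)+

lemma gen_in_L: "subfamily H \<Longrightarrow> gen H Y x v \<Longrightarrow> v \<in> L x"
  using gen_in subfamilyD(3) by blast

lemma gen_sub: "add_subgroup {v. gen H Y x v}"
  by (simp add: add_subgroup_def gen_Z gen_diff add_subgroup_zero[OF Z_sub])

text \<open>Modulo \<open>Z\<close>, \<open>[u, [v, a]] = [[u, v], a] - [[u, a], v]\<close> moves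
  the last generator of the right factor outwards, so induction on that factor applies.\<close>

lemma gen_br_gen:
  assumes H: "subfamily H" and v: "gen H Y y v"
  shows "gen H Y x u \<Longrightarrow> gen H Y (x * y) (br u v)"
  using v
proof (induction arbitrary: x u)
  case (gen_Z v y)
  then show ?case using gen_in_L[OF H] br_Z_right gen.gen_Z by blast
next
  case (gen_base y v)
  then show ?case using gen.gen_br by blast
next
  case (gen_diff y v w)
  then show ?case by (simp add: br_diff_right gen.gen_diff)
next
  case (gen_br y v z a)
  let ?j = "br (br u v) a - br (br u a) v - br u (br v a)"
  have L: "u \<in> L x" "v \<in> L y" "a \<in> L z"
    using gen_in_L[OF H] gen_br subfamilyD(3)[OF H] by blast+
  have "gen H Y (x * y * z) (br (br u v) a)"
    by (rule gen.gen_br[OF gen_br.IH[OF gen_br.prems] gen_br.hyps(2,3)])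
  moreover have "gen H Y (x * y * z) (br (br u a) v)"
    using gen_br.IH[OF gen.gen_br[OF gen_br.prems gen_br.hyps(2,3)]]
    by (simp add: ac_simps)
  moreover have "gen H Y (x * y * z) ?j"
    by (rule gen.gen_Z) (rule jacobi[OF L])
  ultimately have "gen H Y (x * y * z) (br (br u v) a - br (br u a) v - ?j)"
    using gen.gen_diff by blast
  then show ?case by (simp add: mult.assoc)
qed

text \<open>The same use of Jacobi, now keeping track of the last entry: a product of two generated
  elements is a sum of products whose right factor is a single generator. The \<open>if\<close>
  confines the degree of that generator to \<open>Y\<close>, modulo \<open>Z\<close>.\<close>

lemma br_gen_in_prodfam:
  assumes H: "subfamily H" and v: "gen H Y z v"
  shows "gen H Y y u \<Longrightarrow>
    br u v \<in> prodfam (\<lambda>x. {w. gen H Y x w}) (\<lambda>t. if t \<in> Y then H t else Z) (y * z)"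
    (is "_ \<Longrightarrow> _ \<in> ?P (y * z)")
  using v
proof (induction arbitrary: y u)
  case (gen_Z v z)
  then show ?case using gen_in_L[OF H] br_Z_right Z_le_prodfam by blast
next
  case (gen_base z v)
  then show ?case using br_prodfam[of u "\<lambda>x. {w. gen H Y x w}" y v] by simp
next
  case (gen_diff z v w)
  then show ?case by (simp add: br_diff_right add_subgroup_diff[OF prodfam_sub])
next
  case (gen_br z v t a)
  let ?j = "br (br u v) a - br (br u a) v - br u (br v a)"
  have L: "u \<in> L y" "v \<in> L z" "a \<in> L t"
    using gen_in_L[OF H] gen_br subfamilyD(3)[OF H] by blast+
  have "br (br u v) a \<in> ?P (y * z * t)"
    by (rule br_prodfam) (use gen_br_gen[OF H] gen_br in auto)
  moreover have "br (br u a) v \<in> ?P (y * z * t)"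
    using gen_br.IH[OF gen.gen_br[OF gen_br.prems gen_br.hyps(2,3)]]
    by (simp add: ac_simps)
  moreover have "?j \<in> ?P (y * z * t)"
    using jacobi[OF L] Z_le_prodfam by blast
  ultimately have "br (br u v) a - br (br u a) v - ?j \<in> ?P (y * z * t)"
    using add_subgroup_diff[OF prodfam_sub] by blast
  then show ?case by (simp add: mult.assoc)
qed

text \<open>The heart of Kreknin's argument, with \<open>x\<close> the largest degree outside the
  upper part \<open>Y\<close>. By \<open>br_gen_in_prodfam\<close> it is enough to treat
  \<open>[w, a]\<close> with a generator \<open>a\<close> of degree \<open>t\<close> and
  \<open>w\<close> of degree \<open>s\<close>, where \<open>s * t = x\<close>. For
  \<open>t = x\<close> the degree \<open>s\<close> is 1 and \<open>w\<close> is null. For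
  \<open>t\<close> in \<open>Y\<close> the product wraps around the circle, which forces
  \<open>s\<close> above \<open>x\<close> and hence into \<open>Y\<close>.\<close>

lemma der_gen_step:
  assumes H: "subfamily H" and Y: "Y \<subseteq> X" and x: "x \<in> X" "x \<notin> Y"
    and low: "\<And>s. s \<in> X - Y \<Longrightarrow> \<theta> s \<le> \<theta> x" and up: "\<And>t. t \<in> Y \<Longrightarrow> \<theta> x \<le> \<theta> t"
  shows "der (\<lambda>y. {w. gen H (insert x Y) y w}) x \<subseteq> {v. gen H Y x v}"
proof -
  let ?G = "\<lambda>y. {w. gen H (insert x Y) y w}"
  let ?P = "prodfam ?G (\<lambda>t. if t \<in> insert x Y then H t else Z)"
  have br: "br w a \<in> {v. gen H Y x v}"
    if st: "s * t = x" and w: "w \<in> ?G s" and a: "a \<in> (if t \<in> insert x Y then H t else Z)" for w a s t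
  proof -
    have wL: "w \<in> L s" using w gen_in_L[OF H] by blast
    have aL: "a \<in> L t" using a subfamilyD(3)[OF H] Z_le_L by (auto split: if_splits)
    consider "t \<notin> insert x Y" | "s \<notin> X" | "t = x" | "t \<in> Y" "s \<in> X" by blast
    then show ?thesis
    proof cases
      case 1
      then have "br w a \<in> Z" using a wL br_Z_right by simp
      then show ?thesis by (simp add: gen_Z)
    next
      case 2
      then have "br w a \<in> Z" using wL aL L_off br_Z_left by blast
      then show ?thesis by (simp add: gen_Z)
    next
      case 3
      then have "s = 1" using st x(1) zero_X by (metis mult_cancel_right1 mult.commute)
      then have "br w a \<in> Z" using wL aL one_X L_off br_Z_left by blast
      then show ?thesis by (simp add: gen_Z)
    next
      case 4
      have "\<theta> x = \<theta> s + \<theta> t \<or> \<theta> x = \<theta> s + \<theta> t - 1"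
        using theta_mult[of s t] 4 Y x(1) st by blast
      moreover have "0 < \<theta> s" "\<theta> t < 1" "\<theta> x \<le> \<theta> t"
        using 4 theta_range Y up by blast+
      \<comment> \<open>Without wrapping around, \<open>\<theta> x\<close> would exceed
        \<open>\<theta> t\<close>. So \<open>\<theta> x = \<theta> s + \<theta> t - 1\<close>, which
        is less than \<open>\<theta> s\<close>.\<close>
      ultimately have "\<theta> x < \<theta> s" by linarith
      then have "s \<in> Y" using low[of s] 4(2) by force
      moreover have "w \<in> H s" using w gen_in[OF H] by blast
      moreover have "a \<in> H t" using a 4 by simp
      ultimately show ?thesis
        using gen_br[OF gen_base] 4(1) st by blast
    qed
  qed
  have "?P x \<subseteq> {v. gen H Y x v}"
    by (rule prodfam_least) (use br gen_sub gen_Z in blast)+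
  moreover have "der ?G x \<subseteq> ?P x"
    unfolding der_def
    by (rule prodfam_least[OF Z_le_prodfam prodfam_sub])
       (use br_gen_in_prodfam[OF H] in blast)
  ultimately show ?thesis by (rule order_trans[rotated])
qed

lemma gen_trans:
  assumes H: "subfamily H" and K: "\<And>y v. y \<in> Y' \<Longrightarrow> v \<in> K y \<Longrightarrow> gen H Y y v"
  shows "gen K Y' x v \<Longrightarrow> gen H Y x v"
proof (induction rule: gen.induct)
  case (gen_br x u y v)
  then show ?case using gen_br_gen[OF H K] by blast
qed (use K in \<open>auto intro: gen.intros\<close>)

text \<open>\<open>Y\<close> is an upper set for \<open>\<theta>\<close>, and the induction is on
  the number \<open>k\<close> of degrees below it. Making the component of degree \<open>x0\<close>
  generated by \<open>Y\<close> costs \<open>2^k\<close> derivations: \<open>2^k - 1\<close> to be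
  generated by \<open>insert x0 Y\<close>, and one more for \<open>der_gen_step\<close>. After
  another \<open>2^k - 1\<close> derivations of the result \<open>H'\<close>, everything is
  generated by the components of \<open>H'\<close> in \<open>insert x0 Y\<close>, hence by
  \<open>Y\<close>. The total is \<open>2^(k+1) - 1\<close>.\<close>

lemma kreknin_gen:
  assumes "Y \<subseteq> X" "card (X - Y) = k" "\<And>s t. s \<in> X - Y \<Longrightarrow> t \<in> Y \<Longrightarrow> \<theta> s \<le> \<theta> t" "subfamily H"
  shows "(der ^^ (2 ^ k - 1)) H x \<subseteq> {v. gen H Y x v}"
  using assms
proof (induction k arbitrary: Y H x)
  case 0
  then have "Y = X" using finite_X by auto
  show ?case
  proof
    fix v assume "v \<in> (der ^^ (2 ^ 0 - 1)) H x"
    then have v: "v \<in> H x" by simp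
    show "v \<in> {v. gen H Y x v}"
    proof (cases "x \<in> X")
      case True
      then show ?thesis using v \<open>Y = X\<close> gen_base by blast
    next
      case False
      then have "v \<in> Z" using v L_off subfamilyD(3)[OF \<open>subfamily H\<close>] by blast
      then show ?thesis by (simp add: gen_Z)
    qed
  qed
next
  case (Suc k)
  note H = \<open>subfamily H\<close>
  have fin: "finite (\<theta> ` (X - Y))" using finite_X by simp
  have ne: "X - Y \<noteq> {}" using Suc.prems(2) by (metis card.empty nat.distinct(1))
  obtain x0 where x0: "x0 \<in> X - Y" and x0max: "\<And>s. s \<in> X - Y \<Longrightarrow> \<theta> s \<le> \<theta> x0"
    using Max_in[OF fin] Max_ge[OF fin] ne by (smt (verit) empty_is_image image_iff imageI)
  let ?Y = "insert x0 Y"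
  have card: "card (X - ?Y) = k"
    using Suc.prems(2) x0 by (simp add: card_Diff_insert)
  have IH: "subfamily K \<Longrightarrow> (der ^^ (2 ^ k - 1)) K y \<subseteq> {v. gen K ?Y y v}" for K y
    using Suc.IH[of ?Y K y] card Suc.prems(1,3) x0 x0max by blast
  define H' where "H' = (der ^^ (2 ^ k)) H"
  have H': "subfamily H'" unfolding H'_def by (rule subfamily_der_funpow[OF H])
  have H'eq: "H' = der ((der ^^ (2 ^ k - 1)) H)"
    unfolding H'_def by (metis Suc_diff_1 funpow.simps(2) o_apply pos2 zero_less_power)
  have "H' x0 \<subseteq> der (\<lambda>y. {v. gen H ?Y y v}) x0"
    unfolding H'eq by (rule der_mono) (rule IH[OF H])
  also have "\<dots> \<subseteq> {v. gen H Y x0 v}"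
    by (rule der_gen_step[OF H]) (use Suc.prems x0 x0max in auto)
  finally have 1: "H' x0 \<subseteq> {v. gen H Y x0 v}" .
  have 2: "H' y \<subseteq> H y" for y
    unfolding H'_def by (rule der_funpow_le[OF H])
  have "(2::nat) ^ Suc k - 1 = (2 ^ k - 1) + 2 ^ k" by simp
  then have "(der ^^ (2 ^ Suc k - 1)) H x = (der ^^ (2 ^ k - 1)) H' x"
    unfolding H'_def by (simp only: funpow_add o_apply)
  also have "\<dots> \<subseteq> {v. gen H' ?Y x v}" by (rule IH[OF H'])
  also have "\<dots> \<subseteq> {v. gen H Y x v}"
    using gen_trans[OF H, of ?Y H' Y x] 1 2 gen_base by blast
  finally show ?case .
qed

text \<open>With \<open>Y\<close> empty there are no generators, so only \<open>Z\<close> is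
  left.\<close>

theorem kreknin: "(der ^^ (2 ^ card X - 1)) L x \<subseteq> Z"
proof -
  have "gen L {} x v \<Longrightarrow> v \<in> Z" for v
    by (induction rule: gen.induct) (use add_subgroup_diff[OF Z_sub] in auto)
  then show ?thesis
    using kreknin_gen[of "{}" "card X" L x] subfamily_L by auto
qed

subsection \<open>Nilpotency\<close>

primrec lcf :: "nat \<Rightarrow> complex \<Rightarrow> 'v set" where
  "lcf 0 = L"
| "lcf (Suc k) = prodfam (lcf k) L"

lemma lcf_sub: "add_subgroup (lcf k x)"
  by (cases k) (simp_all add: L_sub prodfam_sub)

lemma Z_le_lcf: "Z \<subseteq> lcf k x"
  by (cases k) (simp_all add: Z_le_L Z_le_prodfam)

lemma lcf_Suc_le: "lcf (Suc k) x \<subseteq> lcf k x"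
proof (induction k arbitrary: x)
  case 0
  show ?case by (simp, rule prodfam_least) (use L_sub Z_le_L br_L in blast)+
next
  case (Suc k)
  show ?case
    using prodfam_mono[of "lcf (Suc k)" "lcf k" L L x, OF Suc.IH order_refl] by simp
qed

lemma lcf_antimono: "i \<le> j \<Longrightarrow> lcf j x \<subseteq> lcf i x"
  by (rule lift_Suc_antimono_le[where f = "\<lambda>i. lcf i x"]) (use lcf_Suc_le in auto)

lemma lcf_le_L: "lcf k x \<subseteq> L x"
  using lcf_antimono[of 0 k x] by simp

text \<open>The extra 1 comes from counting from \<open>lcf 0 = L\<close>, as in \<open>lcs\<close>.
  The set \<open>?A\<close> quantifies over all left factors because Jacobi applies the induction
  hypothesis both to \<open>a\<close> and to \<open>br a v\<close>, which lies one step
  deeper.\<close>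

lemma br_lcf: "a \<in> lcf i x \<Longrightarrow> b \<in> lcf j y \<Longrightarrow> br a b \<in> lcf (i + j + 1) (x * y)"
proof (induction j arbitrary: a b i x y)
  case 0
  then show ?case using br_prodfam[of a "lcf i" x b L y] by simp
next
  case (Suc j)
  let ?A = "{b \<in> L y. \<forall>i x. \<forall>a\<in>lcf i x. br a b \<in> lcf (i + Suc j + 1) (x * y)}"
  have Zb: "br a b \<in> lcf i x" if "a \<in> lcf k y" "b \<in> Z" for a b i x k y
    using that br_Z_right[of a y b] lcf_le_L Z_le_lcf by blast
  have "prodfam (lcf j) L y \<subseteq> ?A"
  proof (rule prodfam_least)
    show "Z \<subseteq> ?A" using Zb Z_le_L by blast
    show "add_subgroup ?A"
      unfolding add_subgroup_def
      by (auto simp: br_diff_right add_subgroup_zero[OF lcf_sub] add_subgroup_zero[OF L_sub]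
               intro: add_subgroup_diff[OF lcf_sub] add_subgroup_diff[OF L_sub] simp del: lcf.simps)
  next
    fix u v s t assume st: "s * t = y" and u: "u \<in> lcf j s" and v: "v \<in> L t"
    have "br a (br u v) \<in> lcf (i + Suc j + 1) (x * y)" if a: "a \<in> lcf i x" for i x a
    proof -
      let ?j = "br (br a u) v - br (br a v) u - br a (br u v)"
      have "br (br a u) v \<in> lcf (i + j + 1 + 1) (x * s * t)"
        using br_prodfam[of _ "lcf (i + j + 1)" _ _ L, OF Suc.IH[OF a u] v] by simp
      moreover have "br (br a v) u \<in> lcf (i + j + 1 + 1) (x * s * t)"
        using Suc.IH[OF _ u, of "br a v" "Suc i" "x * t"] br_prodfam[of a "lcf i" x v L t] a v
        by (simp add: ac_simps)
      moreover have "?j \<in> lcf (i + j + 1 + 1) (x * s * t)"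
        using jacobi[of a x u s v t] a u v lcf_le_L Z_le_lcf by blast
      ultimately have "br (br a u) v - br (br a v) u - ?j \<in> lcf (i + j + 1 + 1) (x * s * t)"
        using add_subgroup_diff[OF lcf_sub] by blast
      then show ?thesis using st by (simp add: mult.assoc)
    qed
    moreover have "br u v \<in> L y" using u v st lcf_le_L br_L by blast
    ultimately show "br u v \<in> ?A" by blast
  qed
  then show ?case using Suc.prems by auto
qed

lemma der_funpow_ideal:
  assumes "a \<in> (der ^^ k) L x" "b \<in> L y"
  shows "br a b \<in> (der ^^ k) L (x * y)"
  using assms
proof (induction k arbitrary: a b x y)
  case 0
  then show ?case by (simp add: br_L)
next
  case (Suc k)
  let ?D = "(der ^^ k) L"
  let ?A = "{a \<in> L x. \<forall>y. \<forall>b\<in>L y. br a b \<in> der ?D (x * y)}"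
  have D: "subfamily ?D" by (rule subfamily_der_funpow[OF subfamily_L])
  note D' = subfamily_der[OF D]
  have "prodfam ?D ?D x \<subseteq> ?A"
  proof (rule prodfam_least)
    show "Z \<subseteq> ?A" using br_Z_left subfamilyD(2)[OF D'] Z_le_L by blast
    show "add_subgroup ?A"
      unfolding add_subgroup_def
      by (auto simp: br_diff_left add_subgroup_zero[OF subfamilyD(1)[OF D']] add_subgroup_zero[OF L_sub]
               intro: add_subgroup_diff[OF subfamilyD(1)[OF D']] add_subgroup_diff[OF L_sub])
  next
    fix u v s t assume st: "s * t = x" and u: "u \<in> ?D s" and v: "v \<in> ?D t"
    have uL: "u \<in> L s" and vL: "v \<in> L t" using u v subfamilyD(3)[OF D] by blast+
    have "br (br u v) b \<in> der ?D (x * y)" if b: "b \<in> L y" for y b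
    proof -
      let ?j = "br (br u v) b - br (br u b) v - br u (br v b)"
      have 1: "br (br u b) v \<in> der ?D (s * y * t)"
        by (rule br_der[of _ ?D, OF Suc.IH[OF u b] v])
      have 2: "br u (br v b) \<in> der ?D (s * (t * y))"
        by (rule br_der[of _ ?D, OF u Suc.IH[OF v b]])
      have 3: "?j \<in> der ?D (s * (t * y))"
        using jacobi[OF uL vL b] subfamilyD(2)[OF D'] by blast
      have "?j + br (br u b) v + br u (br v b) \<in> der ?D (s * (t * y))"
        using 1 2 3 by (intro add_subgroup_add[OF subfamilyD(1)[OF D']]) (auto simp: ac_simps)
      then show ?thesis using st by (simp add: mult.assoc[symmetric] mult.commute mult.left_commute)
    qed
    then show "br u v \<in> ?A" using uL vL st br_L by blast
  qed
  then have "der ?D x \<subseteq> ?A" unfolding der_def[of ?D, symmetric] .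
  then show ?case using Suc.prems by auto
qed

text \<open>A word is a list of triples: an element, a level of the lower central series containing
  it, and its degree. Levels are recorded because rearranging a word merges two entries into a
  bracket of higher level.\<close>

lemma foldl_der_ideal:
  assumes "m \<in> (der ^^ k) L x" "\<And>c w y. (c, w, y) \<in> set cs \<Longrightarrow> c \<in> lcf w y"
  shows "foldl br m (map fst cs) \<in> (der ^^ k) L (x * (\<Prod>c\<leftarrow>cs. snd (snd c)))"
  using assms
proof (induction cs arbitrary: m x)
  case (Cons c cs)
  obtain b w y where c: "c = (b, w, y)" by (cases c)
  have "b \<in> L y" using Cons.prems(2)[of b w y] lcf_le_L c by auto
  then have "br m b \<in> (der ^^ k) L (x * y)" using der_funpow_ideal Cons.prems(1) by blast
  from Cons.IH[OF this] Cons.prems(2) show ?case by (simp add: c ac_simps)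
qed simp

lemma foldl_Z:
  assumes "m \<in> Z" "\<And>c w y. (c, w, y) \<in> set cs \<Longrightarrow> c \<in> lcf w y"
  shows "foldl br m (map fst cs) \<in> Z"
  using assms
proof (induction cs arbitrary: m)
  case (Cons c cs)
  obtain b w y where c: "c = (b, w, y)" by (cases c)
  have "b \<in> L y" using Cons.prems(2)[of b w y] lcf_le_L c by auto
  then have "br m b \<in> Z" using br_Z_left Cons.prems(1) by blast
  from Cons.IH[OF this] Cons.prems(2) show ?case by (simp add: c)
qed simp

text \<open>The set of partial products of a sequence in \<open>X\<close> grows with every new factor until it
  leaves \<open>X\<close>, because otherwise it would be invariant under multiplication by that factor.\<close>

lemma subproducts_leave:
  assumes "x \<in> X" "set ys \<subseteq> X" "length ys \<ge> card X"
  shows "\<exists>A. A \<subseteq># mset ys \<and> x * prod_mset A \<notin> X"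
proof (rule ccontr)
  assume "\<not> ?thesis"
  then have all: "A \<subseteq># mset ys \<Longrightarrow> x * prod_mset A \<in> X" for A by blast
  define S where "S zs = {x * prod_mset A | A. A \<subseteq># mset zs}" for zs
  have "length zs < card (S zs)" if "mset zs \<subseteq># mset ys" for zs
    using that
  proof (induction zs)
    case Nil
    then show ?case by (simp add: S_def)
  next
    case (Cons z zs)
    have step: "mset zs \<subseteq># mset (z # zs)" by simp
    have sub: "mset zs \<subseteq># mset ys"
      using step Cons.prems by (rule subset_mset.order_trans)
    have IH: "length zs < card (S zs)" by (rule Cons.IH[OF sub])
    have SX: "S (z # zs) \<subseteq> X"
      unfolding S_def using all Cons.prems subset_mset.order_trans by blast
    have fin: "finite (S (z # zs))" using SX finite_X finite_subset by blast
    have zX: "z \<in> X" using Cons.prems assms(2)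
      by (metis list.set_intros(1) mset_subset_eqD set_mset_mset subsetD)
    have incl: "S zs \<subseteq> S (z # zs)"
    proof
      fix v assume "v \<in> S zs"
      then obtain A where A: "A \<subseteq># mset zs" "v = x * prod_mset A" unfolding S_def by blast
      have "A \<subseteq># mset (z # zs)"
        using A(1) step by (rule subset_mset.order_trans)
      then show "v \<in> S (z # zs)" unfolding S_def using A(2) by blast
    qed
    have mult: "v * z \<in> S (z # zs)" if v: "v \<in> S zs" for v
    proof -
      obtain A where A: "A \<subseteq># mset zs" "v = x * prod_mset A" using v unfolding S_def by blast
      have "add_mset z A \<subseteq># mset (z # zs)" using A(1) by simp
      moreover have "v * z = x * prod_mset (add_mset z A)" using A(2) by (simp add: ac_simps)
      ultimately show ?thesis unfolding S_def by blast
    qed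
    have "S zs \<noteq> S (z # zs)"
    proof
      assume eq: "S zs = S (z # zs)"
      have "{#} \<subseteq># mset zs" "x = x * prod_mset {#}" by simp_all
      then have x: "x \<in> S zs" unfolding S_def by blast
      have "x * z ^ j \<in> S zs" for j
      proof (induction j)
        case (Suc j)
        then show ?case using mult[OF Suc] eq by (simp add: ac_simps)
      qed (use x in simp)
      then have "x * z ^ j \<in> X" for j using SX eq by blast
      then show False using arith_free[OF assms(1) zX] by blast
    qed
    then have "card (S zs) < card (S (z # zs))"
      using incl fin by (simp add: psubset_card_mono psubset_eq)
    then show ?case using IH by simp
  qed
  from this[of ys] have "card X < card (S ys)" using assms(3) by simp
  moreover have "S ys \<subseteq> X" unfolding S_def using all by blast
  ultimately show False using card_mono[OF finite_X] by (metis not_le)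
qed

text \<open>There are two ways to gain a derivation. A word with fewer than \<open>card X\<close>
  entries has, by pigeonhole on the weights, an entry of level at least \<open>k\<close>, which lies
  in the \<open>j\<close>-th derived ring. A longer word of degrees in \<open>X\<close> has a
  subword whose degrees carry \<open>x\<close> out of \<open>X\<close>; moved to the front, it makes
  the whole word null. Each transposition on the way leaves, by Jacobi, a shorter word with two
  entries merged, covered by the induction on length.\<close>

lemma long_words_descend:
  assumes k: "\<And>x. lcf k x \<subseteq> (der ^^ j) L x" and X: "X \<noteq> {}"
    and m: "m \<in> (der ^^ j) L x"
    and cs: "\<And>c w y. (c, w, y) \<in> set cs \<Longrightarrow> c \<in> lcf w y"
    and len: "(\<Sum>c\<leftarrow>cs. fst (snd c) + 1) \<ge> (card X - 1) * k + 1"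
  shows "foldl br m (map fst cs) \<in> (der ^^ Suc j) L (x * (\<Prod>c\<leftarrow>cs. snd (snd c)))"
  using cs len
proof (induction "length cs" arbitrary: cs rule: less_induct)
  case less
  let ?D = "(der ^^ j) L" and ?D' = "(der ^^ Suc j) L"
  let ?W = "x * (\<Prod>c\<leftarrow>cs. snd (snd c))"
  note D = subfamily_der_funpow[OF subfamily_L, of j]
  note D' = subfamily_der_funpow[OF subfamily_L, of "Suc j"]
  show ?case
  proof (cases "length cs < card X")
    case True
    have "\<exists>c\<in>set cs. fst (snd c) \<ge> k"
    proof (rule ccontr)
      assume "\<not> ?thesis"
      then have "\<And>c. c \<in> set cs \<Longrightarrow> fst (snd c) + 1 \<le> k" by (auto simp: not_le Suc_le_eq)
      then have "(\<Sum>c\<leftarrow>cs. fst (snd c) + 1) \<le> (\<Sum>c\<leftarrow>cs. k)" by (rule sum_list_mono)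
      also have "\<dots> = length cs * k" by (simp add: sum_list_triv)
      also have "\<dots> \<le> (card X - 1) * k" using True by (intro mult_right_mono) auto
      finally show False using less.prems(2) by simp
    qed
    then obtain b w y where c: "(b, w, y) \<in> set cs" and w: "k \<le> w" by auto
    obtain ps ss where split: "cs = ps @ (b, w, y) # ss" using c by (metis split_list)
    have b: "b \<in> ?D y" using less.prems(1)[OF c] lcf_antimono[OF w] k by blast
    have "foldl br m (map fst ps) \<in> ?D (x * (\<Prod>c\<leftarrow>ps. snd (snd c)))"
      by (rule foldl_der_ideal[OF m]) (use less.prems(1) split in auto)
    then have "br (foldl br m (map fst ps)) b \<in> ?D' (x * (\<Prod>c\<leftarrow>ps. snd (snd c)) * y)"
      using b by (simp add: der_def br_prodfam)
    from foldl_der_ideal[OF this, of ss] show ?thesis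
      using less.prems(1) by (auto simp: split ac_simps)
  next
    case False
    show ?thesis
    proof (cases "x \<in> X")
      case xX: False
      then have "m \<in> Z" using m L_off subfamilyD(3)[OF D] by blast
      then show ?thesis using foldl_Z[of m cs] less.prems(1) subfamilyD(2)[OF D'] by blast
    next
      case xX: True
      show ?thesis
      proof (cases "set (map (snd \<circ> snd) cs) \<subseteq> X")
        case False
        then obtain b w y where c: "(b, w, y) \<in> set cs" and y: "y \<notin> X" by fastforce
        obtain ps ss where split: "cs = ps @ (b, w, y) # ss" using c by (metis split_list)
        have "b \<in> Z" using less.prems(1)[OF c] lcf_le_L y L_off by blast
        moreover have "foldl br m (map fst ps) \<in> ?D (x * (\<Prod>c\<leftarrow>ps. snd (snd c)))"
          by (rule foldl_der_ideal[OF m]) (use less.prems(1) split in auto)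
        ultimately have "br (foldl br m (map fst ps)) b \<in> Z"
          using br_Z_right subfamilyD(3)[OF D] by blast
        then have "foldl br m (map fst cs) \<in> Z"
          using foldl_Z[of _ ss] less.prems(1) by (simp add: split)
        then show ?thesis using subfamilyD(2)[OF D'] by blast
      next
        case True
        obtain A where A: "A \<subseteq># mset (map (snd \<circ> snd) cs)" "x * prod_mset A \<notin> X"
          using subproducts_leave[OF xX True] False by auto
        \<comment> \<open>The degrees in \<open>A\<close> are lifted to entries of the word, which
          \<open>as\<close> places first.\<close>
        obtain B where B: "B \<subseteq># mset cs" "image_mset (snd \<circ> snd) B = A"
          using A(1) by (metis mset_map subset_mset.le_iff_add image_mset_eq_plusD mset_subset_eq_add_left)
        obtain as where as: "mset as = B" using ex_mset by blast
        obtain bs where bs: "mset bs = mset cs - B" using ex_mset by blast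
        have mset: "mset (as @ bs) = mset cs" using as bs B(1) by simp
        define R :: "('v \<times> nat \<times> complex) list \<Rightarrow> ('v \<times> nat \<times> complex) list \<Rightarrow> bool"
          where "R us vs \<longleftrightarrow> foldl br m (map fst us) - foldl br m (map fst vs) \<in> ?D' ?W" for us vs
        have "R ([] @ cs) ([] @ (as @ bs))"
        proof (rule mset_eq_swap_related[where M = "mset cs"])
          show "R us us" for us
            by (simp add: R_def add_subgroup_zero[OF subfamilyD(1)[OF D', simplified]])
          show "R us ws" if "R us vs" "R vs ws" for us vs ws
            using add_subgroup_add[OF subfamilyD(1)[OF D'] that[unfolded R_def]] by (simp add: R_def)
        next
          fix p a b s assume ms: "mset (p @ a # b # s) = mset cs"
          obtain u w y where a: "a = (u, w, y)" by (cases a)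
          obtain v w' z where b: "b = (v, w', z)" by (cases b)
          have set: "set (p @ a # b # s) = set cs" using ms by (metis set_mset_mset)
          have val: "c \<in> lcf w y" if "(c, w, y) \<in> set (p @ a # b # s)" for c w y
            using less.prems(1) that set by blast
          \<comment> \<open>The weight of an entry is its level plus 1, so the merged entry of level
            \<open>w + w' + 1\<close> weighs as much as both together, and the bound on the total
            weight survives.\<close>
          define c where "c = (br u v, w + w' + 1, y * z)"
          have uv: "u \<in> lcf w y" "v \<in> lcf w' z" using val a b by auto
          let ?q = "p @ c # s"
          have len: "length (p @ a # b # s) = length cs" using ms by (metis size_mset)
          have W: "x * (\<Prod>c\<leftarrow>?q. snd (snd c)) = ?W"
          proof -
            have "(\<Prod>c\<leftarrow>?q. snd (snd c)) = (\<Prod>c\<leftarrow>p @ a # b # s. snd (snd c))"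
              by (simp add: a b c_def ac_simps)
            also have "\<dots> = (\<Prod>c\<leftarrow>cs. snd (snd c))"
              by (simp only: prod_list_map_mset ms)
            finally show ?thesis by simp
          qed
          have S: "(\<Sum>c\<leftarrow>?q. fst (snd c) + 1) = (\<Sum>c\<leftarrow>cs. fst (snd c) + 1)"
          proof -
            have "(\<Sum>c\<leftarrow>?q. fst (snd c) + 1) = (\<Sum>c\<leftarrow>p @ a # b # s. fst (snd c) + 1)"
              by (simp add: a b c_def ac_simps)
            also have "\<dots> = (\<Sum>c\<leftarrow>cs. fst (snd c) + 1)"
              by (simp only: sum_list_map_mset ms)
            finally show ?thesis .
          qed
          have q: "foldl br m (map fst ?q) \<in> ?D' ?W"
          proof -
            have "length ?q < length cs" using len by simp
            moreover have "e \<in> lcf w1 y1" if "(e, w1, y1) \<in> set ?q" for e w1 y1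
              using that val[of e w1 y1] br_lcf[OF uv] by (auto simp: c_def)
            moreover have "(card X - 1) * k + 1 \<le> (\<Sum>c\<leftarrow>?q. fst (snd c) + 1)"
              using S less.prems(2) by simp
            ultimately show ?thesis using less.hyps[of ?q] unfolding W by blast
          qed
          let ?m = "foldl br m (map fst p)"
          have mL: "?m \<in> L (x * (\<Prod>c\<leftarrow>p. snd (snd c)))"
            using foldl_der_ideal[OF m, of p] val subfamilyD(3)[OF D] by fastforce
          have "br (br ?m u) v - br (br ?m v) u - br ?m (br u v) \<in> Z"
            using jacobi[OF mL] uv lcf_le_L by blast
          then have "foldl br (br (br ?m u) v - br (br ?m v) u - br ?m (br u v)) (map fst s) \<in> Z"
            by (rule foldl_Z) (use val in auto)
          then have z: "foldl br m (map fst (p @ a # b # s)) - foldl br m (map fst (p @ b # a # s))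
              - foldl br m (map fst ?q) \<in> ?D' ?W"
            using subfamilyD(2)[OF D'] by (auto simp: foldl_br_diff a b c_def)
          from add_subgroup_add[OF subfamilyD(1)[OF D'] z q]
          show "R (p @ a # b # s) (p @ b # a # s)" by (simp add: R_def)
        qed (use mset in auto)
        moreover have "foldl br m (map fst (as @ bs)) \<in> Z"
        proof -
          have val: "c \<in> lcf w y" if "(c, w, y) \<in> set (as @ bs)" for c w y
            using less.prems(1) that mset by (metis set_mset_mset)
          have "(\<Prod>c\<leftarrow>as. snd (snd c)) = prod_mset A"
            using B(2) by (simp add: prod_list_map_mset as comp_def)
          then have "foldl br m (map fst as) \<in> Z"
            using foldl_der_ideal[OF m, of as] val A(2) L_off subfamilyD(3)[OF D] by fastforce
          then show ?thesis using foldl_Z[of _ bs] val by simp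
        qed
        ultimately have "(foldl br m (map fst cs) - foldl br m (map fst (as @ bs)))
            + foldl br m (map fst (as @ bs)) \<in> ?D' ?W"
          using subfamilyD(2)[OF D']
          by (intro add_subgroup_add[OF subfamilyD(1)[OF D']]) (auto simp: R_def)
        then show ?thesis by simp
      qed
    qed
  qed
qed

text \<open>Write \<open>card X * k + 1\<close> as \<open>k + ?N\<close> and unfold the last
  \<open>?N\<close> brackets. This gives words of \<open>?N\<close> entries of level 0 applied to an
  element of \<open>lcf k\<close>; such entries have weight 1, so the length is the weight that
  \<open>long_words_descend\<close> asks for.\<close>

lemma lcf_step:
  assumes k: "\<And>x. lcf k x \<subseteq> (der ^^ j) L x" and X: "X \<noteq> {}"
  shows "lcf (card X * k + 1) x \<subseteq> (der ^^ Suc j) L x"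
proof -
  let ?N = "(card X - 1) * k + 1"
  note D' = subfamily_der_funpow[OF subfamily_L, of "Suc j"]
  \<comment> \<open>\<open>i\<close> of the brackets are still folded inside \<open>v\<close>; the
    others are already listed in \<open>cs\<close>.\<close>
  have main: "foldl br v (map fst (cs :: ('v \<times> nat \<times> complex) list)) \<in> (der ^^ Suc j) L (y * (\<Prod>c\<leftarrow>cs. snd (snd c)))"
    if "v \<in> lcf (k + i) y" "\<And>c w y. (c, w, y) \<in> set cs \<Longrightarrow> w = 0 \<and> c \<in> L y"
       "length cs + i = ?N" for i v y cs
    using that
  proof (induction i arbitrary: v y cs)
    case 0
    have "v \<in> (der ^^ j) L y" using 0(1) k by auto
    moreover have "(\<Sum>c\<leftarrow>cs. fst (snd c) + 1) = length cs"
      using 0(2) by (induction cs) force+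
    ultimately show ?case
      using long_words_descend[OF k X, of v y cs] 0 by fastforce
  next
    case (Suc i)
    let ?A = "{v. foldl br v (map fst cs) \<in> (der ^^ Suc j) L (y * (\<Prod>c\<leftarrow>cs. snd (snd c)))}"
    have "prodfam (lcf (k + i)) L y \<subseteq> ?A"
    proof (rule prodfam_least)
      show "Z \<subseteq> ?A"
        using foldl_Z[of _ cs] Suc.prems(2) subfamilyD(2)[OF D'] by fastforce
      have "foldl br 0 (map fst cs) = 0" using foldl_br_diff[of 0 0] by simp
      then show "add_subgroup ?A"
        using subfamilyD(1)[OF D'] unfolding add_subgroup_def
        by (simp add: foldl_br_diff del: funpow.simps)
    next
      fix u b s t assume st: "s * t = y" and u: "u \<in> lcf (k + i) s" and b: "b \<in> L t"
      have "foldl br u (map fst ((b, 0, t) # cs))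
          \<in> (der ^^ Suc j) L (s * (\<Prod>c\<leftarrow>(b, 0, t) # cs. snd (snd c)))"
        by (rule Suc.IH[OF u]) (use Suc.prems b in auto)
      then show "br u b \<in> ?A" using st by (simp add: mult.assoc[symmetric] del: funpow.simps)
    qed
    then show ?case using Suc.prems(1) by auto
  qed
  have "k + ?N = card X * k + 1"
    using X finite_X by (cases "card X") auto
  then show ?thesis
    using main[of _ ?N x "[]"] by (auto simp del: funpow.simps)
qed

text \<open>The geometric sum \<open>1 + d + ... + d^(j-1)\<close>.\<close>

primrec class_bound :: "nat \<Rightarrow> nat \<Rightarrow> nat" where
  "class_bound d 0 = 0"
| "class_bound d (Suc j) = d * class_bound d j + 1"

lemma class_bound_less: "2 \<le> d \<Longrightarrow> class_bound d s < d ^ s"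
proof (induction s)
  case (Suc s)
  have "class_bound d (Suc s) < d * class_bound d s + d" using Suc.prems by simp
  also have "\<dots> = d * (class_bound d s + 1)" by simp
  also have "\<dots> \<le> d * d ^ s" using Suc by (intro mult_left_mono) auto
  finally show ?case by simp
qed simp

lemma lcf_class_bound:
  assumes "X \<noteq> {}"
  shows "lcf (class_bound (card X) s) x \<subseteq> (der ^^ s) L x"
proof (induction s arbitrary: x)
  case (Suc s)
  then show ?case using lcf_step[OF Suc assms] by simp
qed simp

theorem graded_nilpotent: "lcf (card X ^ (2 ^ card X)) x \<subseteq> Z"
proof (cases "X = {}")
  case True
  then show ?thesis using L_off by simp
next
  case False
  let ?d = "card X"
  have "?d > 0" using False finite_X by auto
  have "class_bound ?d (2 ^ ?d - 1) \<le> ?d ^ (2 ^ ?d)"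
  \<comment> \<open>For a single degree the geometric sum with \<open>s\<close> terms is
    \<open>s\<close>, which is not below \<open>1^s\<close>; but here
    \<open>s = 2^1 - 1 = 1\<close>, and the bound is met.\<close>
  proof (cases "?d = 1")
    case False
    then have "2 \<le> ?d" using \<open>?d > 0\<close> by linarith
    then have "class_bound ?d (2 ^ ?d - 1) < ?d ^ (2 ^ ?d - 1)" by (rule class_bound_less)
    also have "\<dots> \<le> ?d ^ (2 ^ ?d)" using \<open>?d > 0\<close> by (intro power_increasing) auto
    finally show ?thesis by simp
  qed simp
  then show ?thesis
    using lcf_antimono lcf_class_bound[OF False] kreknin by blast
qed

end

subsection \<open>Roots of good polynomials\<close>

text \<open>The homomorphism \<open>Arg x / (2 pi) + \<epsilon> ln |x|\<close> modulo 1 from the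
  nonzero complex numbers to the circle works. For small positive \<open>\<epsilon>\<close> it is
  nontrivial on all of \<open>X\<close>: if \<open>Arg x\<close> is nonzero the logarithmic term is
  too small to cancel it, and otherwise \<open>|x|\<close> differs from 1 because \<open>x\<close>
  does. Ties are allowed.\<close>

lemma ex_cyclic_order:
  fixes X :: "complex set"
  assumes fin: "finite X" and X: "0 \<notin> X" "1 \<notin> X"
  obtains \<theta> :: "complex \<Rightarrow> real" where "\<And>x. x \<in> X \<Longrightarrow> 0 < \<theta> x \<and> \<theta> x < 1"
    and "\<And>x y. x \<in> X \<Longrightarrow> y \<in> X \<Longrightarrow> x * y \<in> X \<Longrightarrow>
           \<theta> (x * y) = \<theta> x + \<theta> y \<or> \<theta> (x * y) = \<theta> x + \<theta> y - 1"
proof -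
  define good where "good x \<epsilon> \<longleftrightarrow> \<epsilon> > 0 \<and> \<bar>\<epsilon> * ln (cmod x)\<bar> < 1 / 2 \<and>
    (Arg x \<noteq> 0 \<longrightarrow> \<bar>\<epsilon> * ln (cmod x)\<bar> < \<bar>Arg x\<bar> / (2 * pi))" for x \<epsilon>
  have "\<forall>\<^sub>F \<epsilon> in at_right 0. good x \<epsilon>" for x
  proof -
    have lim: "((\<lambda>\<epsilon>. \<bar>\<epsilon> * ln (cmod x)\<bar>) \<longlongrightarrow> 0) (at_right (0::real))"
      by (auto intro!: tendsto_eq_intros)
    have 1: "\<forall>\<^sub>F \<epsilon> in at_right (0::real). \<bar>\<epsilon> * ln (cmod x)\<bar> < 1 / 2"
      by (rule order_tendstoD(2)[OF lim]) simp
    have 2: "\<forall>\<^sub>F \<epsilon> in at_right (0::real). Arg x \<noteq> 0 \<longrightarrow> \<bar>\<epsilon> * ln (cmod x)\<bar> < \<bar>Arg x\<bar> / (2 * pi)"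
      by (cases "Arg x = 0") (auto intro: order_tendstoD(2)[OF lim])
    show ?thesis unfolding good_def
      using 1 2 eventually_at_right_less[of "0::real"] by eventually_elim auto
  qed
  then have "\<forall>\<^sub>F \<epsilon> in at_right 0. \<forall>x\<in>X. good x \<epsilon>"
    using fin by (simp add: eventually_ball_finite)
  then have "\<exists>\<epsilon>. \<forall>x\<in>X. good x \<epsilon>"
    using eventually_happens[of "\<lambda>\<epsilon>. \<forall>x\<in>X. good x \<epsilon>" "at_right 0"] by simp
  then obtain \<epsilon> where good: "\<And>x. x \<in> X \<Longrightarrow> good x \<epsilon>" by blast
  define u where "u x = Arg x / (2 * pi) + \<epsilon> * ln (cmod x)" for x
  define \<theta> where "\<theta> x = frac (u x)" for x
  have notint: "u x \<notin> \<int>" if "x \<in> X" for x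
  proof
    assume "u x \<in> \<int>"
    have g: "\<epsilon> > 0" "\<bar>\<epsilon> * ln (cmod x)\<bar> < 1 / 2"
      "Arg x \<noteq> 0 \<Longrightarrow> \<bar>\<epsilon> * ln (cmod x)\<bar> < \<bar>Arg x\<bar> / (2 * pi)"
      using good[OF that] by (auto simp: good_def)
    have A: "\<bar>Arg x / (2 * pi)\<bar> \<le> 1 / 2"
      using Arg_bounded[of x] pi_gt_zero by (auto simp: field_simps abs_le_iff)
    have "\<bar>u x\<bar> < 1" using A g(2) unfolding u_def by linarith
    moreover have "u x \<noteq> 0"
    proof (cases "Arg x = 0")
      case True
      have "cmod x \<noteq> 1"
      proof
        assume "cmod x = 1"
        then have "x = 1" using rcis_cmod_Arg[of x] True by simp
        then show False using that X by simp
      qed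
      moreover have "x \<noteq> 0" using that X by auto
      ultimately have "ln (cmod x) \<noteq> 0" by (simp add: ln_eq_zero_iff)
      then show ?thesis using True g(1) by (simp add: u_def)
    next
      case False
      then have "\<bar>\<epsilon> * ln (cmod x)\<bar> < \<bar>Arg x / (2 * pi)\<bar>" using g(3) pi_gt_zero by simp
      then show ?thesis unfolding u_def by linarith
    qed
    ultimately show False using \<open>u x \<in> \<int>\<close> by (auto elim!: Ints_cases)
  qed
  have add: "u (x * y) - u x - u y \<in> \<int>" if "x \<noteq> 0" "y \<noteq> 0" for x y
  proof -
    have "cis (Arg (x * y) - Arg x - Arg y) = 1"
      using that by (simp add: cis_divide[symmetric] cis_Arg sgn_mult del: cis_divide) (simp add: sgn_zero_iff)
    then have "cos (Arg (x * y) - Arg x - Arg y) = 1"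
      by (metis Re_complex_of_real cis.sel(1) of_real_1)
    then obtain n :: int where n: "Arg (x * y) - Arg x - Arg y = n * 2 * pi"
      by (auto simp: cos_one_2pi_int)
    have "u (x * y) - u x - u y = (Arg (x * y) - Arg x - Arg y) / (2 * pi)"
      using that unfolding u_def by (simp add: norm_mult ln_mult algebra_simps diff_divide_distrib add_divide_distrib)
    also have "\<dots> = n" unfolding n using pi_gt_zero by simp
    finally show ?thesis by simp
  qed
  show ?thesis
  proof (rule that)
    show "0 < \<theta> x \<and> \<theta> x < 1" if "x \<in> X" for x
      using notint[OF that] frac_gt_0_iff frac_lt_1 by (simp add: \<theta>_def)
  next
    fix x y assume xy: "x \<in> X" "y \<in> X"
    then have "x \<noteq> 0" "y \<noteq> 0" using X by auto
    from add[OF this] obtain k :: int where "u (x * y) = u x + u y + k"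
      by (metis Ints_cases add.commute diff_diff_eq diff_eq_eq)
    then have "frac (u (x * y)) = frac (u x + u y)" by (simp add: frac_def)
    then show "\<theta> (x * y) = \<theta> x + \<theta> y \<or> \<theta> (x * y) = \<theta> x + \<theta> y - 1"
      by (simp add: \<theta>_def frac_add)
  qed
qed

section \<open>Integer polynomials and their complex roots\<close>

lemma coeff_cpoly: "coeff (cpoly p) i = of_int (coeff p i)"
  by (simp add: cpoly_def coeff_map_poly)

lemma degree_cpoly: "degree (cpoly p) = degree p"
  by (simp add: cpoly_def degree_map_poly)

lemma poly_cpoly: "poly (cpoly p) z = (\<Sum>i\<le>degree p. of_int (coeff p i) * z ^ i)"
  by (simp add: poly_altdef coeff_cpoly degree_cpoly)

lemma cpoly_eq_0_iff: "cpoly p = 0 \<longleftrightarrow> p = 0"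
  by (metis coeff_cpoly degree_cpoly leading_coeff_0_iff of_int_eq_0_iff)

lemma cpoly_add: "cpoly (p + q) = cpoly p + cpoly q"
  by (rule poly_eqI) (simp add: coeff_cpoly)

lemma cpoly_sum: "cpoly (sum f A) = (\<Sum>x\<in>A. cpoly (f x))"
  by (induction A rule: infinite_finite_induct) (simp_all add: cpoly_add cpoly_eq_0_iff)

lemma cpoly_mult: "cpoly (p * q) = cpoly p * cpoly q"
  by (rule poly_eqI) (simp add: coeff_cpoly coeff_mult)

lemma cpoly_smult: "cpoly (smult c p) = smult (of_int c) (cpoly p)"
  by (rule poly_eqI) (simp add: coeff_cpoly)

lemma cpoly_monom: "cpoly (monom c n) = monom (of_int c) n"
  by (rule poly_eqI) (simp add: coeff_cpoly)

lemma poly_cpoly_of_int: "poly (cpoly p) (of_int k) = of_int (poly p k)"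
  by (simp add: poly_altdef coeff_cpoly degree_cpoly)

lemma finite_croots: "r \<noteq> 0 \<Longrightarrow> finite (croots r)"
  unfolding croots_def by (rule poly_roots_finite) (simp add: cpoly_eq_0_iff)

lemma pcompose_monom_monom:
  "pcompose (monom c k) (monom 1 h) = monom (c :: 'a :: comm_semiring_1) (k * h)"
proof (induction k)
  case (Suc k)
  then show ?case by (simp add: monom_Suc pcompose_pCons mult_monom)
qed (simp add: monom_0)

text \<open>The polynomials \<open>p_i\<close> in the expansion of \<open>p(t)\<close> as the sum of
  \<open>t^i p_i(t^h)\<close> over \<open>i < h\<close>.\<close>

definition poly_section :: "nat \<Rightarrow> 'a::comm_semiring_1 poly \<Rightarrow> nat \<Rightarrow> 'a poly" where
  "poly_section h p i = (\<Sum>n\<le>degree p. if n mod h = i then monom (coeff p n) (n div h) else 0)"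

lemma poly_section_decomp:
  fixes p :: "'a::comm_ring_1 poly"
  assumes "h > 0"
  shows "p = (\<Sum>i<h. monom 1 i * pcompose (poly_section h p i) (monom 1 h))"
proof -
  have "(\<Sum>i<h. monom 1 i * pcompose (poly_section h p i) (monom 1 h))
      = (\<Sum>i<h. \<Sum>n\<le>degree p. if n mod h = i then monom (coeff p n) n else 0)"
  proof (rule sum.cong[OF refl])
    fix i
    have "monom 1 i * pcompose (poly_section h p i) (monom 1 h)
       = (\<Sum>n\<le>degree p. monom 1 i * (if n mod h = i then monom (coeff p n) (n div h * h) else 0))"
      by (simp add: poly_section_def pcompose_sum sum_distrib_left if_distrib[of "\<lambda>q. pcompose q _"]
          pcompose_monom_monom cong: if_cong)
    also have "\<dots> = (\<Sum>n\<le>degree p. if n mod h = i then monom (coeff p n) n else 0)"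
      by (rule sum.cong) (auto simp: mult_monom)
    finally show "monom 1 i * pcompose (poly_section h p i) (monom 1 h) = \<dots>" .
  qed
  also have "\<dots> = (\<Sum>n\<le>degree p. \<Sum>i<h. if n mod h = i then monom (coeff p n) n else 0)"
    by (rule sum.swap)
  also have "\<dots> = (\<Sum>n\<le>degree p. monom (coeff p n) n)"
    using assms by (intro sum.cong) simp_all
  also have "\<dots> = p" by (rule poly_as_sum_of_monoms)
  finally show ?thesis by simp
qed

text \<open>\<open>s\<close> is the primitive integral minimal polynomial of \<open>z\<close>, and
  divisibility over the integers is Gauss's lemma: pseudo-division gives \<open>a q = s t\<close>,
  as the remainder has smaller degree, and \<open>a\<close> divides the content of \<open>t\<close>
  because \<open>s\<close> has content 1.\<close>

lemma ex_minimal_int_poly: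
  assumes "q0 \<noteq> 0" "poly (cpoly q0) z = 0"
  obtains s where "degree s > 0" "\<And>q. poly (cpoly q) z = 0 \<Longrightarrow> s dvd q"
proof -
  define P where "P q \<longleftrightarrow> q \<noteq> 0 \<and> poly (cpoly q) z = 0" for q
  obtain q1 where q1: "P q1" and min: "\<And>q. P q \<Longrightarrow> degree q1 \<le> degree q"
    using ex_has_least_nat[of P q0 degree] assms P_def by blast
  define s where "s = primitive_part q1"
  have cont: "content q1 \<noteq> 0" using q1 by (simp add: P_def)
  have q1s: "q1 = smult (content q1) s" by (simp add: s_def)
  have s0: "s \<noteq> 0" using q1 q1s by (auto simp: P_def)
  have deg: "degree s = degree q1" using q1s cont by (metis degree_smult_eq)
  have root: "poly (cpoly s) z = 0"
    using q1 cont q1s by (metis P_def cpoly_smult mult_eq_0_iff of_int_eq_0_iff poly_smult)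
  have content: "content s = 1" using q1 by (simp add: s_def P_def)
  show ?thesis
  proof (rule that)
    show "degree s > 0"
    proof (rule ccontr)
      assume "\<not> degree s > 0"
      then have "poly (cpoly s) z = of_int (coeff s 0)" by (simp add: poly_cpoly)
      then show False using root s0 \<open>\<not> degree s > 0\<close> by (simp add: leading_coeff_0_iff[symmetric] del: leading_coeff_0_iff)
    qed
  next
    fix q assume q: "poly (cpoly q) z = 0"
    obtain a t where a: "a \<noteq> 0" "smult a q = s * t + pseudo_mod q s"
      using pseudo_mod(1)[OF s0] by blast
    have "poly (cpoly (pseudo_mod q s)) z = 0"
      using arg_cong[OF a(2), of "\<lambda>p. poly (cpoly p) z"] q root
      by (simp add: cpoly_add cpoly_mult cpoly_smult)
    then have "pseudo_mod q s = 0"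
      using pseudo_mod(2)[OF s0, of q] min[of "pseudo_mod q s"] deg by (force simp: P_def)
    then have eq: "smult a q = s * t" using a(2) by simp
    have "content (smult a q) = content t" by (simp add: eq content_mult content)
    then have "normalize a dvd content t" by (metis content_smult dvd_triv_left)
    then have "a dvd content t" by simp
    then have "[:a:] dvd t" by (simp only: const_poly_dvd_iff_dvd_content)
    then obtain t' where "t = [:a:] * t'" by (rule dvdE)
    then have "smult a q = smult a (s * t')" using eq by simp
    then have "q = s * t'" using a(1) by (metis smult_cancel)
    then show "s dvd q" by simp
  qed
qed

text \<open>If \<open>r(0) r(1) r(t)\<close> were zero, everything would divide it, and
  \<open>u = 1\<close> with \<open>s(t) = t\<close> would show that \<open>r\<close> is bad.\<close>

lemma good_polyD:
  assumes "good_poly r"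
  shows "r \<noteq> 0" "0 \<notin> croots r" "1 \<notin> croots r"
proof -
  have nz: "smult (poly r 0 * poly r 1) r \<noteq> 0"
  proof
    assume "smult (poly r 0 * poly r 1) r = 0"
    then have "pcompose [:0, 1:] (monom 1 (1 + 1)) dvd smult (poly r 0 * poly r 1) r"
      by (simp only: dvd_0_right)
    then have "bad_poly r" unfolding bad_poly_def
      by (intro exI[of _ 1] exI[of _ "[:0, 1:]"]) simp
    then show False using assms by (simp add: good_poly_def)
  qed
  show "r \<noteq> 0" using nz by auto
  have "poly (cpoly r) (of_int 0) \<noteq> 0" "poly (cpoly r) (of_int 1) \<noteq> 0"
    unfolding poly_cpoly_of_int using nz by auto
  then show "0 \<notin> croots r" "1 \<notin> croots r" by (simp_all add: croots_def)
qed

text \<open>If all \<open>x y^j\<close> are roots, then \<open>y\<close> is a root of unity, of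
  order \<open>h\<close> at least 2 since 1 is no root. On these roots \<open>r(x y^j)\<close> is a
  polynomial \<open>Q\<close> in \<open>y^j\<close> of degree below \<open>h\<close>, with
  coefficients \<open>x^i r_i(x^h)\<close>. As \<open>Q\<close> has \<open>h\<close> zeros, all
  sections \<open>r_i\<close> vanish at \<open>x^h\<close> and are divisible by its minimal
  polynomial \<open>s\<close>. So \<open>s(t^h)\<close> divides \<open>r\<close>, and
  \<open>r\<close> is bad with \<open>u = h - 1\<close>.\<close>

theorem good_poly_arith_free:
  assumes good: "good_poly r" and x: "x \<in> croots r" and y: "y \<in> croots r"
  shows "\<exists>j. x * y ^ j \<notin> croots r"
proof (rule ccontr)
  assume "\<not> ?thesis"
  then have all: "x * y ^ j \<in> croots r" for j by blast
  note r = good_polyD[OF good]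
  have x0: "x \<noteq> 0" and y0: "y \<noteq> 0" and y1: "y \<noteq> 1" using r x y by auto
  have "finite (range (\<lambda>j. x * y ^ j))"
    by (rule finite_subset[OF _ finite_croots[OF r(1)]]) (use all in blast)
  then have "\<not> inj (\<lambda>j::nat. x * y ^ j)" using finite_imageD infinite_UNIV_nat by blast
  then obtain a b where "a < b" "x * y ^ a = x * y ^ b"
    unfolding inj_def by (metis linorder_neqE_nat)
  then have "y ^ (b - a) = 1" using x0 y0
    by (metis le_add_diff_inverse less_imp_le_nat mult_cancel_left mult_cancel_left2 power_add power_not_zero)
  then have ex: "\<exists>h>0. y ^ h = 1" using \<open>a < b\<close> by (intro exI[of _ "b - a"]) simp
  define h where "h = (LEAST h. h > 0 \<and> y ^ h = 1)"
  have h: "h > 0" "y ^ h = 1" using LeastI_ex[OF ex] by (simp_all add: h_def)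
  have hmin: "k \<ge> h" if "k > 0" "y ^ k = 1" for k
    unfolding h_def by (rule Least_le) (use that in simp)
  have "h \<noteq> 1" using h y1 by auto
  then have h2: "h \<ge> 2" using h(1) by linarith
  have inj: "inj_on (\<lambda>j. y ^ j) {..<h}"
  proof (rule linorder_inj_onI)
    fix i j assume ij: "i < j" "i \<in> {..<h}" "j \<in> {..<h}"
    show "y ^ i \<noteq> y ^ j"
    proof
      assume "y ^ i = y ^ j"
      then have "y ^ (j - i) = 1" using y0 ij(1)
        by (metis le_add_diff_inverse less_imp_le_nat mult_cancel_left2 power_add power_not_zero)
      then show False using hmin[of "j - i"] ij by auto
    qed
  qed auto
  define S where "S i = poly_section h r i" for i
  define z where "z = x ^ h"
  define Q where "Q = (\<Sum>i<h. monom (x ^ i * poly (cpoly (S i)) z) i)"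
  have cs: "poly (cpoly (pcompose p (monom 1 h))) w = poly (cpoly p) (w ^ h)" for p w
  proof -
    have "cpoly (pcompose p (monom 1 h)) = pcompose (cpoly p) (monom 1 h)"
    proof -
      have "cpoly (pcompose p (monom 1 h)) = (\<Sum>i\<le>degree p. monom (of_int (coeff p i)) (i * h))"
        by (subst (1) poly_as_sum_of_monoms[of p, symmetric])
           (simp add: pcompose_sum pcompose_monom_monom cpoly_sum cpoly_monom)
      also have "\<dots> = pcompose (cpoly p) (monom 1 h)"
        using arg_cong[OF poly_as_sum_of_monoms[of "cpoly p"], of "\<lambda>q. pcompose q (monom 1 h)"]
        by (simp add: pcompose_sum pcompose_monom_monom coeff_cpoly degree_cpoly)
      finally show ?thesis .
    qed
    then show ?thesis by (simp add: poly_pcompose poly_monom)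
  qed
  have root: "poly Q (y ^ j) = 0" for j
  proof -
    have "(x * y ^ j) ^ h = z"
      using h(2) by (simp add: z_def power_mult_distrib flip: power_mult) (simp add: power_mult mult.commute[of j])
    then have "poly (cpoly r) (x * y ^ j) = (\<Sum>i<h. (x * y ^ j) ^ i * poly (cpoly (S i)) z)"
      by (subst poly_section_decomp[OF h(1), of r])
         (simp add: cpoly_sum poly_sum cpoly_mult cpoly_monom poly_monom cs S_def)
    also have "\<dots> = poly Q (y ^ j)"
      by (simp add: Q_def poly_sum poly_monom power_mult_distrib ac_simps)
    finally show ?thesis using all[of j] by (simp add: croots_def)
  qed
  have "Q = 0"
  proof (rule ccontr)
    assume Q0: "Q \<noteq> 0"
    have "card ((\<lambda>j. y ^ j) ` {..<h}) \<le> card {w. poly Q w = 0}"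
      by (rule card_mono[OF poly_roots_finite[OF Q0]]) (use root in auto)
    then have "h \<le> degree Q" using card_poly_roots_bound[OF Q0] inj by (simp add: card_image)
    moreover have "degree Q \<le> h - 1"
      unfolding Q_def by (rule degree_sum_le) (auto intro: order_trans[OF degree_monom_le])
    ultimately show False using h(1) by linarith
  qed
  then have "coeff Q i = 0" for i by simp
  then have Si: "poly (cpoly (S i)) z = 0" if "i < h" for i
    using that x0 spec[of "\<lambda>i. coeff Q i = 0" i] by (simp add: Q_def coeff_sum)
  have "\<exists>i<h. S i \<noteq> 0"
  proof (rule ccontr)
    assume "\<not> ?thesis"
    then have "r = 0"
      by (subst poly_section_decomp[OF h(1), of r]) (simp add: S_def[symmetric])
    then show False using r(1) by simp
  qed
  then obtain i0 where "i0 < h" "S i0 \<noteq> 0" by blast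
  then obtain s where s: "degree s > 0" "\<And>q. poly (cpoly q) z = 0 \<Longrightarrow> s dvd q"
    using ex_minimal_int_poly[of "S i0" z] Si by metis
  have "pcompose s (monom 1 h) dvd r"
  proof (subst poly_section_decomp[OF h(1), of r], rule dvd_sum)
    fix i assume "i \<in> {..<h}"
    then obtain t where "S i = s * t" using s(2)[OF Si] by (auto elim: dvdE)
    then have "pcompose (S i) (monom 1 h) = pcompose s (monom 1 h) * pcompose t (monom 1 h)"
      by (simp add: pcompose_mult)
    then show "pcompose s (monom 1 h) dvd monom 1 i * pcompose (poly_section h r i) (monom 1 h)"
      by (simp add: S_def)
  qed
  then have "pcompose s (monom 1 ((h - 1) + 1)) dvd smult (poly r 0 * poly r 1) r"
    using h(1) by (simp add: dvd_smult)
  then have "bad_poly r" unfolding bad_poly_def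
    using s(1) h2 by (intro exI[of _ "h - 1"] exI[of _ s]) auto
  then show False using good by (simp add: good_poly_def)
qed

subsection \<open>Finitely generated rings of algebraic integers\<close>

text \<open>Finite generation as an additive group is the form of integrality used here: it bounds
  denominators in \<open>fg_subring_rational\<close> and gives independent generators in
  \<open>ex_splitting\<close>.\<close>

definition fg_subring :: "complex set \<Rightarrow> bool" where
  "fg_subring R \<longleftrightarrow> 1 \<in> R \<and> (\<forall>x\<in>R. \<forall>y\<in>R. x * y \<in> R) \<and> (\<exists>S. finite S \<and> R = group_closure S)"

lemma fg_subring_add_subgroup: "fg_subring R \<Longrightarrow> add_subgroup R"
  by (auto simp: fg_subring_def add_subgroup_group_closure)

lemma fg_subring_mult: "fg_subring R \<Longrightarrow> x \<in> R \<Longrightarrow> y \<in> R \<Longrightarrow> x * y \<in> R"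
  by (simp add: fg_subring_def)

lemma fg_subring_one: "fg_subring R \<Longrightarrow> 1 \<in> R"
  by (simp add: fg_subring_def)

lemma add_subgroup_of_int_mult:
  fixes A :: "'v::ring_1 set"
  assumes "add_subgroup A" "x \<in> A"
  shows "of_int k * x \<in> A"
proof -
  have "of_nat n * x \<in> A" for n
    by (induction n) (simp_all add: algebra_simps add_subgroup_zero add_subgroup_add assms)
  then show ?thesis
    using add_subgroup_uminus[OF assms(1)] by (cases k rule: int_cases2) auto
qed

lemma fg_subring_of_int: "fg_subring R \<Longrightarrow> of_int k \<in> R"
  using add_subgroup_of_int_mult[OF fg_subring_add_subgroup fg_subring_one, of R k] by simp

lemma fg_subring_power: "fg_subring R \<Longrightarrow> x \<in> R \<Longrightarrow> x ^ k \<in> R"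
  by (induction k) (simp_all add: fg_subring_one fg_subring_mult)

lemma fg_subring_prod: "fg_subring R \<Longrightarrow> (\<And>i. i \<in> I \<Longrightarrow> f i \<in> R) \<Longrightarrow> prod f I \<in> R"
  by (induction I rule: infinite_finite_induct) (simp_all add: fg_subring_one fg_subring_mult)

lemma group_closure_times:
  fixes A B :: "'v::ring set"
  assumes "x \<in> group_closure A" "y \<in> group_closure B"
  shows "x * y \<in> group_closure {a * b | a b. a \<in> A \<and> b \<in> B}" (is "_ \<in> ?C")
proof -
  have C: "add_subgroup ?C" by (rule add_subgroup_group_closure)
  have 1: "a * y \<in> ?C" if a: "a \<in> A" for a
  proof -
    have "add_subgroup {y. a * y \<in> ?C}"
      by (simp add: add_subgroup_def right_diff_distrib group_closure.diff)
    moreover have "B \<subseteq> {y. a * y \<in> ?C}" using a by (auto intro!: group_closure_base)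
    ultimately show ?thesis using group_closure_least assms(2) by blast
  qed
  have "add_subgroup {x. x * y \<in> ?C}"
    by (simp add: add_subgroup_def left_diff_distrib group_closure.diff)
  moreover have "A \<subseteq> {x. x * y \<in> ?C}" using 1 by auto
  ultimately show ?thesis using group_closure_least assms(1) by blast
qed

text \<open>\<open>R'\<close> is the ring \<open>R[\<alpha>]\<close>. The monic equation rewrites
  high powers of \<open>\<alpha>\<close>, so the generators of \<open>R\<close> times the powers
  below the degree generate it additively.\<close>

lemma fg_subring_adjoin:
  assumes R: "fg_subring R" and p: "lead_coeff p = 1" "poly (cpoly p) \<alpha> = 0"
  obtains R' where "fg_subring R'" "R \<subseteq> R'" "\<alpha> \<in> R'"
proof -
  obtain S where S: "finite S" "R = group_closure S" using R by (auto simp: fg_subring_def)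
  note Rsub = fg_subring_add_subgroup[OF R]
  let ?d = "degree p"
  define R' where "R' = {poly q \<alpha> | q. \<forall>i. coeff q i \<in> R}"
  let ?P = "group_closure {\<alpha> ^ i | i. i < ?d}"
  define S' where "S' = {s * t | s t. s \<in> S \<and> t \<in> {\<alpha> ^ i | i. i < ?d}}"
  have pow: "\<alpha> ^ k \<in> ?P" for k
  proof (induction k rule: less_induct)
    case (less k)
    show ?case
    proof (cases "k < ?d")
      case False
      have "0 = (\<Sum>i\<le>?d. of_int (coeff p i) * \<alpha> ^ i)" using p(2) by (simp add: poly_cpoly)
      also have "\<dots> = (\<Sum>i<?d. of_int (coeff p i) * \<alpha> ^ i) + \<alpha> ^ ?d"
        using p(1) by (simp add: lessThan_Suc_atMost[symmetric])
      finally have "\<alpha> ^ ?d = - (\<Sum>i<?d. of_int (coeff p i) * \<alpha> ^ i)"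
        by (metis add.commute eq_neg_iff_add_eq_0)
      then have "\<alpha> ^ k = - (\<Sum>i<?d. of_int (coeff p i) * \<alpha> ^ i) * \<alpha> ^ (k - ?d)"
        using False by (metis le_add_diff_inverse not_le power_add)
      also have "\<dots> = - (\<Sum>i<?d. of_int (coeff p i) * \<alpha> ^ (k - ?d + i))"
        by (simp add: sum_distrib_left power_add ac_simps)
      also have "\<dots> \<in> ?P"
        using False
        by (intro add_subgroup_uminus add_subgroup_sum add_subgroup_of_int_mult less.IH
            add_subgroup_group_closure) auto
      finally show ?thesis .
    qed (auto intro: group_closure_base)
  qed
  have R'eq: "R' = group_closure S'"
  proof (rule antisym)
    show "R' \<subseteq> group_closure S'"
    proof
      fix x assume "x \<in> R'"
      then obtain q where q: "\<And>i. coeff q i \<in> R" "x = poly q \<alpha>" by (auto simp: R'_def)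
      have "coeff q i * \<alpha> ^ i \<in> group_closure S'" for i
        unfolding S'_def by (rule group_closure_times) (use q(1) S(2) pow in auto)
      then show "x \<in> group_closure S'"
        unfolding q(2) poly_altdef by (intro add_subgroup_sum add_subgroup_group_closure)
    qed
  next
    have "add_subgroup R'"
      unfolding add_subgroup_def
    proof (intro conjI ballI)
      show "0 \<in> R'" unfolding R'_def using add_subgroup_zero[OF Rsub] by (auto intro: exI[of _ 0])
    next
      fix x y assume "x \<in> R'" "y \<in> R'"
      then obtain p q where "\<And>i. coeff p i \<in> R" "x = poly p \<alpha>" "\<And>i. coeff q i \<in> R" "y = poly q \<alpha>"
        by (auto simp: R'_def)
      then show "x - y \<in> R'" unfolding R'_def
        by (intro CollectI exI[of _ "p - q"]) (auto intro: add_subgroup_diff[OF Rsub])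
    qed
    moreover have "S' \<subseteq> R'"
    proof
      fix x assume "x \<in> S'"
      then obtain s i where "s \<in> S" "x = s * \<alpha> ^ i" by (auto simp: S'_def)
      then show "x \<in> R'" unfolding R'_def
        using S(2) add_subgroup_zero[OF Rsub]
        by (intro CollectI exI[of _ "monom s i"]) (auto simp: poly_monom intro: group_closure_base)
    qed
    ultimately show "group_closure S' \<subseteq> R'" by (intro group_closure_least)
  qed
  show ?thesis
  proof (rule that)
    show "R \<subseteq> R'"
    proof
      fix x assume "x \<in> R"
      then show "x \<in> R'" unfolding R'_def using add_subgroup_zero[OF Rsub]
        by (intro CollectI exI[of _ "[:x:]"]) (auto simp: coeff_pCons split: nat.split)
    qed
    then have one: "1 \<in> R'" using fg_subring_one[OF R] by blast
    show "\<alpha> \<in> R'" unfolding R'_def using add_subgroup_zero[OF Rsub] fg_subring_one[OF R]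
      by (intro CollectI exI[of _ "monom 1 1"]) (auto simp: poly_monom)
    have "S' = (\<lambda>(s, i). s * \<alpha> ^ i) ` (S \<times> {..<?d})"
      unfolding S'_def by force
    then have fin: "finite S'" using S(1) by simp
    have "x * y \<in> R'" if x: "x \<in> R'" and y: "y \<in> R'" for x y
    proof -
      obtain p q where pq: "\<And>i. coeff p i \<in> R" "x = poly p \<alpha>" "\<And>i. coeff q i \<in> R" "y = poly q \<alpha>"
        using x y by (auto simp: R'_def)
      then show ?thesis unfolding R'_def
        by (intro CollectI exI[of _ "p * q"])
           (auto simp: coeff_mult intro!: add_subgroup_sum[OF Rsub] fg_subring_mult[OF R])
    qed
    then show "fg_subring R'" unfolding fg_subring_def using one fin R'eq by blast
  qed
qed

lemma fg_subring_exists: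
  assumes "finite A" "\<And>\<alpha>. \<alpha> \<in> A \<Longrightarrow> \<exists>p. lead_coeff p = 1 \<and> poly (cpoly p) \<alpha> = 0"
  obtains R where "fg_subring R" "A \<subseteq> R"
proof -
  have "\<exists>R. fg_subring R \<and> A \<subseteq> R"
    using assms
  proof (induction A rule: finite_induct)
    case empty
    have "x * y \<in> group_closure {1}" if "x \<in> group_closure {1}" "y \<in> group_closure {1}" for x y :: complex
      using group_closure_times[OF that] by simp
    then have "fg_subring (group_closure {1})"
      unfolding fg_subring_def by (auto intro: group_closure_base exI[of _ "{1}"])
    then show ?case by blast
  next
    case (insert \<alpha> A)
    then obtain R p where "fg_subring R" "A \<subseteq> R" "lead_coeff p = 1" "poly (cpoly p) \<alpha> = 0" by blast
    then show ?case using fg_subring_adjoin[of R p \<alpha>] by (metis insert_subset subset_trans)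
  qed
  then show ?thesis using that by blast
qed

text \<open>In lowest terms \<open>q = u / v\<close>, every power of \<open>v\<close> divides
  \<open>D\<close>.\<close>

lemma rat_bounded_denominators:
  fixes q :: rat
  assumes "D \<noteq> 0" "\<And>k. of_int D * q ^ k \<in> \<int>"
  shows "q \<in> \<int>"
proof -
  obtain u v where uv: "quotient_of q = (u, v)" by (cases "quotient_of q")
  have v: "v > 0" and cop: "coprime u v" and q: "q = of_int u / of_int v"
    using quotient_of_denom_pos[OF uv] quotient_of_coprime[OF uv] quotient_of_div[OF uv] by auto
  have dvd: "v ^ k dvd D" for k
  proof -
    obtain m where "of_int D * q ^ k = of_int m" using assms(2)[of k] by (auto elim: Ints_cases)
    then have "(of_int (D * u ^ k) :: rat) = of_int (m * v ^ k)"
      using v by (simp add: q power_divide field_simps)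
    then have "D * u ^ k = m * v ^ k" by (simp only: of_int_eq_iff)
    then have "v ^ k dvd D * u ^ k" by simp
    moreover have "coprime (v ^ k) (u ^ k)" using cop by (simp add: coprime_commute)
    ultimately show ?thesis by (simp add: coprime_dvd_mult_left_iff)
  qed
  have "v = 1"
  proof (rule ccontr)
    assume "v \<noteq> 1"
    then have "v \<ge> 2" using v by linarith
    \<comment> \<open>This exponent is large enough, since \<open>2^|D|\<close> exceeds
      \<open>|D|\<close>.\<close>
    let ?k = "nat \<bar>D\<bar>"
    have "\<bar>D\<bar> < 2 ^ ?k" using of_nat_less_two_power[of ?k, where ?'a = int] by simp
    also have "\<dots> \<le> v ^ ?k" using \<open>v \<ge> 2\<close> by (intro power_mono) auto
    also have "\<dots> \<le> \<bar>D\<bar>" using dvd_imp_le_int[OF assms(1) dvd[of ?k]] v by simp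
    finally show False by simp
  qed
  then show ?thesis using q by simp
qed

text \<open>All powers of \<open>x\<close> stay in \<open>R\<close>. A functional \<open>g\<close>
  to the rationals, linear over them and with \<open>g 1 = 1\<close>, has a common denominator
  \<open>D\<close> on the finitely generated group \<open>R\<close>, and it fixes the powers of the
  rational number \<open>x\<close>. So these powers have bounded denominators.\<close>

lemma fg_subring_rational:
  assumes R: "fg_subring R" and x: "x \<in> R" "x \<in> \<rat>"
  shows "x \<in> \<int>"
proof -
  obtain S where S: "finite S" "R = group_closure S" using R by (auto simp: fg_subring_def)
  interpret vector_space_pair "\<lambda>q (z::complex). of_rat q * z" "\<lambda>q (r::rat). q * r"
    by unfold_locales (simp_all add: algebra_simps of_rat_add of_rat_mult)
  have "vs1.independent {1}" by (simp add: vs1.dependent_single)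
  from linear_independent_extend[OF this, of "\<lambda>_. 1"] obtain g
    where g1: "g 1 = (1::rat)" and g: "Vector_Spaces.linear (\<lambda>q (z::complex). of_rat q * z) (\<lambda>q (r::rat). q * r) g"
    by auto
  have "\<exists>D::int. D \<noteq> 0 \<and> (\<forall>s\<in>S. of_int D * g s \<in> \<int>)"
    using S(1)
  proof (induction S rule: finite_induct)
    case (insert s S)
    then obtain D where D: "D \<noteq> 0" "\<And>s. s \<in> S \<Longrightarrow> of_int D * g s \<in> \<int>" by blast
    obtain u v where uv: "quotient_of (g s) = (u, v)" by (cases "quotient_of (g s)")
    have v: "v > 0" "g s = of_int u / of_int v"
      using quotient_of_denom_pos[OF uv] quotient_of_div[OF uv] by auto
    have "of_int (D * v) * g t \<in> \<int>" if "t \<in> insert s S" for t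
    proof (cases "t = s")
      case True
      then have "of_int (D * v) * g t = of_int (D * u)" using v by simp
      then show ?thesis by (simp only: Ints_of_int)
    next
      case False
      then have "of_int D * g t \<in> \<int>" using that D(2) by blast
      then have "of_int v * (of_int D * g t) \<in> \<int>" using Ints_mult[OF Ints_of_int] by blast
      moreover have "of_int (D * v) * g t = of_int v * (of_int D * g t)" by simp
      ultimately show ?thesis by (simp only:)
    qed
    then show ?case using D(1) v(1) by (intro exI[of _ "D * v"]) auto
  qed (auto intro: exI[of _ 1])
  then obtain D :: int where D: "D \<noteq> 0" "\<And>s. s \<in> S \<Longrightarrow> of_int D * g s \<in> \<int>" by blast
  have "R \<subseteq> {y. of_int D * g y \<in> \<int>}"
    unfolding S(2)
    by (rule group_closure_least)
       (use D in \<open>auto simp: add_subgroup_def linear_0[OF g] linear_diff[OF g] right_diff_distrib\<close>)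
  then have DR: "of_int D * g y \<in> \<int>" if "y \<in> R" for y using that by blast
  obtain q where q: "x = of_rat q" using x(2) by (auto elim: Rats_cases)
  have "of_int D * q ^ k \<in> \<int>" for k
  proof -
    have "g (of_rat (q ^ k) * 1) = q ^ k * g 1" by (rule linear_scale[OF g])
    then show ?thesis using DR[OF fg_subring_power[OF R x(1), of k]] g1 q by (simp add: of_rat_power)
  qed
  then have "q \<in> \<int>" by (rule rat_bounded_denominators[OF D(1)])
  then show ?thesis using q by (auto elim!: Ints_cases)
qed

text \<open>For finite \<open>S\<close>, linear independence of 1 together with the elements of
  \<open>S\<close> over the rationals. Relations with any rational value are excluded, not only
  those with value 0; this makes the coefficient of 1 unique in \<open>ex_splitting\<close>.\<close>

definition int_indep :: "complex set \<Rightarrow> bool" where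
  "int_indep S \<longleftrightarrow> (\<forall>c. (\<Sum>s\<in>S. of_int (c s) * s) \<in> \<rat> \<longrightarrow> (\<forall>s\<in>S. c s = 0))"

text \<open>Euclid's algorithm on the coefficients of a relation between generators shows that a
  generating set of minimal size is independent over the rationals.\<close>

lemma relation_reduces:
  fixes S :: "complex set"
  assumes "finite S" "group_closure (insert 1 S) = R" "R \<inter> \<rat> \<subseteq> \<int>"
    and "(\<Sum>s\<in>S. of_int (c s) * s) \<in> \<rat>" "s0 \<in> S" "c s0 \<noteq> 0"
  shows "\<exists>S'. finite S' \<and> card S' < card S \<and> group_closure (insert 1 S') = R"
  using assms
proof (induction "nat (\<Sum>s\<in>S. \<bar>c s\<bar>)" arbitrary: S c s0 rule: less_induct)
  case less
  show ?case
  proof (cases "\<exists>t\<in>S. t \<noteq> s0 \<and> c t \<noteq> 0")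
    case False
    then have "(\<Sum>s\<in>S. of_int (c s) * s) = of_int (c s0) * s0"
      using less.prems(1,5) by (subst sum.remove[of _ s0]) (auto intro!: sum.neutral)
    then have "of_int (c s0) * s0 / of_int (c s0) \<in> \<rat>"
      using less.prems(4) by (intro Rats_divide) auto
    then have "s0 \<in> \<rat>" using less.prems(6) by simp
    moreover have "s0 \<in> R" using less.prems(2,5) by (auto intro: group_closure_base)
    ultimately obtain k where k: "s0 = of_int k" using less.prems(3) by (auto elim: Ints_cases)
    let ?S = "S - {s0}"
    have "of_int k * 1 \<in> group_closure (insert (1::complex) ?S)"
      by (rule add_subgroup_of_int_mult[OF add_subgroup_group_closure]) (simp add: group_closure_base)
    then have "insert 1 S \<subseteq> group_closure (insert 1 ?S)"
      using k by (auto intro: group_closure_base)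
    then have "group_closure (insert 1 S) \<subseteq> group_closure (insert 1 ?S)"
      by (rule group_closure_least[OF _ add_subgroup_group_closure])
    moreover have "group_closure (insert 1 ?S) \<subseteq> group_closure (insert 1 S)"
      by (rule group_closure_mono) auto
    ultimately show ?thesis
      using less.prems(1,2) card_Diff1_less[OF less.prems(1,5)] by (intro exI[of _ ?S]) auto
  next
    case True
    then obtain t0 where "t0 \<in> S" "t0 \<noteq> s0" "c t0 \<noteq> 0" by blast
    then obtain s t where st: "s \<in> S" "t \<in> S" "s \<noteq> t" "c s \<noteq> 0" "c t \<noteq> 0" "\<bar>c t\<bar> \<le> \<bar>c s\<bar>"
      using less.prems(5,6) by (metis linear)
    \<comment> \<open>Replacing the generator \<open>t\<close> by \<open>w = t + e s\<close> changes
      the coefficient of \<open>s\<close> to \<open>c s - e * c t\<close>, while \<open>w\<close>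
      takes over \<open>c t\<close>. The sign \<open>e\<close> makes the coefficient of
      \<open>s\<close> smaller, because \<open>|c t|\<close> is at most
      \<open>|c s|\<close>.\<close>
    define e where "e = sgn (c s) * sgn (c t)"
    define w where "w = t + of_int e * s"
    have less_c: "\<bar>c s - e * c t\<bar> < \<bar>c s\<bar>"
      using st(4,5,6) by (cases "c s > 0"; cases "c t > 0") (auto simp: e_def)
    let ?S = "insert w (S - {t})"
    have closure: "group_closure (insert 1 ?S) = R"
    proof (rule antisym)
      have "w \<in> group_closure (insert 1 S)"
        unfolding w_def using st
        by (intro add_subgroup_add add_subgroup_of_int_mult add_subgroup_group_closure group_closure_base) auto
      then have "insert 1 ?S \<subseteq> R" using less.prems(2) by (auto intro: group_closure_base)
      then show "group_closure (insert 1 ?S) \<subseteq> R"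
        using less.prems(2) group_closure_least add_subgroup_group_closure by metis
      have "w - of_int e * s \<in> group_closure (insert 1 ?S)"
        using st
        by (intro add_subgroup_diff add_subgroup_of_int_mult add_subgroup_group_closure group_closure_base) auto
      then have "insert 1 S \<subseteq> group_closure (insert 1 ?S)"
        by (auto simp: w_def intro: group_closure_base)
      then show "R \<subseteq> group_closure (insert 1 ?S)"
        using less.prems(2) group_closure_least add_subgroup_group_closure by metis
    qed
    show ?thesis
    \<comment> \<open>If \<open>w\<close> is a generator already, exchanging \<open>t\<close> for it
      shrinks the set at once.\<close>
    proof (cases "w \<in> S - {t}")
      case True
      then have "card ?S < card S"
        using less.prems(1) st(2) by (metis card_Diff1_less insert_absorb)
      then show ?thesis using closure less.prems(1) by (intro exI[of _ ?S]) auto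
    next
      case False
      define c' where "c' = c(s := c s - e * c t, w := c t)"
      have ws: "w \<noteq> s" using False st by auto
      have card: "card ?S = card S"
        using False less.prems(1) card_Suc_Diff1[OF less.prems(1) st(2)] by simp
      define T where "T = S - {t} - {s}"
      have T: "finite T" "s \<notin> T" "t \<notin> T" "w \<notin> T" using False less.prems(1) by (auto simp: T_def)
      have S: "S = insert t (insert s T)" "?S = insert w (insert s T)"
        using st by (auto simp: T_def)
      have c'T: "c' x = c x" if "x \<in> T" for x using that T by (auto simp: c'_def)
      have c's: "c' s = c s - e * c t" "c' w = c t" using ws by (auto simp: c'_def)
      have "(\<Sum>x\<in>?S. of_int (c' x) * x) = of_int (c t) * w + (of_int (c s - e * c t) * s + (\<Sum>x\<in>T. of_int (c x) * x))"
        unfolding S(2) using T ws c's c'T by simp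
      also have "\<dots> = (\<Sum>x\<in>S. of_int (c x) * x)"
        unfolding S(1) using T st(3) by (simp add: w_def algebra_simps)
      finally have rel: "(\<Sum>x\<in>?S. of_int (c' x) * x) \<in> \<rat>" using less.prems(4) by simp
      have "(\<Sum>x\<in>?S. \<bar>c' x\<bar>) = \<bar>c t\<bar> + (\<bar>c s - e * c t\<bar> + (\<Sum>x\<in>T. \<bar>c x\<bar>))"
        unfolding S(2) using T ws c's c'T by simp
      also have "\<dots> < \<bar>c t\<bar> + (\<bar>c s\<bar> + (\<Sum>x\<in>T. \<bar>c x\<bar>))" using less_c by simp
      also have "\<dots> = (\<Sum>x\<in>S. \<bar>c x\<bar>)"
        unfolding S(1) using T st(3) by simp
      finally have sum_less: "(\<Sum>x\<in>?S. \<bar>c' x\<bar>) < (\<Sum>x\<in>S. \<bar>c x\<bar>)" .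
      have "0 \<le> (\<Sum>x\<in>?S. \<bar>c' x\<bar>)" by (rule sum_nonneg) simp
      then have lt: "nat (\<Sum>x\<in>?S. \<bar>c' x\<bar>) < nat (\<Sum>x\<in>S. \<bar>c x\<bar>)" using sum_less by linarith
      have "\<exists>S'. finite S' \<and> card S' < card ?S \<and> group_closure (insert 1 S') = R"
        by (rule less.hyps[OF lt _ closure less.prems(3) rel, of w])
           (use less.prems(1) c's st(5) in auto)
      then show ?thesis using card by simp
    qed
  qed
qed

lemma ex_int_indep_generators:
  fixes S :: "complex set"
  assumes "finite S" "group_closure (insert 1 S) = R" "R \<inter> \<rat> \<subseteq> \<int>"
  obtains S' where "finite S'" "group_closure (insert 1 S') = R" "int_indep S'"
proof -
  have "\<exists>S'. finite S' \<and> group_closure (insert 1 S') = R \<and> int_indep S'"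
    using assms
  proof (induction "card S" arbitrary: S rule: less_induct)
    case less
    show ?case
    proof (cases "int_indep S")
      case False
      then obtain c s0 where "(\<Sum>s\<in>S. of_int (c s) * s) \<in> \<rat>" "s0 \<in> S" "c s0 \<noteq> 0"
        by (auto simp: int_indep_def)
      from relation_reduces[OF less.prems this] show ?thesis using less.hyps less.prems(3) by blast
    qed (use less.prems in blast)
  qed
  then show ?thesis using that by blast
qed

text \<open>\<open>l\<close> reads off the coefficient of 1 with respect to independent generators.
  It is well defined since the difference of two representations is a relation with an integer
  value.\<close>

lemma ex_splitting:
  assumes R: "fg_subring R"
  obtains l :: "complex \<Rightarrow> int" where "\<And>x y. x \<in> R \<Longrightarrow> y \<in> R \<Longrightarrow> l (x + y) = l x + l y" "l 1 = 1"
proof -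
  obtain S0 where S0: "finite S0" "R = group_closure S0" using R by (auto simp: fg_subring_def)
  have "insert 1 S0 \<subseteq> group_closure S0" using S0(2) fg_subring_one[OF R] by (auto intro: group_closure_base)
  then have "group_closure (insert 1 S0) \<subseteq> group_closure S0"
    by (rule group_closure_least[OF _ add_subgroup_group_closure])
  moreover have "group_closure S0 \<subseteq> group_closure (insert 1 S0)"
    by (rule group_closure_mono) auto
  ultimately have "group_closure (insert 1 S0) = R" using S0(2) by simp
  moreover have "R \<inter> \<rat> \<subseteq> \<int>" using fg_subring_rational[OF R] by blast
  ultimately obtain S where S: "finite S" "group_closure (insert 1 S) = R" "int_indep S"
    using ex_int_indep_generators[OF S0(1)] by metis
  define rep where "rep x k \<longleftrightarrow> (\<exists>c. x = of_int k + (\<Sum>s\<in>S. of_int (c s) * s))" for x k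
  have rep_ex: "\<exists>k. rep x k" if "x \<in> R" for x
  proof -
    have "add_subgroup {x. \<exists>k. rep x k}"
      unfolding add_subgroup_def
    proof (intro conjI ballI)
      show "0 \<in> {x. \<exists>k. rep x k}" unfolding rep_def by (auto intro!: exI[of _ 0] exI[of _ "\<lambda>_. 0"])
    next
      fix x y assume "x \<in> {x. \<exists>k. rep x k}" "y \<in> {x. \<exists>k. rep x k}"
      then obtain k c k' c' where "x = of_int k + (\<Sum>s\<in>S. of_int (c s) * s)"
        "y = of_int k' + (\<Sum>s\<in>S. of_int (c' s) * s)" unfolding rep_def by blast
      then have "x - y = of_int (k - k') + (\<Sum>s\<in>S. of_int (c s - c' s) * s)"
        by (simp add: sum_subtractf algebra_simps)
      then show "x - y \<in> {x. \<exists>k. rep x k}" unfolding rep_def by (auto simp del: of_int_diff intro!: exI)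
    qed
    moreover have "insert 1 S \<subseteq> {x. \<exists>k. rep x k}"
    proof
      fix x assume "x \<in> insert 1 S"
      then consider "x = 1" | "x \<in> S" by blast
      then show "x \<in> {x. \<exists>k. rep x k}"
      proof cases
        case 1
        then show ?thesis unfolding rep_def by (auto intro!: exI[of _ 1] exI[of _ "\<lambda>_. 0"])
      next
        case 2
        have "x = of_int 0 + (\<Sum>s\<in>S. of_int (if s = x then 1 else 0) * s)"
          using S(1) 2 by (simp add: if_distrib[of of_int] if_distrib[of "\<lambda>z. z * _"] cong: if_cong)
        then show ?thesis unfolding rep_def mem_Collect_eq by (intro exI)
      qed
    qed
    ultimately have "R \<subseteq> {x. \<exists>k. rep x k}" using group_closure_least S(2) by metis
    then show ?thesis using that by blast
  qed
  have rep_unique: "k = k'" if kk': "rep x k" "rep x k'" for x k k'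
  proof -
    obtain c c' where c: "x = of_int k + (\<Sum>s\<in>S. of_int (c s) * s)"
        "x = of_int k' + (\<Sum>s\<in>S. of_int (c' s) * s)" using kk' unfolding rep_def by blast
    then have eq: "(\<Sum>s\<in>S. of_int (c s - c' s) * s) = of_int (k' - k)"
      by (simp add: sum_subtractf algebra_simps)
    then have "\<forall>s\<in>S. c s - c' s = 0"
      using S(3)[unfolded int_indep_def, rule_format, of "\<lambda>s. c s - c' s"] by simp
    then have "(\<Sum>s\<in>S. of_int (c s - c' s) * s) = 0" by simp
    then have "(of_int (k' - k) :: complex) = 0" using eq by simp
    then show "k = k'" by (simp only: of_int_eq_0_iff)
  qed
  have rep_add: "rep (x + y) (k + k')" if xy: "rep x k" "rep y k'" for x y k k'
  proof -
    obtain c c' where "x = of_int k + (\<Sum>s\<in>S. of_int (c s) * s)"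
        "y = of_int k' + (\<Sum>s\<in>S. of_int (c' s) * s)" using xy unfolding rep_def by blast
    then have "x + y = of_int (k + k') + (\<Sum>s\<in>S. of_int (c s + c' s) * s)"
      by (simp add: sum.distrib algebra_simps)
    then show ?thesis unfolding rep_def by (intro exI[of _ "\<lambda>s. c s + c' s"])
  qed
  define l where "l x = (THE k. rep x k)" for x
  have l: "rep x (l x)" if "x \<in> R" for x
    unfolding l_def using rep_ex[OF that] rep_unique by (metis theI)
  show ?thesis
  proof (rule that)
    show "l (x + y) = l x + l y" if "x \<in> R" "y \<in> R" for x y
      using rep_unique l[OF add_subgroup_add[OF fg_subring_add_subgroup[OF R] that]]
        rep_add[OF l[OF that(1)] l[OF that(2)]] by blast
    have "rep 1 1" unfolding rep_def by (auto intro!: exI[of _ "\<lambda>_. 0"])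
    then show "l 1 = 1" using rep_unique l[OF fg_subring_one[OF R]] by blast
  qed
qed

subsection \<open>Power sums and rationality\<close>

text \<open>Up to sign, its coefficients are the elementary symmetric functions of the values
  \<open>v p\<close>.\<close>

definition euler_fps :: "'i set \<Rightarrow> ('i \<Rightarrow> complex) \<Rightarrow> complex fps" where
  "euler_fps P v = (\<Prod>p\<in>P. 1 - fps_const (v p) * fps_X)"

definition power_sum_fps :: "'i set \<Rightarrow> ('i \<Rightarrow> complex) \<Rightarrow> complex fps" where
  "power_sum_fps P v = Abs_fps (\<lambda>s. if s = 0 then 0 else \<Sum>p\<in>P. v p ^ s)"

text \<open>Newton's identities in the form of a logarithmic derivative. Adding one factor to the
  product adds one geometric series to the power sums.\<close>

lemma newton_identity:
  assumes "finite P"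
  shows "euler_fps P v * power_sum_fps P v = - fps_X * fps_deriv (euler_fps P v)"
  using assms
proof (induction P rule: finite_induct)
  case empty
  then show ?case by (simp add: euler_fps_def power_sum_fps_def fps_eq_iff)
next
  case (insert p P)
  let ?E = "euler_fps P v" and ?S = "power_sum_fps P v" and ?w = "1 - fps_const (v p) * fps_X"
  define g where "g = Abs_fps (\<lambda>s. if s = 0 then 0 else v p ^ s)"
  have E: "euler_fps (insert p P) v = ?w * ?E"
    using insert by (simp add: euler_fps_def)
  have S: "power_sum_fps (insert p P) v = g + ?S"
    using insert by (auto simp: power_sum_fps_def g_def fps_eq_iff)
  have wg: "?w * g = fps_const (v p) * fps_X"
  proof (rule fps_ext)
    fix n
    show "fps_nth (?w * g) n = fps_nth (fps_const (v p) * fps_X) n"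
      by (cases n) (auto simp: g_def left_diff_distrib mult.assoc)
  qed
  have "euler_fps (insert p P) v * power_sum_fps (insert p P) v = ?E * (?w * g) + ?w * (?E * ?S)"
    unfolding E S by (simp add: algebra_simps)
  also have "\<dots> = ?E * (fps_const (v p) * fps_X) + ?w * (- fps_X * fps_deriv ?E)"
    unfolding wg insert.IH ..
  also have "\<dots> = - fps_X * fps_deriv (?w * ?E)"
    by (simp add: algebra_simps)
  finally show ?case unfolding E .
qed

lemma newton_coeff:
  assumes "finite P"
  shows "(\<Sum>i\<le>n. fps_nth (euler_fps P v) i * fps_nth (power_sum_fps P v) (n - i)) = - of_nat n * fps_nth (euler_fps P v) n"
proof -
  have "fps_nth (euler_fps P v * power_sum_fps P v) n = - of_nat n * fps_nth (euler_fps P v) n"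
    unfolding newton_identity[OF assms] by (cases n) (auto simp: algebra_simps)
  then show ?thesis by (simp add: fps_mult_nth atLeast0AtMost)
qed

lemma euler_fps_0: "finite P \<Longrightarrow> fps_nth (euler_fps P v) 0 = 1"
  by (induction P rule: finite_induct) (simp_all add: euler_fps_def)

lemma Rats_sum_closed: "(\<And>i. i \<in> I \<Longrightarrow> f i \<in> \<rat>) \<Longrightarrow> sum f I \<in> (\<rat> :: complex set)"
  by (induction I rule: infinite_finite_induct) (auto intro: Rats_add)

lemma sum_Times: "(\<Sum>p\<in>A \<times> B. f p) = (\<Sum>x\<in>A. \<Sum>y\<in>B. f (x, y))"
  by (simp add: sum.cartesian_product)

text \<open>Newton's identity can be solved for the \<open>n\<close>-th coefficient by dividing by
  \<open>n\<close>. Together with the converse below this passes rationality between symmetric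
  functions and power sums, in place of an argument with Galois groups.\<close>

lemma power_sums_rational_imp_euler:
  assumes P: "finite P" and rat: "\<And>s. s > 0 \<Longrightarrow> (\<Sum>p\<in>P. v p ^ s) \<in> \<rat>"
  shows "fps_nth (euler_fps P v) n \<in> \<rat>"
proof (induction n rule: less_induct)
  case (less n)
  show ?case
  proof (cases "n = 0")
    case True
    then show ?thesis using euler_fps_0[OF P] by simp
  next
    case False
    have "(\<Sum>i<n. fps_nth (euler_fps P v) i * fps_nth (power_sum_fps P v) (n - i)) = - of_nat n * fps_nth (euler_fps P v) n"
      using newton_coeff[OF P, of v n] by (simp add: lessThan_Suc_atMost[symmetric] power_sum_fps_def)
    moreover have "(\<Sum>i<n. fps_nth (euler_fps P v) i * fps_nth (power_sum_fps P v) (n - i)) \<in> \<rat>"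
      using less.IH rat by (intro Rats_sum_closed Rats_mult) (auto simp: power_sum_fps_def)
    ultimately have "- of_nat n * fps_nth (euler_fps P v) n / - of_nat n \<in> \<rat>"
      by (intro Rats_divide) auto
    then show ?thesis using False by simp
  qed
qed

lemma euler_rational_imp_power_sums:
  assumes P: "finite P" and rat: "\<And>n. fps_nth (euler_fps P v) n \<in> \<rat>"
  shows "s > 0 \<Longrightarrow> (\<Sum>p\<in>P. v p ^ s) \<in> \<rat>"
proof (induction s rule: less_induct)
  case (less s)
  have S: "fps_nth (power_sum_fps P v) k \<in> \<rat>" if "k < s" for k
    using less.IH[of k] that by (auto simp: power_sum_fps_def)
  have "{..s} = insert 0 {1..s}" by auto
  then have "fps_nth (euler_fps P v) 0 * fps_nth (power_sum_fps P v) s + (\<Sum>i=1..s. fps_nth (euler_fps P v) i * fps_nth (power_sum_fps P v) (s - i))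
      = - of_nat s * fps_nth (euler_fps P v) s"
    using newton_coeff[OF P, of v s] by simp
  then have "fps_nth (power_sum_fps P v) s = - of_nat s * fps_nth (euler_fps P v) s
      - (\<Sum>i=1..s. fps_nth (euler_fps P v) i * fps_nth (power_sum_fps P v) (s - i))"
    using euler_fps_0[OF P] by (simp add: algebra_simps)
  also have "\<dots> \<in> \<rat>"
    using less.prems by (intro Rats_diff Rats_mult Rats_sum_closed rat S) auto
  finally show ?case using less.prems by (simp add: power_sum_fps_def)
qed

lemma euler_fps_top:
  assumes "finite P"
  shows "fps_nth (euler_fps P v) (card P) = (\<Prod>p\<in>P. - v p) \<and> (\<forall>n>card P. fps_nth (euler_fps P v) n = 0)"
  using assms
proof (induction P rule: finite_induct)
  case (insert p P)
  have E: "fps_nth (euler_fps (insert p P) v) (Suc n) = fps_nth (euler_fps P v) (Suc n) - v p * fps_nth (euler_fps P v) n" for n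
    using insert by (simp add: euler_fps_def left_diff_distrib mult.assoc)
  have "fps_nth (euler_fps (insert p P) v) n = 0" if "n > card (insert p P)" for n
    using that insert E[of "n - 1"] by (cases n) auto
  then show ?case using insert E[of "card P"] by simp
qed (auto simp: euler_fps_def)

text \<open>Zero values do not affect power sums with positive exponent. So the nonzero values alone
  have rational elementary symmetric functions, and their product is the last of these up to
  sign.\<close>

lemma prod_nonzero_rational:
  assumes P: "finite P" and rat: "\<And>s. s > 0 \<Longrightarrow> (\<Sum>p\<in>P. v p ^ s) \<in> \<rat>"
  shows "(\<Prod>p\<in>{p\<in>P. v p \<noteq> 0}. v p) \<in> (\<rat> :: complex set)"
proof -
  let ?P = "{p\<in>P. v p \<noteq> 0}"
  have "(\<Sum>p\<in>?P. v p ^ s) = (\<Sum>p\<in>P. v p ^ s)" if "s > 0" for s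
    using P that by (intro sum.mono_neutral_left) auto
  then have "fps_nth (euler_fps ?P v) (card ?P) \<in> \<rat>"
    using P rat by (intro power_sums_rational_imp_euler) auto
  then have "(\<Prod>p\<in>?P. - v p) \<in> \<rat>" using euler_fps_top[of ?P v] P by simp
  moreover have "(\<Prod>p\<in>?P. v p) = (-1) ^ card ?P * (\<Prod>p\<in>?P. - v p)"
    by (simp add: prod_uminus flip: mult.assoc power_mult_distrib)
  ultimately show ?thesis by (simp add: Rats_mult)
qed

text \<open>Roots are counted without multiplicity, so \<open>r\<close> is replaced by its
  squarefree part over the rationals, the quotient by the gcd with the derivative. Because 0 is no
  root, reversing it gives a constant times the product of \<open>1 - z T\<close> over the distinct
  roots.\<close>

lemma croots_power_sum_rational:
  assumes r: "r \<noteq> 0" and nz: "0 \<notin> croots r"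
  shows "(\<Sum>x\<in>croots r. x ^ s) \<in> \<rat>"
proof (cases "degree r = 0")
  case True
  then obtain c where "r = [:c:]" using degree_eq_zeroE by blast
  then have "croots r = {}" using r by (auto simp: croots_def poly_cpoly)
  then show ?thesis by simp
next
  case False
  define h :: "rat poly" where "h = map_poly of_int r"
  define C :: "rat poly \<Rightarrow> complex poly" where "C = map_poly of_rat"
  have coeffC: "coeff (C p) i = of_rat (coeff p i)" for p i by (simp add: C_def coeff_map_poly)
  have Cmult: "C (p * q) = C p * C q" for p q
    by (rule poly_eqI) (simp add: coeffC coeff_mult of_rat_sum of_rat_mult)
  have Cadd: "C (p + q) = C p + C q" for p q
    by (rule poly_eqI) (simp add: coeffC of_rat_add)
  have Cpderiv: "C (pderiv p) = pderiv (C p)" for p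
    by (rule poly_eqI) (simp add: coeffC coeff_pderiv of_rat_mult flip: of_nat_Suc)
  have Ch: "C h = cpoly r"
    by (rule poly_eqI) (simp add: coeffC coeff_cpoly h_def coeff_map_poly)
  define g where "g = gcd h (pderiv h)"
  have pd: "pderiv (C h) \<noteq> 0"
    using False by (simp add: Ch pderiv_eq_0_iff degree_cpoly)
  define q where "q = h div g"
  have hq: "h = q * g" by (simp add: q_def g_def)
  have hd: "pderiv h = (pderiv h div g) * g" by (simp add: g_def)
  obtain u w where "g = u * h + w * pderiv h"
    unfolding g_def using bezout_coefficients_fst_snd[of h "pderiv h"] by metis
  then have "rsquarefree (C q) \<and> (\<forall>a. poly (C q) a = 0 \<longleftrightarrow> poly (C h) a = 0)"
    by (intro poly_squarefree_decomp[OF pd, of "C q" "C g" "C (pderiv h div g)" "C u" "C w"])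
       (metis hq Cmult, metis hd Cmult Cpderiv, metis Cadd Cmult Cpderiv)
  then have sq: "rsquarefree (C q)" and roots: "{z. poly (C q) z = 0} = croots r"
    by (auto simp: Ch croots_def)
  have Cq0: "C q \<noteq> 0" using sq by (simp add: rsquarefree_def)
  have "reflect_poly (C q) = reflect_poly (smult (lead_coeff (C q)) (\<Prod>z\<in>croots r. [:- z, 1:]))"
    using complex_poly_decompose_rsquarefree[OF sq] roots by simp
  also have "\<dots> = smult (lead_coeff (C q)) (\<Prod>z\<in>croots r. [:1, - z:])"
  proof -
    have "reflect_poly [:- z, 1:] = [:1, - z:]" if "z \<in> croots r" for z
      by (rule poly_eqI) (use that nz in \<open>auto simp: coeff_reflect_poly coeff_pCons split: nat.splits\<close>)
    then show ?thesis by (simp add: reflect_poly_smult reflect_poly_prod)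
  qed
  finally have rfl: "reflect_poly (C q) = smult (lead_coeff (C q)) (\<Prod>z\<in>croots r. [:1, - z:])" .
  have "fps_of_poly (\<Prod>z\<in>croots r. [:1, - z:]) = euler_fps (croots r) (\<lambda>z. z)"
    unfolding euler_fps_def fps_of_poly_prod fps_of_poly_linear'
    by (intro prod.cong refl) (simp add: fps_const_neg[symmetric] del: fps_const_neg)
  then have "lead_coeff (C q) * fps_nth (euler_fps (croots r) (\<lambda>z. z)) n = coeff (reflect_poly (C q)) n" for n
    using rfl by (metis coeff_smult fps_of_poly_nth)
  then have eq: "fps_nth (euler_fps (croots r) (\<lambda>z. z)) n = coeff (reflect_poly (C q)) n / lead_coeff (C q)" for n
    using Cq0 by (simp add: field_simps)
  have "fps_nth (euler_fps (croots r) (\<lambda>z. z)) n \<in> \<rat>" for n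
    unfolding eq by (auto simp: coeffC coeff_reflect_poly)
  then show ?thesis
    using euler_rational_imp_power_sums[OF finite_croots[OF r], of "\<lambda>z. z" s]
    by (cases "s = 0") auto
qed

text \<open>The power sums of the differences expand binomially into products of power sums of the
  roots.\<close>

lemma discr_product_rational:
  assumes r: "r \<noteq> 0" and nz: "0 \<notin> croots r"
  shows "(\<Prod>p \<in> {p \<in> croots r \<times> croots r. fst p \<noteq> snd p}. fst p - snd p) \<in> \<rat>"
proof -
  let ?X = "croots r"
  have "(\<Sum>p\<in>?X \<times> ?X. (fst p - snd p) ^ s) \<in> \<rat>" for s
  proof -
    have "(\<Sum>p\<in>?X \<times> ?X. (fst p - snd p) ^ s)
        = (\<Sum>x\<in>?X. \<Sum>y\<in>?X. \<Sum>k\<le>s. of_nat (s choose k) * (-1) ^ (s - k) * (x ^ k * y ^ (s - k)))"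
      unfolding sum_Times
    proof (intro sum.cong refl)
      fix x y :: complex
      have "(x - y) ^ s = (x + (- 1) * y) ^ s" by simp
      also have "\<dots> = (\<Sum>k\<le>s. of_nat (s choose k) * (-1) ^ (s - k) * (x ^ k * y ^ (s - k)))"
        unfolding binomial_ring by (simp only: power_mult_distrib ac_simps)
      finally show "(fst (x, y) - snd (x, y)) ^ s = \<dots>" by simp
    qed
    also have "\<dots> = (\<Sum>k\<le>s. of_nat (s choose k) * (-1) ^ (s - k) * ((\<Sum>x\<in>?X. x ^ k) * (\<Sum>y\<in>?X. y ^ (s - k))))"
    proof -
      have "(\<Sum>x\<in>?X. \<Sum>y\<in>?X. \<Sum>k\<le>s. of_nat (s choose k) * (-1) ^ (s - k) * (x ^ k * y ^ (s - k)))
        = (\<Sum>x\<in>?X. \<Sum>k\<le>s. \<Sum>y\<in>?X. of_nat (s choose k) * (-1) ^ (s - k) * (x ^ k * y ^ (s - k)))"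
        by (intro sum.cong refl sum.swap)
      also have "\<dots> = (\<Sum>k\<le>s. \<Sum>x\<in>?X. \<Sum>y\<in>?X. of_nat (s choose k) * (-1) ^ (s - k) * (x ^ k * y ^ (s - k)))"
        by (rule sum.swap)
      also have "\<dots> = (\<Sum>k\<le>s. of_nat (s choose k) * (-1) ^ (s - k) * ((\<Sum>x\<in>?X. x ^ k) * (\<Sum>y\<in>?X. y ^ (s - k))))"
        by (intro sum.cong refl, subst sum_product, simp only: sum_distrib_left)
      finally show ?thesis .
    qed
    also have "\<dots> \<in> \<rat>"
      by (intro Rats_sum_closed Rats_mult croots_power_sum_rational[OF r nz]) (auto intro: Rats_power)
    finally show ?thesis .
  qed
  then have "(\<Prod>p\<in>{p \<in> ?X \<times> ?X. fst p - snd p \<noteq> 0}. fst p - snd p) \<in> \<rat>"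
    by (intro prod_nonzero_rational) (auto simp: finite_croots[OF r])
  then show ?thesis by simp
qed

lemma cpoly_power: "cpoly (p ^ s) = cpoly p ^ s"
proof (induction s)
  case 0
  show ?case by (rule poly_eqI) (simp add: coeff_cpoly)
qed (simp add: cpoly_mult)

text \<open>The coefficients of \<open>r^s\<close> express the power sums of the values by squares
  of power sums of the roots.\<close>

lemma value_product_rational:
  assumes r: "r \<noteq> 0" and nz: "0 \<notin> croots r"
  shows "(\<Prod>p \<in> {p \<in> croots r \<times> croots r. poly (cpoly r) (fst p * snd p) \<noteq> 0}.
           poly (cpoly r) (fst p * snd p)) \<in> \<rat>"
proof (rule prod_nonzero_rational)
  let ?X = "croots r"
  fix s :: nat
  let ?q = "r ^ s"
  have "(\<Sum>p\<in>?X \<times> ?X. poly (cpoly r) (fst p * snd p) ^ s)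
      = (\<Sum>x\<in>?X. \<Sum>y\<in>?X. \<Sum>k\<le>degree ?q. of_int (coeff ?q k) * (x ^ k * y ^ k))"
    unfolding sum_Times
  proof (intro sum.cong refl)
    fix x y :: complex
    have "poly (cpoly r) (x * y) ^ s = poly (cpoly ?q) (x * y)" by (simp add: cpoly_power)
    then show "poly (cpoly r) (fst (x, y) * snd (x, y)) ^ s
        = (\<Sum>k\<le>degree ?q. of_int (coeff ?q k) * (x ^ k * y ^ k))"
      unfolding poly_cpoly by (simp add: power_mult_distrib)
  qed
  also have "\<dots> = (\<Sum>k\<le>degree ?q. of_int (coeff ?q k) * ((\<Sum>x\<in>?X. x ^ k) * (\<Sum>y\<in>?X. y ^ k)))"
  proof -
    have "(\<Sum>x\<in>?X. \<Sum>y\<in>?X. \<Sum>k\<le>degree ?q. of_int (coeff ?q k) * (x ^ k * y ^ k))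
      = (\<Sum>x\<in>?X. \<Sum>k\<le>degree ?q. \<Sum>y\<in>?X. of_int (coeff ?q k) * (x ^ k * y ^ k))"
      by (intro sum.cong refl sum.swap)
    also have "\<dots> = (\<Sum>k\<le>degree ?q. \<Sum>x\<in>?X. \<Sum>y\<in>?X. of_int (coeff ?q k) * (x ^ k * y ^ k))"
      by (rule sum.swap)
    also have "\<dots> = (\<Sum>k\<le>degree ?q. of_int (coeff ?q k) * ((\<Sum>x\<in>?X. x ^ k) * (\<Sum>y\<in>?X. y ^ k)))"
        by (intro sum.cong refl, subst sum_product, simp only: sum_distrib_left)
      finally show ?thesis .
  qed
  also have "\<dots> \<in> \<rat>"
    by (intro Rats_sum_closed Rats_mult croots_power_sum_rational[OF r nz]) auto
  finally show "(\<Sum>p\<in>?X \<times> ?X. poly (cpoly r) (fst p * snd p) ^ s) \<in> \<rat>" .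
qed (simp add: finite_croots[OF r])

subsection \<open>The torsion number\<close>

text \<open>For the third bound, one root has the maximal multiplicity, every other root at least 1,
  and the multiplicities add up to at most the degree.\<close>

lemma card_croots_max_mult:
  assumes r: "r \<noteq> 0" and d: "degree r > 0"
  shows "card (croots r) \<ge> 1" "max_mult r \<ge> 1" "card (croots r) + max_mult r \<le> degree r + 1"
proof -
  let ?X = "croots r" and ?o = "\<lambda>z. order z (cpoly r)"
  have fin: "finite ?X" by (rule finite_croots[OF r])
  have "\<not> constant (poly (cpoly r))"
    using d by (metis constant_degree degree_cpoly less_irrefl)
  then have ne: "?X \<noteq> {}" unfolding croots_def using fundamental_theorem_of_algebra by blast
  then show "card ?X \<ge> 1" using fin by (simp add: Suc_le_eq card_gt_0_iff)
  have o1: "?o z \<ge> 1" if "z \<in> ?X" for z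
    using that r by (simp add: croots_def order_root cpoly_eq_0_iff Suc_le_eq)
  obtain z0 where z0: "z0 \<in> ?X" "max_mult r = ?o z0"
    unfolding max_mult_def using Max_in[of "?o ` ?X"] fin ne by (metis (no_types, lifting) finite_imageI image_iff image_is_empty)
  show "max_mult r \<ge> 1" using z0 o1 by simp
  have "card ?X - 1 = (\<Sum>z\<in>?X - {z0}. 1)" using z0(1) by simp
  also have "\<dots> \<le> (\<Sum>z\<in>?X - {z0}. ?o z)" using o1 by (intro sum_mono) auto
  finally have "card ?X - 1 + ?o z0 \<le> (\<Sum>z\<in>?X. ?o z)"
    using sum.remove[OF fin z0(1), of ?o] by simp
  also have "\<dots> \<le> degree r"
    using sum_order_le_degree[of "cpoly r"] r by (simp add: croots_def cpoly_eq_0_iff degree_cpoly)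
  finally show "card ?X + max_mult r \<le> degree r + 1" using z0(2) \<open>card ?X \<ge> 1\<close> by simp
qed

text \<open>For \<open>k\<close> differences to the power \<open>m\<close> and \<open>e\<close>
  values, \<open>k * m + 2 * d * e\<close> factors \<open>a\<close> are needed to make all of them
  integral. Strictness leaves one more factor \<open>a\<close>.\<close>

lemma torsion_exponent_bound:
  fixes l m d e k :: nat
  assumes "1 \<le> m" "l + m \<le> d + 1" "e \<le> l * l" "k \<le> l * l"
  shows "k * m + 2 * d * e < 1 + 2 * d ^ 2 + 2 * d ^ 3"
proof -
  have "l \<le> d" using assms(1,2) by linarith
  then obtain j where d: "d = l + j" using le_Suc_ex by blast
  have m: "m \<le> j + 1" using assms(2) d by simp
  have "k * m + 2 * d * e \<le> l * l * (j + 1) + 2 * d * (l * l)"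
    using assms(3,4) m by (intro add_mono mult_mono) auto
  also have "\<dots> < 1 + 2 * d ^ 2 + 2 * d ^ 3"
    unfolding d by (simp add: power2_eq_square power3_eq_cube algebra_simps)
  finally show ?thesis .
qed

text \<open>For nonconstant \<open>r\<close>, distributing the powers of \<open>a\<close> turns the
  number into \<open>a * a^e * (m - 1)! * pD^m * pV\<close>, where \<open>pD\<close> and
  \<open>pV\<close> are products of integral differences and values. So it lies in \<open>R\<close>,
  where each required element divides it; being rational as well, it is an integer.\<close>

theorem torsion_number:
  assumes good: "good_poly r"
  defines "a \<equiv> of_int (lead_coeff r) :: complex"
  obtains n :: int and R where "of_int n = discr_star r * prod_star r" "fg_subring R"
    "\<And>x. x \<in> croots r \<Longrightarrow> a * x \<in> R"
    "\<exists>b\<in>R. a * b = of_int n"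
    "\<And>x y. x \<in> croots r \<Longrightarrow> y \<in> croots r \<Longrightarrow> x \<noteq> y \<Longrightarrow> \<exists>b\<in>R. (a * x - a * y) * b = of_int n"
    "\<And>x y. x \<in> croots r \<Longrightarrow> y \<in> croots r \<Longrightarrow> x * y \<notin> croots r \<Longrightarrow>
       a ^ (2 * degree r) * poly (cpoly r) (x * y) \<in> R \<and>
       (\<exists>b\<in>R. a ^ (2 * degree r) * poly (cpoly r) (x * y) * b = of_int n)"
proof -
  let ?X = "croots r" and ?d = "degree r" and ?m = "max_mult r"
  note r = good_polyD[OF good]
  have fin: "finite ?X" by (rule finite_croots[OF r(1)])
  have int: "\<exists>p. lead_coeff p = 1 \<and> poly (cpoly p) \<alpha> = 0" if "\<alpha> \<in> (\<lambda>x. a * x) ` ?X" for \<alpha>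
  proof -
    obtain x where x: "x \<in> ?X" "\<alpha> = a * x" using \<open>\<alpha> \<in> _\<close> by blast
    have root: "(\<Sum>i\<le>?d. of_int (coeff r i) * x ^ i) = 0" using x(1) by (simp add: croots_def poly_cpoly)
    have d: "?d > 0"
    proof (rule ccontr)
      assume "\<not> ?d > 0"
      then have "coeff r 0 = 0" using root by simp
      then show False using r(1) \<open>\<not> ?d > 0\<close> by (metis gr0I leading_coeff_0_iff)
    qed
    \<comment> \<open>This is \<open>a^(d-1) r(t / a)\<close>, a monic integer polynomial with root
      \<open>a x\<close>.\<close>
    define p where "p = monom 1 ?d + (\<Sum>i<?d. monom (coeff r i * lead_coeff r ^ (?d - 1 - i)) i)"
    have deg: "degree (\<Sum>i<?d. monom (coeff r i * lead_coeff r ^ (?d - 1 - i)) i) < ?d"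
      using d by (intro degree_sum_less) (auto intro: le_less_trans[OF degree_monom_le])
    have "degree p = ?d"
      using deg unfolding p_def by (subst degree_add_eq_left) (simp_all add: degree_monom_eq)
    then have "lead_coeff p = 1"
      using coeff_eq_0[OF deg] by (simp add: p_def)
    moreover have "poly (cpoly p) \<alpha> = a ^ (?d - 1) * (\<Sum>i\<le>?d. of_int (coeff r i) * x ^ i)"
    proof -
      have "poly (cpoly p) \<alpha> = a ^ ?d * x ^ ?d + (\<Sum>i<?d. of_int (coeff r i) * a ^ (?d - 1 - i) * (a ^ i * x ^ i))"
        by (simp add: p_def cpoly_add cpoly_sum cpoly_monom poly_sum poly_monom x(2) power_mult_distrib a_def)
      also have "(\<Sum>i<?d. of_int (coeff r i) * a ^ (?d - 1 - i) * (a ^ i * x ^ i))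
          = (\<Sum>i<?d. a ^ (?d - 1) * (of_int (coeff r i) * x ^ i))"
      proof (rule sum.cong[OF refl])
        fix i assume "i \<in> {..<?d}"
        then have "a ^ (?d - 1) = a ^ (?d - 1 - i) * a ^ i" by (simp flip: power_add)
        then show "of_int (coeff r i) * a ^ (?d - 1 - i) * (a ^ i * x ^ i)
          = a ^ (?d - 1) * (of_int (coeff r i) * x ^ i)" by simp
      qed
      also have "a ^ ?d * x ^ ?d = a ^ (?d - 1) * (of_int (coeff r ?d) * x ^ ?d)"
        using d by (simp add: a_def flip: power_Suc2)
      finally show ?thesis
        by (simp add: lessThan_Suc_atMost[symmetric] sum_distrib_left algebra_simps)
    qed
    ultimately show ?thesis using root by auto
  qed
  obtain R where R: "fg_subring R" and "(\<lambda>x. a * x) ` ?X \<subseteq> R"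
    using fg_subring_exists[of "(\<lambda>x. a * x) ` ?X"] fin int by blast
  then have aX: "a * x \<in> R" if "x \<in> ?X" for x using that by blast
  note Rsub = fg_subring_add_subgroup[OF R]
  have aR: "a \<in> R" unfolding a_def by (rule fg_subring_of_int[OF R])
  \<comment> \<open>A term of \<open>r(x y)\<close> contains at most \<open>d\<close> factors
    \<open>x y\<close>, and each of them absorbs two factors \<open>a\<close>.\<close>
  define val where "val x y = a ^ (2 * ?d) * poly (cpoly r) (x * y)" for x y
  have valR: "val x y \<in> R" if "x \<in> ?X" "y \<in> ?X" for x y
  proof -
    have "val x y = (\<Sum>k\<le>?d. of_int (coeff r k) * (a ^ (2 * ?d - 2 * k) * ((a * x) * (a * y)) ^ k))"
      unfolding val_def poly_cpoly sum_distrib_left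
    proof (rule sum.cong[OF refl])
      fix k assume "k \<in> {..?d}"
      then have "a ^ (2 * ?d) = a ^ (2 * ?d - 2 * k) * a ^ (k + k)" by (simp flip: power_add)
      then show "a ^ (2 * ?d) * (of_int (coeff r k) * (x * y) ^ k)
          = of_int (coeff r k) * (a ^ (2 * ?d - 2 * k) * ((a * x) * (a * y)) ^ k)"
        by (simp add: power_mult_distrib power_add)
    qed
    also have "\<dots> \<in> R"
      by (intro add_subgroup_sum[OF Rsub] fg_subring_mult[OF R] fg_subring_of_int[OF R]
          fg_subring_power[OF R] aR aX that)
    finally show ?thesis .
  qed
  define divides where "divides u v \<longleftrightarrow> (\<exists>b\<in>R. u * b = v)" for u v :: complex
  have divI: "divides u v" if "v = u * b" "b \<in> R" for u v b using that by (auto simp: divides_def)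
  have divT: "divides u w" if "divides u v" "w = v * b" "b \<in> R" for u v w b
    using that fg_subring_mult[OF R] by (auto simp: divides_def mult.assoc)
  define N where "N = discr_star r * prod_star r"
  have "N \<in> R \<and> N \<in> \<rat> \<and> divides a N \<and>
    (\<forall>x\<in>?X. \<forall>y\<in>?X. x \<noteq> y \<longrightarrow> divides (a * x - a * y) N) \<and>
    (\<forall>x\<in>?X. \<forall>y\<in>?X. x * y \<notin> ?X \<longrightarrow> divides (val x y) N)"
  proof (cases "?d = 0")
    case True
    \<comment> \<open>A nonzero constant has no roots, and the number is its value.\<close>
    then have N: "N = a" by (simp add: N_def discr_star_def prod_star_def a_def)
    obtain c where c: "r = [:c:]" using True degree_eq_zeroE by blast
    have "?X = {}" using r(1) by (auto simp: croots_def poly_cpoly c)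
    then show ?thesis using aR fg_subring_one[OF R] N by (auto simp: a_def divides_def)
  next
    case False
    define D where "D = {p \<in> ?X \<times> ?X. fst p \<noteq> snd p}"
    define E where "E = {p \<in> ?X \<times> ?X. poly (cpoly r) (fst p * snd p) \<noteq> 0}"
    define pd where "pd = (\<Prod>p\<in>D. fst p - snd p)"
    define pv where "pv = (\<Prod>p\<in>E. poly (cpoly r) (fst p * snd p))"
    define pD where "pD = (\<Prod>p\<in>D. a * fst p - a * snd p)"
    define pV where "pV = (\<Prod>p\<in>E. val (fst p) (snd p))"
    have finDE: "finite D" "finite E" using fin by (auto simp: D_def E_def)
    have cardDE: "card D \<le> card ?X * card ?X" "card E \<le> card ?X * card ?X"
      unfolding D_def E_def card_cartesian_product[symmetric]
      using fin by (intro card_mono; auto)+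
    have pD: "pD = a ^ card D * pd"
      by (simp add: pD_def pd_def prod.distrib flip: right_diff_distrib)
    have pV: "pV = a ^ (2 * ?d * card E) * pv"
      by (simp add: pV_def pv_def val_def prod.distrib power_mult)
    have m: "?m \<ge> 1" using card_croots_max_mult[OF r(1)] False by simp
    have N: "N = a ^ (1 + 2 * ?d ^ 2) * fact (?m - 1) * pd ^ ?m * (a ^ (2 * ?d ^ 3) * pv)"
      using False
      by (simp add: N_def discr_star_def prod_star_def a_def pd_def pv_def D_def E_def prod_power_distrib)
    have pdQ: "pd \<in> \<rat>" and pvQ: "pv \<in> \<rat>"
      using discr_product_rational[OF r(1,2)] value_product_rational[OF r(1,2)]
      by (simp_all only: pd_def pv_def D_def E_def)
    have aQ: "a \<in> \<rat>" by (simp add: a_def)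
    have "of_nat (fact k) \<in> (\<rat> :: complex set)" for k by (rule Rats_of_nat)
    then have factQ: "fact k \<in> (\<rat> :: complex set)" for k by simp
    have "N \<in> \<rat>"
      unfolding N by (intro Rats_mult Rats_power pdQ pvQ aQ factQ)
    moreover obtain e where e: "1 + 2 * ?d ^ 2 + 2 * ?d ^ 3 = card D * ?m + 2 * ?d * card E + Suc e"
    proof -
      have "card D * ?m + 2 * ?d * card E < 1 + 2 * ?d ^ 2 + 2 * ?d ^ 3"
        using torsion_exponent_bound[of ?m "card ?X" ?d "card E" "card D"]
          card_croots_max_mult[OF r(1)] False cardDE by simp
      then show ?thesis using that by (metis less_imp_Suc_add add_Suc_right)
    qed
    have N': "N = a * (a ^ e * fact (?m - 1) * pD ^ ?m * pV)"
    proof -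
      have "N = a ^ (1 + 2 * ?d ^ 2 + 2 * ?d ^ 3) * (fact (?m - 1) * pd ^ ?m * pv)"
        unfolding N by (simp add: power_add)
      also have "\<dots> = a * (a ^ e * fact (?m - 1) * pD ^ ?m * pV)"
        unfolding e pD pV by (simp add: power_add power_mult power_mult_distrib)
      finally show ?thesis .
    qed
    have factR: "fact k \<in> R" for k
      using fg_subring_of_int[OF R, of "fact k"] by simp
    have DR: "a * fst p - a * snd p \<in> R" if "p \<in> D" for p
      using that aX add_subgroup_diff[OF Rsub] by (auto simp: D_def)
    have ER: "val (fst p) (snd p) \<in> R" if "p \<in> E" for p
      using that valR by (auto simp: E_def)
    have pDR: "pD \<in> R" unfolding pD_def by (rule fg_subring_prod[OF R DR])
    have pVR: "pV \<in> R" unfolding pV_def by (rule fg_subring_prod[OF R ER])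
    note closed = fg_subring_mult[OF R] fg_subring_power[OF R] aR factR pDR pVR
    have NR: "N \<in> R" unfolding N' by (intro closed)
    moreover have "divides a N"
      by (rule divI[OF N']) (intro closed)
    moreover have "divides (a * x - a * y) N" if xy: "x \<in> ?X" "y \<in> ?X" "x \<noteq> y" for x y
    proof -
      have "(x, y) \<in> D" using xy by (simp add: D_def)
      then have "pD = (a * x - a * y) * (\<Prod>p\<in>D - {(x, y)}. a * fst p - a * snd p)"
        unfolding pD_def using finDE(1) by (subst prod.remove) auto
      then have 1: "divides (a * x - a * y) pD"
        by (rule divI) (rule fg_subring_prod[OF R], use DR in auto)
      show ?thesis
      proof (rule divT[OF 1])
        have "pD ^ ?m = pD * pD ^ (?m - 1)" using m by (metis One_nat_def Suc_le_D diff_Suc_1 power_Suc)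
        then show "N = pD * (a * a ^ e * fact (?m - 1) * pD ^ (?m - 1) * pV)"
          unfolding N' by (simp only: ac_simps)
      qed (intro closed)
    qed
    moreover have "divides (val x y) N" if xy: "x \<in> ?X" "y \<in> ?X" "x * y \<notin> ?X" for x y
    proof -
      have "(x, y) \<in> E" using xy by (simp add: E_def croots_def)
      then have "pV = val x y * (\<Prod>p\<in>E - {(x, y)}. val (fst p) (snd p))"
        unfolding pV_def using finDE(2) by (subst prod.remove) auto
      then have 1: "divides (val x y) pV"
        by (rule divI) (rule fg_subring_prod[OF R], use ER in auto)
      show ?thesis
      proof (rule divT[OF 1])
        show "N = pV * (a * a ^ e * fact (?m - 1) * pD ^ ?m)"
          unfolding N' by (simp only: ac_simps)
      qed (intro closed)
    qed
    ultimately show ?thesis by blast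
  qed
  then have N: "N \<in> R" "N \<in> \<rat>" "divides a N"
    "\<And>x y. x \<in> ?X \<Longrightarrow> y \<in> ?X \<Longrightarrow> x \<noteq> y \<Longrightarrow> divides (a * x - a * y) N"
    "\<And>x y. x \<in> ?X \<Longrightarrow> y \<in> ?X \<Longrightarrow> x * y \<notin> ?X \<Longrightarrow> divides (val x y) N" by blast+
  obtain n :: int where n: "N = of_int n"
    using fg_subring_rational[OF R N(1,2)] by (auto elim: Ints_cases)
  show ?thesis
    by (rule that[of n R])
       (use N(3-5) n R aX valR in \<open>auto simp: N_def divides_def val_def\<close>)
qed

subsection \<open>Iterated commutators in the lower central series\<close>

context group
begin

definition cm :: "'a \<Rightarrow> 'a \<Rightarrow> 'a" where
  "cm x y = x \<otimes> y \<otimes> inv x \<otimes> inv y"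

lemma cm_closed [simp]: "x \<in> carrier G \<Longrightarrow> y \<in> carrier G \<Longrightarrow> cm x y \<in> carrier G"
  by (simp add: cm_def)

lemma cancel_inv [simp]:
  assumes "x \<in> carrier G" "y \<in> carrier G"
  shows "x \<otimes> (inv x \<otimes> y) = y" "inv x \<otimes> (x \<otimes> y) = y"
  using assms by (simp_all flip: m_assoc)

lemma inv_cm: "x \<in> carrier G \<Longrightarrow> y \<in> carrier G \<Longrightarrow> inv (cm x y) = cm y x"
  by (simp add: cm_def inv_mult_group m_assoc)

lemma cm_one_left [simp]: "y \<in> carrier G \<Longrightarrow> cm \<one> y = \<one>"
  by (simp add: cm_def)

lemma conj_cm:
  assumes "g \<in> carrier G" "x \<in> carrier G" "y \<in> carrier G"
  shows "g \<otimes> cm x y \<otimes> inv g = cm (g \<otimes> x \<otimes> inv g) (g \<otimes> y \<otimes> inv g)"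
  using assms by (simp add: cm_def inv_mult_group m_assoc)

lemma cm_mult_left:
  assumes "x \<in> carrier G" "x' \<in> carrier G" "y \<in> carrier G"
  shows "cm (x \<otimes> x') y = cm x (cm x' y) \<otimes> cm x' y \<otimes> cm x y"
  using assms by (simp add: cm_def inv_mult_group m_assoc)

lemma hall_witt:
  assumes "x \<in> carrier G" "y \<in> carrier G" "z \<in> carrier G"
  shows "cm (cm x y) (y \<otimes> z \<otimes> inv y) \<otimes> cm (cm y z) (z \<otimes> x \<otimes> inv z)
    \<otimes> cm (cm z x) (x \<otimes> y \<otimes> inv x) = \<one>"
  using assms by (simp add: cm_def inv_mult_group m_assoc)

lemma lcs_normal: "lcs G k \<lhd> G"
proof (induction k)
  case 0
  show ?case by (simp add: normal_invI subgroup_self)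
next
  case (Suc k)
  note sub = normal_imp_subgroup[OF Suc, THEN subgroup.subset]
  show ?case
  proof (simp, rule normal_generateI)
    show "{x \<otimes> y \<otimes> inv x \<otimes> inv y |x y. x \<in> carrier G \<and> y \<in> lcs G k} \<subseteq> carrier G"
      using sub by blast
  next
    fix h g assume "h \<in> {x \<otimes> y \<otimes> inv x \<otimes> inv y |x y. x \<in> carrier G \<and> y \<in> lcs G k}" and g: "g \<in> carrier G"
    then obtain x y where h: "h = cm x y" "x \<in> carrier G" "y \<in> lcs G k" by (auto simp: cm_def)
    have "g \<otimes> y \<otimes> inv g \<in> lcs G k" using normal.inv_op_closed2[OF Suc g h(3)] .
    then show "g \<otimes> h \<otimes> inv g \<in> {x \<otimes> y \<otimes> inv x \<otimes> inv y |x y. x \<in> carrier G \<and> y \<in> lcs G k}"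
      using conj_cm[OF g h(2), of y] g h sub unfolding cm_def by blast
  qed
qed

lemma lcs_subgroup: "subgroup (lcs G k) G"
  by (rule normal_imp_subgroup[OF lcs_normal])

lemma lcs_carrier: "x \<in> lcs G k \<Longrightarrow> x \<in> carrier G"
  using subgroup.subset[OF lcs_subgroup] by blast

lemma lcs_one: "\<one> \<in> lcs G k"
  by (rule subgroup.one_closed[OF lcs_subgroup])

lemma lcs_mult: "x \<in> lcs G k \<Longrightarrow> y \<in> lcs G k \<Longrightarrow> x \<otimes> y \<in> lcs G k"
  by (rule subgroup.m_closed[OF lcs_subgroup])

lemma lcs_inv: "x \<in> lcs G k \<Longrightarrow> inv x \<in> lcs G k"
  by (rule subgroup.m_inv_closed[OF lcs_subgroup])

lemma lcs_conj: "g \<in> carrier G \<Longrightarrow> x \<in> lcs G k \<Longrightarrow> g \<otimes> x \<otimes> inv g \<in> lcs G k"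
  by (rule normal.inv_op_closed2[OF lcs_normal])

lemma lcs_int_pow: "x \<in> lcs G k \<Longrightarrow> x [^] (i::int) \<in> lcs G k"
  using subgroup_int_pow_closed[OF lcs_subgroup] .

lemma cm_lcs_Suc: "x \<in> carrier G \<Longrightarrow> y \<in> lcs G k \<Longrightarrow> cm x y \<in> lcs G (Suc k)"
  by (auto simp: cm_def intro!: generate.incl)

lemma cm_lcs_Suc': "x \<in> carrier G \<Longrightarrow> y \<in> lcs G k \<Longrightarrow> cm y x \<in> lcs G (Suc k)"
  using cm_lcs_Suc[of x y k] lcs_inv[of "cm x y" "Suc k"] inv_cm[of x y] lcs_carrier[of y k] by metis

lemma lcs_Suc_le: "lcs G (Suc k) \<subseteq> lcs G k"
proof -
  have "{x \<otimes> y \<otimes> inv x \<otimes> inv y |x y. x \<in> carrier G \<and> y \<in> lcs G k} \<subseteq> lcs G k"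
    using lcs_conj lcs_inv lcs_mult by blast
  from generate_subgroup_incl[OF this lcs_subgroup] show ?thesis by simp
qed

lemma lcs_antimono: "i \<le> j \<Longrightarrow> lcs G j \<subseteq> lcs G i"
  by (rule lift_Suc_antimono_le[of "lcs G"]) (use lcs_Suc_le in auto)

text \<open>The three subgroups argument: the Hall-Witt identity expresses
  \<open>[[u, v], y]\<close> by commutators to which the induction hypothesis on \<open>i\<close>
  applies, for varying \<open>j\<close>. The 1 comes from counting the series from 0.\<close>

lemma cm_lcs: "x \<in> lcs G i \<Longrightarrow> y \<in> lcs G j \<Longrightarrow> cm x y \<in> lcs G (i + j + 1)"
proof (induction i arbitrary: x y j)
  case 0
  then show ?case using cm_lcs_Suc by simp
next
  case (Suc i)
  let ?N = "lcs G (Suc i + j + 1)"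
  have gen: "cm (cm u v) y \<in> ?N" if u: "u \<in> carrier G" and v: "v \<in> lcs G i" and y: "y \<in> lcs G j" for u v y
  proof -
    have c: "v \<in> carrier G" "y \<in> carrier G" using v y lcs_carrier by auto
    \<comment> \<open>With this choice the conjugate of \<open>z\<close> by \<open>v\<close> in the
      Hall-Witt identity is \<open>y\<close>.\<close>
    define z where "z = inv v \<otimes> y \<otimes> v"
    have z: "z \<in> lcs G j" using lcs_conj[of "inv v" y j] c y by (simp add: z_def)
    have zc: "z \<in> carrier G" using z lcs_carrier by blast
    have vz: "v \<otimes> z \<otimes> inv v = y" using c by (simp add: z_def m_assoc)
    have 1: "cm (cm v z) (z \<otimes> u \<otimes> inv z) \<in> ?N"
      using cm_lcs_Suc'[of "z \<otimes> u \<otimes> inv z" "cm v z" "i + j + 1"] Suc.IH[OF v z] u zc by simp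
    have "cm z u \<in> lcs G (Suc j)" using cm_lcs_Suc'[OF u z] .
    moreover have "u \<otimes> v \<otimes> inv u \<in> lcs G i" using lcs_conj[OF u v] .
    ultimately have "cm (u \<otimes> v \<otimes> inv u) (cm z u) \<in> ?N"
      using Suc.IH[of "u \<otimes> v \<otimes> inv u" "cm z u" "Suc j"] by simp
    then have 2: "cm (cm z u) (u \<otimes> v \<otimes> inv u) \<in> ?N"
      using lcs_inv[of "cm (u \<otimes> v \<otimes> inv u) (cm z u)"] inv_cm u c zc by (metis cm_closed inv_closed m_closed)
    have "cm (cm u v) y \<otimes> (cm (cm v z) (z \<otimes> u \<otimes> inv z) \<otimes> cm (cm z u) (u \<otimes> v \<otimes> inv u)) = \<one>"
      using hall_witt[OF u c(1) zc] u c zc by (simp add: vz m_assoc)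
    then have "cm (cm u v) y = inv (cm (cm v z) (z \<otimes> u \<otimes> inv z) \<otimes> cm (cm z u) (u \<otimes> v \<otimes> inv u))"
      using u c zc by (metis cm_closed inv_closed inv_equality m_closed)
    then show ?thesis using lcs_inv[OF lcs_mult[OF 1 2]] by simp
  qed
  have "cm x y \<in> ?N" if "y \<in> lcs G j" for y
    using Suc.prems(1)[unfolded lcs.simps] that
  proof (induction x arbitrary: y rule: generate.induct)
    case one
    then show ?case using lcs_one lcs_carrier by (simp del: lcs.simps)
  next
    case (incl h)
    then show ?case using gen by (auto simp flip: cm_def)
  next
    case (inv h)
    then obtain u v where h: "h = cm u v" "u \<in> carrier G" "v \<in> lcs G i" by (auto simp: cm_def)
    have c: "h \<in> carrier G" "y \<in> carrier G" using h inv.prems lcs_carrier by auto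
    have "inv h \<otimes> inv (cm h y) \<otimes> inv (inv h) \<in> ?N"
      using gen[OF h(2,3) inv.prems] h(1) c by (intro lcs_conj lcs_inv) auto
    moreover have "inv h \<otimes> inv (cm h y) \<otimes> inv (inv h) = cm (inv h) y"
      using c by (simp add: cm_def inv_mult_group m_assoc)
    ultimately show ?case by simp
  next
    case (eng h1 h2)
    have sub: "{x \<otimes> y \<otimes> inv x \<otimes> inv y |x y. x \<in> carrier G \<and> y \<in> lcs G i} \<subseteq> carrier G"
      using lcs_carrier by blast
    have c: "h1 \<in> carrier G" "h2 \<in> carrier G" "y \<in> carrier G"
      using eng lcs_carrier generate_in_carrier[OF sub] by blast+
    have "cm (h1 \<otimes> h2) y = h1 \<otimes> cm h2 y \<otimes> inv h1 \<otimes> cm h1 y"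
      using c by (simp add: cm_def inv_mult_group m_assoc)
    then show ?case using eng.IH eng.prems lcs_conj[OF c(1)] lcs_mult by metis
  qed
  then show ?case using Suc.prems(2) by blast
qed

text \<open>The left-normed commutator \<open>[x, y_1, ..., y_m]\<close>. The list serves as a
  context in which \<open>x\<close> is tested; each entry is paired with its level in the lower
  central series, and \<open>lev\<close> below measures by how much the context raises the
  level.\<close>

definition ctx :: "'a \<Rightarrow> (nat \<times> 'a) list \<Rightarrow> 'a" where
  "ctx x ys = foldl (\<lambda>u p. cm u (snd p)) x ys"

definition lev :: "(nat \<times> 'a) list \<Rightarrow> nat" where
  "lev ys = (\<Sum>p\<leftarrow>ys. fst p + 1)"

definition valid :: "(nat \<times> 'a) list \<Rightarrow> bool" where
  "valid ys \<longleftrightarrow> (\<forall>p\<in>set ys. snd p \<in> lcs G (fst p))"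

lemma ctx_simps [simp]: "ctx x [] = x" "ctx x (p # ys) = ctx (cm x (snd p)) ys"
  by (simp_all add: ctx_def)

lemma lev_simps [simp]: "lev [] = 0" "lev (p # ys) = fst p + 1 + lev ys"
  by (simp_all add: lev_def)

lemma valid_simps [simp]: "valid []" "valid (p # ys) \<longleftrightarrow> snd p \<in> lcs G (fst p) \<and> valid ys"
  by (simp_all add: valid_def)

lemma ctx_lcs: "x \<in> lcs G i \<Longrightarrow> valid ys \<Longrightarrow> ctx x ys \<in> lcs G (i + lev ys)"
proof (induction ys arbitrary: x i)
  case (Cons p ys)
  then have "cm x (snd p) \<in> lcs G (i + fst p + 1)" using cm_lcs by auto
  from Cons.IH[OF this] Cons.prems show ?case by (simp add: ac_simps)
qed simp

end

text \<open>\<open>lcs G top\<close> is the last term that can be nontrivial, and it is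
  central.\<close>

locale nilpotent_top = group G for G (structure) +
  fixes top :: nat
  assumes top: "lcs G (Suc top) = {\<one>}"
begin

lemma lcs_top_commute:
  assumes "x \<in> lcs G top" "y \<in> carrier G"
  shows "x \<otimes> y = y \<otimes> x"
proof -
  have c: "x \<in> carrier G" using assms lcs_carrier by blast
  have "cm x y = \<one>" using cm_lcs_Suc'[OF assms(2,1)] top by simp
  then have "x \<otimes> y \<otimes> inv x \<otimes> inv y \<otimes> (y \<otimes> x) = y \<otimes> x" using assms c by (simp add: cm_def)
  then show ?thesis using assms c by (simp add: m_assoc)
qed

lemma ctx_trivial: "x \<in> lcs G i \<Longrightarrow> valid ys \<Longrightarrow> top < i + lev ys \<Longrightarrow> ctx x ys = \<one>"
  using ctx_lcs[of x i ys] lcs_antimono[of "Suc top" "i + lev ys"] top by auto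

text \<open>The error term \<open>[x, [x', y]]\<close> from \<open>cm_mult_left\<close> lies one
  level deeper, so it dies in a context that reaches exactly the last term. The remaining two
  factors commute there.\<close>

lemma ctx_mult:
  "x \<in> lcs G i \<Longrightarrow> x' \<in> lcs G i \<Longrightarrow> valid ys \<Longrightarrow> i + lev ys = top \<Longrightarrow>
     ctx (x \<otimes> x') ys = ctx x ys \<otimes> ctx x' ys"
proof (induction ys arbitrary: x x' i)
  case (Cons p ys)
  obtain j y where p: "p = (j, y)" by (cases p)
  have y: "y \<in> lcs G j" and v: "valid ys" using Cons.prems by (auto simp: p)
  let ?i = "i + j + 1"
  have lvl: "?i + lev ys = top" using Cons.prems by (simp add: p)
  have c: "x \<in> carrier G" "x' \<in> carrier G" "y \<in> carrier G"
    using Cons.prems y lcs_carrier by blast+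
  have l: "cm x' y \<in> lcs G ?i" "cm x y \<in> lcs G ?i"
    using cm_lcs y Cons.prems by blast+
  have l2: "cm x (cm x' y) \<in> lcs G (Suc ?i)"
    using cm_lcs_Suc[OF c(1) l(1)] .
  then have l3: "cm x (cm x' y) \<in> lcs G ?i" using lcs_Suc_le by blast
  have "ctx (cm x (cm x' y) \<otimes> cm x' y \<otimes> cm x y) ys
      = ctx (cm x (cm x' y)) ys \<otimes> ctx (cm x' y) ys \<otimes> ctx (cm x y) ys"
    using Cons.IH[OF lcs_mult[OF l3 l(1)] l(2) v lvl] Cons.IH[OF l3 l(1) v lvl] by simp
  also have "ctx (cm x (cm x' y)) ys = \<one>"
    using ctx_trivial[OF l2 v] lvl by simp
  finally have "ctx (cm (x \<otimes> x') y) ys = ctx (cm x' y) ys \<otimes> ctx (cm x y) ys"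
    using cm_mult_left[OF c] ctx_lcs[OF l(1) v] lcs_carrier by simp
  moreover have "ctx (cm x' y) ys \<otimes> ctx (cm x y) ys = ctx (cm x y) ys \<otimes> ctx (cm x' y) ys"
    by (rule lcs_top_commute) (use ctx_lcs[OF l(1) v, unfolded lvl] ctx_lcs[OF l(2) v, unfolded lvl] lcs_carrier in blast)+
  ultimately show ?case by (simp add: p)
qed simp

end

subsection \<open>Formal combinations of group elements\<close>

lemma sum_single_lookup: "(\<Sum>k\<in>Poly_Mapping.keys f. Poly_Mapping.single k (Poly_Mapping.lookup f k)) = f"
proof (rule poly_mapping_eqI)
  fix j
  show "Poly_Mapping.lookup (\<Sum>k\<in>Poly_Mapping.keys f. Poly_Mapping.single k (Poly_Mapping.lookup f k)) j = Poly_Mapping.lookup f j"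
    by (simp add: lookup_sum lookup_single when_def in_keys_iff)
qed

definition lin :: "('k \<Rightarrow> 'c::ab_group_add \<Rightarrow> 'w::ab_group_add) \<Rightarrow> ('k \<Rightarrow>\<^sub>0 'c) \<Rightarrow> 'w" where
  "lin \<phi> f = (\<Sum>k\<in>Poly_Mapping.keys f. \<phi> k (Poly_Mapping.lookup f k))"

lemma lin_add:
  assumes "\<And>k a b. \<phi> k (a + b) = \<phi> k a + \<phi> k b"
  shows "lin \<phi> (f + g) = lin \<phi> f + lin \<phi> g"
proof -
  have "\<phi> k 0 = 0" for k using assms[of k 0 0] by simp
  then show ?thesis unfolding lin_def by (intro setsum_keys_plus_distrib assms)
qed

lemma lin_single:
  assumes "\<And>k a b. \<phi> k (a + b) = \<phi> k a + \<phi> k b"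
  shows "lin \<phi> (Poly_Mapping.single k c) = \<phi> k c"
proof -
  have "\<phi> k 0 = 0" for k using assms[of k 0 0] by simp
  then show ?thesis by (simp add: lin_def)
qed

lemma additive_0:
  fixes F :: "'u::ab_group_add \<Rightarrow> 'w::ab_group_add"
  shows "(\<And>f g. F (f + g) = F f + F g) \<Longrightarrow> F 0 = 0"
  using additive.zero[of F] by (simp add: additive_def)

lemma additive_sum:
  fixes F :: "'u::ab_group_add \<Rightarrow> 'w::ab_group_add"
  assumes "\<And>f g. F (f + g) = F f + F g"
  shows "F (sum h A) = (\<Sum>x\<in>A. F (h x))"
  using additive.sum[of F h A] assms by (simp add: additive_def)

lemma additive_diff:
  fixes F :: "'u::ab_group_add \<Rightarrow> 'w::ab_group_add"
  assumes "\<And>f g. F (f + g) = F f + F g"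
  shows "F (f - g) = F f - F g"
  using additive.diff[of F f g] assms by (simp add: additive_def)

lemma additive_eqI:
  fixes F F' :: "('k \<Rightarrow>\<^sub>0 'c::ab_group_add) \<Rightarrow> 'w::ab_group_add"
  assumes "\<And>f g. F (f + g) = F f + F g" "\<And>f g. F' (f + g) = F' f + F' g"
    and "\<And>k c. F (Poly_Mapping.single k c) = F' (Poly_Mapping.single k c)"
  shows "F f = F' f"
proof -
  have "F (\<Sum>k\<in>Poly_Mapping.keys f. Poly_Mapping.single k (Poly_Mapping.lookup f k))
      = F' (\<Sum>k\<in>Poly_Mapping.keys f. Poly_Mapping.single k (Poly_Mapping.lookup f k))"
    unfolding additive_sum[of F, OF assms(1)] additive_sum[of F', OF assms(2)] by (simp only: assms(3))
  then show ?thesis by (simp only: sum_single_lookup)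
qed

lemma additive_group_closure:
  fixes F :: "'u::ab_group_add \<Rightarrow> 'w::ab_group_add"
  assumes "x \<in> group_closure S" "add_subgroup A" "\<And>f g. F (f + g) = F f + F g"
    and "\<And>s. s \<in> S \<Longrightarrow> F s \<in> A"
  shows "F x \<in> A"
proof -
  have "add_subgroup {x. F x \<in> A}"
    using assms(2) additive_0[of F, OF assms(3)] additive_diff[of F, OF assms(3)]
    by (simp add: add_subgroup_def)
  then show ?thesis using group_closure_least[of S "{x. F x \<in> A}"] assms(1,4) by blast
qed

text \<open>A key \<open>(i, x)\<close> with coefficient \<open>c\<close> stands for the class of
  \<open>x\<close> in the factor number \<open>i\<close> of the lower central series, tensored with
  \<open>c\<close>. Keys are free; all relations between them come from the null subgroup
  \<open>Z\<close>.\<close>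

type_synonym 'a formal = "(nat \<times> 'a) \<Rightarrow>\<^sub>0 complex"

definition scale :: "complex \<Rightarrow> 'a formal \<Rightarrow> 'a formal" where
  "scale c = lin (\<lambda>k b. Poly_Mapping.single k (c * b))"

lemma scale_add: "scale c (f + g) = scale c f + scale c g"
  unfolding scale_def by (rule lin_add) (simp add: distrib_left single_add)

lemma scale_single [simp]: "scale c (Poly_Mapping.single k b) = Poly_Mapping.single k (c * b)"
  unfolding scale_def by (rule lin_single) (simp add: distrib_left single_add)

lemma scale_add_left: "scale (c + d) f = scale c f + scale d f"
  by (rule additive_eqI[where f = f])
     (simp_all add: scale_add distrib_right single_add algebra_simps)

lemma scale_scale: "scale c (scale d f) = scale (c * d) f"
  by (rule additive_eqI[where f = f]) (simp_all add: scale_add mult.assoc)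

lemma scale_one [simp]: "scale 1 f = f"
  by (rule additive_eqI[where f = f]) (simp_all add: scale_add)

definition gmap :: "('a \<Rightarrow> 'a) \<Rightarrow> 'a formal \<Rightarrow> 'a formal" where
  "gmap \<gamma> = lin (\<lambda>k b. Poly_Mapping.single (fst k, \<gamma> (snd k)) b)"

lemma gmap_add: "gmap \<gamma> (f + g) = gmap \<gamma> f + gmap \<gamma> g"
  unfolding gmap_def by (rule lin_add) (simp add: single_add)

lemma gmap_single [simp]: "gmap \<gamma> (Poly_Mapping.single (i, x) b) = Poly_Mapping.single (i, \<gamma> x) b"
  unfolding gmap_def by (subst lin_single) (simp_all add: single_add)

lemma gmap_scale: "gmap \<gamma> (scale c f) = scale c (gmap \<gamma> f)"
  by (rule additive_eqI[where f = f]) (auto simp: scale_add gmap_add)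

lemma gmap_funpow_add: "(gmap \<gamma> ^^ p) (f + g) = (gmap \<gamma> ^^ p) f + (gmap \<gamma> ^^ p) g"
  by (induction p) (simp_all add: gmap_add)

lemma gmap_funpow_single: "(gmap \<gamma> ^^ p) (Poly_Mapping.single (i, x) b) = Poly_Mapping.single (i, (\<gamma> ^^ p) x) b"
  by (induction p) simp_all

lemma gmap_funpow_scale: "(gmap \<gamma> ^^ p) (scale c f) = scale c ((gmap \<gamma> ^^ p) f)"
  by (induction p) (simp_all add: gmap_scale)

context group
begin

definition cmp :: "nat \<times> 'a \<Rightarrow> nat \<times> 'a \<Rightarrow> nat \<times> 'a" where
  "cmp s t = (fst s + fst t + 1, cm (snd s) (snd t))"

definition fbr :: "'a formal \<Rightarrow> 'a formal \<Rightarrow> 'a formal" where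
  "fbr f g = lin (\<lambda>s a. lin (\<lambda>t b. Poly_Mapping.single (cmp s t) (a * b)) g) f"

lemma fbr_inner_add:
  "lin (\<lambda>t b. Poly_Mapping.single (cmp s t) ((a + a' :: complex) * b)) g
   = lin (\<lambda>t b. Poly_Mapping.single (cmp s t) (a * b)) g + lin (\<lambda>t b. Poly_Mapping.single (cmp s t) (a' * b)) g"
  unfolding lin_def distrib_right single_add sum.distrib by (rule refl)

lemma fbr_add_left: "fbr (f + f') g = fbr f g + fbr f' g"
  unfolding fbr_def by (rule lin_add) (rule fbr_inner_add)

lemma fbr_single_left:
  "fbr (Poly_Mapping.single s a) g = lin (\<lambda>t b. Poly_Mapping.single (cmp s t) (a * b)) g"
  unfolding fbr_def by (rule lin_single) (rule fbr_inner_add)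

lemma fbr_add_right: "fbr f (g + g') = fbr f g + fbr f g'"
proof (rule additive_eqI[where f = f])
  fix s a
  show "fbr (Poly_Mapping.single s a) (g + g') = fbr (Poly_Mapping.single s a) g + fbr (Poly_Mapping.single s a) g'"
    unfolding fbr_single_left by (rule lin_add) (simp add: distrib_left single_add)
qed (simp_all add: fbr_add_left)

lemma fbr_single: "fbr (Poly_Mapping.single s a) (Poly_Mapping.single t b) = Poly_Mapping.single (cmp s t) (a * b)"
  unfolding fbr_single_left by (rule lin_single) (simp add: distrib_left single_add)

lemma fbr_scale_left: "fbr (scale c f) g = scale c (fbr f g)"
proof (rule additive_eqI[where f = f])
  fix s a
  show "fbr (scale c (Poly_Mapping.single s a)) g = scale c (fbr (Poly_Mapping.single s a) g)"
    by (rule additive_eqI[where f = g]) (simp_all add: fbr_add_right scale_add fbr_single ac_simps)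
qed (simp_all add: fbr_add_left scale_add)

lemma fbr_scale_right: "fbr f (scale c g) = scale c (fbr f g)"
proof (rule additive_eqI[where f = f])
  fix s a
  show "fbr (Poly_Mapping.single s a) (scale c g) = scale c (fbr (Poly_Mapping.single s a) g)"
    by (rule additive_eqI[where f = g]) (simp_all add: fbr_add_right scale_add fbr_single ac_simps)
qed (simp_all add: fbr_add_left scale_add)

end

text \<open>\<open>l\<close> is the retraction from \<open>ex_splitting\<close>. It turns
  coefficients in \<open>R\<close> into integer exponents, so that formal combinations can be tested
  in \<open>G\<close>.\<close>

locale identity_setting = nilpotent_top G top for G (structure) and top +
  fixes \<gamma> :: "'a \<Rightarrow> 'a" and r :: "int poly" and n :: int and R :: "complex set" and l :: "complex \<Rightarrow> int"
  assumes hom: "\<gamma> \<in> hom G G" and identity: "is_identity G \<gamma> r"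
    and no_torsion: "\<not> has_torsion G n"
    and R: "fg_subring R"
    and l_add: "\<And>x y. x \<in> R \<Longrightarrow> y \<in> R \<Longrightarrow> l (x + y) = l x + l y" and l_1: "l 1 = 1"
begin

section \<open>The identity of the endomorphism inside contexts\<close>

abbreviation A where "A \<equiv> G\<lparr>carrier := lcs G top\<rparr>"

lemma A_group: "comm_group A"
proof -
  interpret A: group A by (rule subgroup_imp_group[OF lcs_subgroup])
  show ?thesis
    by (rule A.group_comm_groupI) (use lcs_top_commute lcs_carrier in auto)
qed

sublocale A: comm_group A
  by (rule A_group)

lemma gamma_closed [simp]: "x \<in> carrier G \<Longrightarrow> \<gamma> x \<in> carrier G"
  using hom by (auto simp: hom_def)

lemma gamma_hom: "group_hom G G \<gamma>"
  by (simp add: group_hom_def group_hom_axioms_def hom group_axioms)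

lemma gamma_cm: "x \<in> carrier G \<Longrightarrow> y \<in> carrier G \<Longrightarrow> \<gamma> (cm x y) = cm (\<gamma> x) (\<gamma> y)"
  by (simp add: cm_def hom_mult[OF hom] group_hom.hom_inv[OF gamma_hom])

lemma gamma_lcs: "x \<in> lcs G k \<Longrightarrow> \<gamma> x \<in> lcs G k"
proof (induction k arbitrary: x)
  case (Suc k)
  show ?case using Suc.prems unfolding lcs.simps
  proof (induction x rule: generate.induct)
    case one
    show ?case by (simp add: group_hom.hom_one[OF gamma_hom] generate.one)
  next
    case (incl h)
    then obtain u v where h: "h = cm u v" "u \<in> carrier G" "v \<in> lcs G k" by (auto simp: cm_def)
    then have "\<gamma> h = cm (\<gamma> u) (\<gamma> v)" using gamma_cm lcs_carrier by blast
    then show ?case using h Suc.IH[of v] cm_lcs_Suc[of "\<gamma> u" "\<gamma> v" k] by simp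
  next
    case (inv h)
    then obtain u v where h: "h = cm u v" "u \<in> carrier G" "v \<in> lcs G k" by (auto simp: cm_def)
    have c: "h \<in> carrier G" using h lcs_carrier by simp
    have "\<gamma> h = cm (\<gamma> u) (\<gamma> v)" using h gamma_cm lcs_carrier by blast
    then have "\<gamma> h \<in> lcs G (Suc k)" using h Suc.IH[of v] cm_lcs_Suc[of "\<gamma> u" "\<gamma> v" k] by simp
    then show ?case using lcs_inv[of "\<gamma> h" "Suc k"] group_hom.hom_inv[OF gamma_hom c] by simp
  next
    case (eng h1 h2)
    have sub: "{x \<otimes> y \<otimes> inv x \<otimes> inv y |x y. x \<in> carrier G \<and> y \<in> lcs G k} \<subseteq> carrier G"
      using lcs_carrier by blast
    have "h1 \<in> carrier G" "h2 \<in> carrier G"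
      using eng.hyps generate_in_carrier[OF sub] by blast+
    then have "\<gamma> (h1 \<otimes> h2) = \<gamma> h1 \<otimes> \<gamma> h2" by (rule hom_mult[OF hom])
    then show ?case using generate.eng[OF eng.IH] by simp
  qed
qed simp

lemma gamma_funpow_lcs: "x \<in> lcs G k \<Longrightarrow> (\<gamma> ^^ p) x \<in> lcs G k"
  by (induction p) (simp_all add: gamma_lcs)

lemma gamma_funpow_hom: "(\<gamma> ^^ p) \<in> hom G G"
proof (induction p)
  case (Suc p)
  show ?case
    using Suc hom by (simp add: hom_def Pi_iff)
qed (simp add: hom_def)

lemma ctx_in_A: "x \<in> lcs G i \<Longrightarrow> valid ys \<Longrightarrow> i + lev ys = top \<Longrightarrow> ctx x ys \<in> lcs G top"
  using ctx_lcs by blast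

lemma ctx_hom:
  assumes "valid ys" "i + lev ys = top"
  shows "(\<lambda>x. ctx x ys) \<in> hom (G\<lparr>carrier := lcs G i\<rparr>) A"
  using assms by (auto simp: hom_def ctx_in_A ctx_mult)

lemma ctx_group_hom:
  assumes "valid ys" "i + lev ys = top"
  shows "group_hom (G\<lparr>carrier := lcs G i\<rparr>) A (\<lambda>x. ctx x ys)"
  using ctx_hom[OF assms] subgroup_imp_group[OF lcs_subgroup] A.group_axioms
  by (simp add: group_hom_def group_hom_axioms_def)

lemma ctx_int_pow:
  assumes "x \<in> lcs G i" "valid ys" "i + lev ys = top"
  shows "ctx (x [^] (k::int)) ys = ctx x ys [^] k"
proof -
  have "ctx (x [^]\<^bsub>G\<lparr>carrier := lcs G i\<rparr>\<^esub> k) ys = ctx x ys [^]\<^bsub>A\<^esub> k"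
    using group_hom.hom_int_pow[OF ctx_group_hom[OF assms(2,3)], of x k] assms(1) by simp
  then show ?thesis
    using int_pow_consistent[OF lcs_subgroup assms(1)]
      int_pow_consistent[OF lcs_subgroup ctx_in_A[OF assms]] by simp
qed

lemma ctx_one: "valid ys \<Longrightarrow> ctx \<one> ys = \<one>"
  using ctx_trivial[OF lcs_one[of "Suc top"], of ys] by simp

lemma ctx_inv:
  assumes "x \<in> lcs G i" "valid ys" "i + lev ys = top"
  shows "ctx (inv x) ys = inv (ctx x ys)"
  using ctx_int_pow[OF assms, of "-1"] lcs_carrier[OF assms(1)] lcs_carrier[OF ctx_in_A[OF assms]]
  by (simp add: int_pow_neg)

lemma list_prod_lcs: "set xs \<subseteq> lcs G k \<Longrightarrow> list_prod G xs \<in> lcs G k"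
  by (induction xs) (simp_all add: lcs_one lcs_mult)

lemma poly_pow_lcs: "x \<in> lcs G k \<Longrightarrow> poly_pow G \<gamma> s x \<in> lcs G k"
  unfolding poly_pow_def by (rule list_prod_lcs) (auto intro!: gamma_funpow_lcs lcs_int_pow)

lemma ctx_list_prod_upt:
  assumes "\<And>i. i < m \<Longrightarrow> f i \<in> lcs G j" "valid ys" "j + lev ys = top"
  shows "ctx (list_prod G (map f [0..<m])) ys = finprod A (\<lambda>i. ctx (f i) ys) {..<m}"
  using assms(1)
proof (induction m)
  case 0
  then show ?case by (simp add: ctx_one assms)
next
  case (Suc m)
  have lp: "list_prod G us \<in> carrier G \<and> list_prod G (us @ [v]) = list_prod G us \<otimes> v"
    if "set us \<subseteq> carrier G" "v \<in> carrier G" for us v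
    using that by (induction us) (auto simp: m_assoc)
  have f: "f i \<in> lcs G j" if "i \<le> m" for i using Suc.prems that by simp
  have l: "list_prod G (map f [0..<m]) \<in> lcs G j" by (rule list_prod_lcs) (use f in auto)
  have fc: "f i \<in> carrier G" if "i \<le> m" for i using lcs_carrier[OF f[OF that]] .
  have "set (map f [0..<m]) \<subseteq> carrier G" using fc by auto
  then have "ctx (list_prod G (map f [0..<Suc m])) ys = ctx (list_prod G (map f [0..<m]) \<otimes> f m) ys"
    using lp[of "map f [0..<m]" "f m"] fc by simp
  also have "\<dots> = ctx (list_prod G (map f [0..<m])) ys \<otimes> ctx (f m) ys"
    by (rule ctx_mult[OF l f assms(2,3)]) simp
  also have "\<dots> = finprod A (\<lambda>i. ctx (f i) ys) {..<m} \<otimes> ctx (f m) ys"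
    using Suc by simp
  also have "\<dots> = finprod A (\<lambda>i. ctx (f i) ys) {..<Suc m}"
  proof -
    have t: "ctx (f i) ys \<in> lcs G top" if "i \<le> m" for i by (rule ctx_in_A[OF f[OF that] assms(2,3)])
    have "finprod A (\<lambda>i. ctx (f i) ys) (insert m {..<m}) = ctx (f m) ys \<otimes>\<^bsub>A\<^esub> finprod A (\<lambda>i. ctx (f i) ys) {..<m}"
      by (rule A.finprod_insert) (use t in auto)
    moreover have "finprod A (\<lambda>i. ctx (f i) ys) {..<m} \<in> carrier A"
      by (rule A.finprod_closed) (use t in auto)
    ultimately show ?thesis
      using A.m_comm[of "ctx (f m) ys" "finprod A (\<lambda>i. ctx (f i) ys) {..<m}"] t
      by (simp add: lessThan_Suc)
  qed
  finally show ?case .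
qed

text \<open>\<open>K\<close> may exceed the degree, so that the parts of a decomposition can be
  added over a common index range.\<close>

lemma ctx_poly_pow:
  assumes x: "x \<in> lcs G j" and ys: "valid ys" "j + lev ys = top" and K: "degree s \<le> K"
  shows "ctx (poly_pow G \<gamma> s x) ys = finprod A (\<lambda>i. ctx ((\<gamma> ^^ i) x) ys [^] coeff s i) {..K}"
proof -
  have g: "(\<gamma> ^^ i) (x [^] k) = (\<gamma> ^^ i) x [^] k" for i and k :: int
    using hom_int_pow[OF gamma_funpow_hom] x lcs_carrier group_axioms by metis
  have t: "(\<gamma> ^^ i) x \<in> lcs G j" for i by (rule gamma_funpow_lcs[OF x])
  have "ctx (poly_pow G \<gamma> s x) ys = finprod A (\<lambda>i. ctx ((\<gamma> ^^ i) (x [^] coeff s i)) ys) {..<Suc (degree s)}"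
    unfolding poly_pow_def
    by (rule ctx_list_prod_upt[OF _ ys]) (intro gamma_funpow_lcs lcs_int_pow x)
  also have "\<dots> = finprod A (\<lambda>i. ctx ((\<gamma> ^^ i) x) ys [^] coeff s i) {..<Suc (degree s)}"
    by (intro A.finprod_cong) (auto simp: g ctx_int_pow[OF t ys] intro!: lcs_int_pow ctx_in_A[OF t ys])
  also have "\<dots> = finprod A (\<lambda>i. ctx ((\<gamma> ^^ i) x) ys [^] coeff s i) {..K}"
    by (rule A.finprod_mono_neutral_cong_left)
       (use K in \<open>auto simp: coeff_eq_0 intro!: lcs_int_pow ctx_in_A[OF t ys]\<close>)
  finally show ?thesis .
qed

lemma ctx_poly_pow_list:
  assumes x: "x \<in> lcs G j" and ys: "valid ys" "j + lev ys = top" and K: "\<And>s. s \<in> set rs \<Longrightarrow> degree s \<le> K"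
  shows "ctx (list_prod G (map (\<lambda>s. poly_pow G \<gamma> s x) rs)) ys
    = finprod A (\<lambda>i. ctx ((\<gamma> ^^ i) x) ys [^] coeff (sum_list rs) i) {..K}"
  using K
proof (induction rs)
  case Nil
  then show ?case using ys by (simp add: ctx_one A.finprod_one_eqI)
next
  case (Cons s rs)
  have t: "ctx ((\<gamma> ^^ i) x) ys \<in> lcs G top" for i
    by (rule ctx_in_A[OF gamma_funpow_lcs[OF x] ys])
  have "ctx (list_prod G (map (\<lambda>s. poly_pow G \<gamma> s x) (s # rs))) ys
    = ctx (poly_pow G \<gamma> s x) ys \<otimes> ctx (list_prod G (map (\<lambda>s. poly_pow G \<gamma> s x) rs)) ys"
    using ctx_mult[OF poly_pow_lcs[OF x] list_prod_lcs[of "map (\<lambda>s. poly_pow G \<gamma> s x) rs"] ys]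
      poly_pow_lcs[OF x] by auto
  also have "\<dots> = finprod A (\<lambda>i. ctx ((\<gamma> ^^ i) x) ys [^] coeff s i) {..K}
      \<otimes>\<^bsub>A\<^esub> finprod A (\<lambda>i. ctx ((\<gamma> ^^ i) x) ys [^] coeff (sum_list rs) i) {..K}"
    using Cons ctx_poly_pow[OF x ys, of s K] by simp
  also have "\<dots> = finprod A (\<lambda>i. ctx ((\<gamma> ^^ i) x) ys [^] coeff s i \<otimes>\<^bsub>A\<^esub> ctx ((\<gamma> ^^ i) x) ys [^] coeff (sum_list rs) i) {..K}"
    by (rule A.finprod_multf[symmetric]) (auto intro!: lcs_int_pow t)
  also have "\<dots> = finprod A (\<lambda>i. ctx ((\<gamma> ^^ i) x) ys [^] coeff (sum_list (s # rs)) i) {..K}"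
    using lcs_carrier[OF t]
    by (intro A.finprod_cong) (auto simp: int_pow_mult intro!: lcs_int_pow lcs_mult t)
  finally show ?case .
qed

text \<open>A context that ends in the last term is a homomorphism into an abelian group. It forgets
  the order of the factors and the decomposition, and only the coefficients of \<open>r\<close>
  remain.\<close>

lemma ctx_identity:
  assumes x: "x \<in> lcs G j" and ys: "valid ys" "j + lev ys = top"
  shows "finprod A (\<lambda>i. ctx ((\<gamma> ^^ i) x) ys [^] coeff r i) {..degree r} = \<one>"
proof -
  obtain rs where rs: "sum_list rs = r"
    and id: "\<And>x. x \<in> carrier G \<Longrightarrow> list_prod G (map (\<lambda>s. poly_pow G \<gamma> s x) rs) = \<one>"
    using identity unfolding is_identity_def by blast
  define K where "K = Max (insert (degree r) (degree ` set rs))"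
  have K: "degree s \<le> K" if "s \<in> set rs" for s
    unfolding K_def by (rule Max_ge) (use that in auto)
  have Kr: "degree r \<le> K" unfolding K_def by (rule Max_ge) auto
  have t: "ctx ((\<gamma> ^^ i) x) ys \<in> lcs G top" for i
    by (rule ctx_in_A[OF gamma_funpow_lcs[OF x] ys])
  have "finprod A (\<lambda>i. ctx ((\<gamma> ^^ i) x) ys [^] coeff r i) {..degree r}
      = finprod A (\<lambda>i. ctx ((\<gamma> ^^ i) x) ys [^] coeff r i) {..K}"
    by (rule A.finprod_mono_neutral_cong_left)
       (use Kr in \<open>auto simp: coeff_eq_0 intro!: lcs_int_pow t\<close>)
  also have "\<dots> = ctx \<one> ys"
    using ctx_poly_pow_list[OF x ys, of rs K] K id[OF lcs_carrier[OF x]] rs by simp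
  finally show ?thesis using ctx_one[OF ys(1)] by simp
qed

end

section \<open>Formal combinations with coefficients in R and their null subgroup\<close>

context identity_setting
begin

lemma l_0: "l 0 = 0"
  using l_add[of 0 0] fg_subring_of_int[OF R, of 0] by simp

lemma l_uminus: "x \<in> R \<Longrightarrow> l (- x) = - l x"
  using l_add[of x "- x"] add_subgroup_uminus[OF fg_subring_add_subgroup[OF R]] l_0 by simp

lemma l_of_int_mult:
  assumes "x \<in> R"
  shows "l (of_int k * x) = k * l x"
proof -
  note sub = fg_subring_add_subgroup[OF R]
  have nat: "l (of_nat m * x) = int m * l x" for m
  proof (induction m)
    case (Suc m)
    have "of_nat m * x \<in> R" using add_subgroup_of_int_mult[OF sub assms, of "int m"] by simp
    then have "l (x + of_nat m * x) = l x + l (of_nat m * x)" using l_add assms by simp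
    then show ?case using Suc by (simp add: algebra_simps)
  qed (simp add: l_0)
  show ?thesis
  proof (cases k rule: int_cases2)
    case (nonneg m)
    then show ?thesis using nat by simp
  next
    case (nonpos m)
    have "of_nat m * x \<in> R" using add_subgroup_of_int_mult[OF sub assms, of "int m"] by simp
    then show ?thesis using nat l_uminus nonpos by simp
  qed
qed

definition singles :: "'a formal set" where
  "singles = {Poly_Mapping.single (i, x) c | i x c. x \<in> lcs G i \<and> c \<in> R}"

text \<open>Coefficients are confined to \<open>R\<close>, where \<open>l\<close> is additive, and
  elements to the level named by their key.\<close>

definition U :: "'a formal set" where
  "U = group_closure singles"

lemma U_sub: "add_subgroup U"
  unfolding U_def by (rule add_subgroup_group_closure)

lemma single_U: "x \<in> lcs G i \<Longrightarrow> c \<in> R \<Longrightarrow> Poly_Mapping.single (i, x) c \<in> U"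
  unfolding U_def singles_def by (rule group_closure_base) blast

lemma additive_U:
  fixes F :: "'a formal \<Rightarrow> 'w::ab_group_add"
  assumes "f \<in> U" "add_subgroup B" "\<And>f g. F (f + g) = F f + F g"
    and "\<And>i x c. x \<in> lcs G i \<Longrightarrow> c \<in> R \<Longrightarrow> F (Poly_Mapping.single (i, x) c) \<in> B"
  shows "F f \<in> B"
  by (rule additive_group_closure[OF assms(1)[unfolded U_def] assms(2,3)])
     (use assms(4) in \<open>auto simp: singles_def\<close>)

lemma U_lookup:
  assumes "f \<in> U"
  shows "Poly_Mapping.lookup f k \<in> R" "k \<in> Poly_Mapping.keys f \<Longrightarrow> snd k \<in> lcs G (fst k)"
proof -
  let ?V = "{f. \<forall>k. Poly_Mapping.lookup f k \<in> R \<and> (snd k \<notin> lcs G (fst k) \<longrightarrow> Poly_Mapping.lookup f k = 0)}"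
  note sub = fg_subring_add_subgroup[OF R]
  have "add_subgroup ?V"
    unfolding add_subgroup_def
    using add_subgroup_zero[OF sub] add_subgroup_diff[OF sub] by (auto simp: lookup_minus)
  moreover have "singles \<subseteq> ?V"
    using add_subgroup_zero[OF sub] by (auto simp: singles_def lookup_single when_def)
  ultimately have "U \<subseteq> ?V" unfolding U_def by (intro group_closure_least)
  then have "f \<in> ?V" using assms by (rule subsetD)
  then have V: "Poly_Mapping.lookup f k \<in> R \<and> (snd k \<notin> lcs G (fst k) \<longrightarrow> Poly_Mapping.lookup f k = 0)" for k
    by (simp only: mem_Collect_eq) blast
  show "Poly_Mapping.lookup f k \<in> R" "k \<in> Poly_Mapping.keys f \<Longrightarrow> snd k \<in> lcs G (fst k)"
    using V[of k] by (auto simp: in_keys_iff)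
qed

text \<open>The contribution of one key to the test value \<open>E\<close>. Levels that do not match
  the context count as trivial, and a coefficient \<open>c\<close> becomes the exponent
  \<open>l (\<rho> * c)\<close>. Letting \<open>\<rho>\<close> range over \<open>R\<close> makes the
  common kernel of all tests stable under scaling by \<open>R\<close>.\<close>

definition Efac :: "complex \<Rightarrow> (nat \<times> 'a) list \<Rightarrow> 'a formal \<Rightarrow> nat \<times> 'a \<Rightarrow> 'a" where
  "Efac \<rho> ys f k = (if fst k + lev ys = top then ctx (snd k) ys [^] l (\<rho> * Poly_Mapping.lookup f k) else \<one>)"

definition E :: "complex \<Rightarrow> (nat \<times> 'a) list \<Rightarrow> 'a formal \<Rightarrow> 'a" where
  "E \<rho> ys f = finprod A (Efac \<rho> ys f) (Poly_Mapping.keys f)"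

lemma Efac_in:
  assumes "snd k \<in> lcs G (fst k)" "valid ys"
  shows "Efac \<rho> ys f k \<in> lcs G top"
  unfolding Efac_def using assms lcs_int_pow ctx_in_A lcs_one by simp

lemma E_eq:
  assumes "finite K" "Poly_Mapping.keys f \<subseteq> K" "\<And>k. k \<in> K \<Longrightarrow> snd k \<in> lcs G (fst k)" "valid ys"
  shows "E \<rho> ys f = finprod A (Efac \<rho> ys f) K"
  unfolding E_def
proof (rule A.finprod_mono_neutral_cong_left)
  show "Efac \<rho> ys f i = \<one>\<^bsub>A\<^esub>" if "i \<in> K - Poly_Mapping.keys f" for i
    using that by (auto simp: Efac_def in_keys_iff l_0)
qed (use assms Efac_in in auto)

lemma E_in: "f \<in> U \<Longrightarrow> valid ys \<Longrightarrow> E \<rho> ys f \<in> lcs G top"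
  unfolding E_def using A.finprod_closed[of "Efac \<rho> ys f" "Poly_Mapping.keys f"] Efac_in U_lookup(2) by auto

lemma E_add:
  assumes f: "f \<in> U" and g: "g \<in> U" and \<rho>: "\<rho> \<in> R" and ys: "valid ys"
  shows "E \<rho> ys (f + g) = E \<rho> ys f \<otimes> E \<rho> ys g"
proof -
  let ?K = "Poly_Mapping.keys f \<union> Poly_Mapping.keys g"
  have K: "finite ?K" "\<And>k. k \<in> ?K \<Longrightarrow> snd k \<in> lcs G (fst k)"
    using U_lookup(2)[OF f] U_lookup(2)[OF g] by auto
  have fac: "Efac \<rho> ys (f + g) k = Efac \<rho> ys f k \<otimes> Efac \<rho> ys g k" if "k \<in> ?K" for k
  proof (cases "fst k + lev ys = top")
    case True
    have "l (\<rho> * Poly_Mapping.lookup (f + g) k) = l (\<rho> * Poly_Mapping.lookup f k) + l (\<rho> * Poly_Mapping.lookup g k)"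
      using U_lookup(1)[OF f] U_lookup(1)[OF g] \<rho> fg_subring_mult[OF R]
      by (simp add: lookup_add distrib_left l_add)
    moreover have "ctx (snd k) ys \<in> carrier G"
      using ctx_in_A[OF K(2)[OF that] ys True] lcs_carrier by blast
    ultimately show ?thesis using True by (simp add: Efac_def int_pow_mult)
  qed (simp add: Efac_def)
  have "E \<rho> ys (f + g) = finprod A (Efac \<rho> ys (f + g)) ?K"
    by (rule E_eq) (use K ys Poly_Mapping.keys_add[of f g] in blast)+
  also have "\<dots> = finprod A (\<lambda>k. Efac \<rho> ys f k \<otimes>\<^bsub>A\<^esub> Efac \<rho> ys g k) ?K"
    by (rule A.finprod_cong') (use fac K Efac_in[OF _ ys] lcs_mult in auto)
  also have "\<dots> = finprod A (Efac \<rho> ys f) ?K \<otimes>\<^bsub>A\<^esub> finprod A (Efac \<rho> ys g) ?K"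
    by (rule A.finprod_multf) (use K Efac_in[OF _ ys] in auto)
  also have "finprod A (Efac \<rho> ys f) ?K = E \<rho> ys f"
    by (rule E_eq[symmetric]) (use K ys in auto)
  also have "finprod A (Efac \<rho> ys g) ?K = E \<rho> ys g"
    by (rule E_eq[symmetric]) (use K ys in auto)
  finally show ?thesis by simp
qed

lemma E_single:
  assumes x: "x \<in> lcs G i" and ys: "valid ys"
  shows "E \<rho> ys (Poly_Mapping.single (i, x) c)
    = (if i + lev ys = top then ctx x ys [^] l (\<rho> * c) else \<one>)"
proof -
  have "E \<rho> ys (Poly_Mapping.single (i, x) c) = finprod A (Efac \<rho> ys (Poly_Mapping.single (i, x) c)) {(i, x)}"
    by (rule E_eq) (use x ys in auto)
  also have "\<dots> = Efac \<rho> ys (Poly_Mapping.single (i, x) c) (i, x)"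
    using A.finprod_insert[of "{}" "(i, x)" "Efac \<rho> ys (Poly_Mapping.single (i, x) c)"]
      Efac_in[of "(i, x)" ys \<rho> "Poly_Mapping.single (i, x) c"] x ys lcs_carrier by force
  finally show ?thesis by (simp add: Efac_def)
qed

lemma top_int_pow_mult:
  "x \<in> lcs G top \<Longrightarrow> y \<in> lcs G top \<Longrightarrow> (x \<otimes> y) [^] (k::int) = x [^] k \<otimes> y [^] k"
  using int_pow_mult_distrib lcs_top_commute lcs_carrier by blast

text \<open>The counterpart of \<open>additive_U\<close> for maps into the multiplicative group
  \<open>G\<close>.\<close>

lemma U_hom_eqI:
  assumes "f \<in> U"
    and "\<And>f g. f \<in> U \<Longrightarrow> g \<in> U \<Longrightarrow> e1 (f + g) = e1 f \<otimes> e1 g" "\<And>f. f \<in> U \<Longrightarrow> e1 f \<in> carrier G"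
    and "\<And>f g. f \<in> U \<Longrightarrow> g \<in> U \<Longrightarrow> e2 (f + g) = e2 f \<otimes> e2 g" "\<And>f. f \<in> U \<Longrightarrow> e2 f \<in> carrier G"
    and "\<And>i x c. x \<in> lcs G i \<Longrightarrow> c \<in> R \<Longrightarrow> e1 (Poly_Mapping.single (i, x) c) = e2 (Poly_Mapping.single (i, x) c)"
  shows "e1 f = e2 f"
proof -
  have 0: "0 \<in> U" by (rule add_subgroup_zero[OF U_sub])
  have one: "e 0 = \<one>" if "\<And>f g. f \<in> U \<Longrightarrow> g \<in> U \<Longrightarrow> e (f + g) = e f \<otimes> e g" "\<And>f. f \<in> U \<Longrightarrow> e f \<in> carrier G" for e
    using that(1)[OF 0 0] that(2)[OF 0] by simp
  have diff: "e (f - g) = e f \<otimes> inv (e g)"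
    if "\<And>f g. f \<in> U \<Longrightarrow> g \<in> U \<Longrightarrow> e (f + g) = e f \<otimes> e g" "\<And>f. f \<in> U \<Longrightarrow> e f \<in> carrier G"
      and fg: "f \<in> U" "g \<in> U" for e f g
  proof -
    have d: "f - g \<in> U" by (rule add_subgroup_diff[OF U_sub fg])
    have "e f = e (f - g) \<otimes> e g" using that(1)[OF d fg(2)] by simp
    then show ?thesis using that(2) d fg by (simp add: m_assoc)
  qed
  have "add_subgroup {f \<in> U. e1 f = e2 f}"
    unfolding add_subgroup_def
    using 0 one[of e1, OF assms(2,3)] one[of e2, OF assms(4,5)]
      diff[of e1, OF assms(2,3)] diff[of e2, OF assms(4,5)] add_subgroup_diff[OF U_sub] by simp
  moreover have "singles \<subseteq> {f \<in> U. e1 f = e2 f}"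
    using assms(6) single_U by (auto simp: singles_def)
  ultimately show ?thesis using group_closure_least assms(1) unfolding U_def by blast
qed

lemma E_0: "valid ys \<Longrightarrow> E \<rho> ys 0 = \<one>"
  by (simp add: E_def)

lemma E_diff:
  assumes "f \<in> U" "g \<in> U" "\<rho> \<in> R" "valid ys"
  shows "E \<rho> ys (f - g) = E \<rho> ys f \<otimes> inv (E \<rho> ys g)"
proof -
  have d: "f - g \<in> U" by (rule add_subgroup_diff[OF U_sub assms(1,2)])
  have "E \<rho> ys f = E \<rho> ys (f - g) \<otimes> E \<rho> ys g" using E_add[OF d assms(2-4)] by simp
  moreover have "E \<rho> ys (f - g) \<in> carrier G" "E \<rho> ys g \<in> carrier G"
    using E_in[OF d assms(4)] E_in[OF assms(2,4)] lcs_carrier by blast+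
  ultimately show ?thesis by (simp add: m_assoc)
qed

lemma gmap_U: "f \<in> U \<Longrightarrow> (gmap \<gamma> ^^ p) f \<in> U"
  by (rule additive_U[OF _ U_sub gmap_funpow_add]) (auto simp: gmap_funpow_single intro: single_U gamma_funpow_lcs)

lemma scale_U: "f \<in> U \<Longrightarrow> c \<in> R \<Longrightarrow> scale c f \<in> U"
  by (rule additive_U[OF _ U_sub scale_add]) (auto intro: single_U fg_subring_mult[OF R])

lemma fbr_U:
  assumes "f \<in> U" "g \<in> U"
  shows "fbr f g \<in> U"
proof (rule additive_U[OF assms(1) U_sub fbr_add_left])
  fix i x c assume xc: "x \<in> lcs G i" "c \<in> R"
  show "fbr (Poly_Mapping.single (i, x) c) g \<in> U"
    by (rule additive_U[OF assms(2) U_sub fbr_add_right])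
       (use xc in \<open>auto simp: fbr_single cmp_def intro!: single_U fg_subring_mult[OF R] cm_lcs[simplified]\<close>)
qed

lemma gmap_fbr:
  assumes "f \<in> U" "g \<in> U"
  shows "gmap \<gamma> (fbr f g) = fbr (gmap \<gamma> f) (gmap \<gamma> g)"
proof -
  have 0: "add_subgroup {0 :: 'a formal}" by (simp add: add_subgroup_def)
  have "gmap \<gamma> (fbr f g) - fbr (gmap \<gamma> f) (gmap \<gamma> g) \<in> {0}"
  proof (rule additive_U[OF assms(1) 0])
    fix i x c assume xc: "x \<in> lcs G i" "c \<in> R"
    show "gmap \<gamma> (fbr (Poly_Mapping.single (i, x) c) g) - fbr (gmap \<gamma> (Poly_Mapping.single (i, x) c)) (gmap \<gamma> g) \<in> {0}"
      by (rule additive_U[OF assms(2) 0])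
         (use xc lcs_carrier in \<open>auto simp: fbr_add_right gmap_add fbr_single cmp_def gamma_cm algebra_simps\<close>)
  qed (simp add: fbr_add_left gmap_add algebra_simps)
  then show ?thesis by simp
qed

lemma gmap_funpow_fbr:
  "f \<in> U \<Longrightarrow> g \<in> U \<Longrightarrow> (gmap \<gamma> ^^ p) (fbr f g) = fbr ((gmap \<gamma> ^^ p) f) ((gmap \<gamma> ^^ p) g)"
  by (induction p) (simp_all add: gmap_fbr gmap_U)

lemma E_scale:
  assumes "f \<in> U" "\<rho> \<in> R" "c \<in> R" "valid ys"
  shows "E \<rho> ys (scale c f) = E (\<rho> * c) ys f"
  by (rule U_hom_eqI[OF assms(1)])
     (use assms in \<open>auto simp: scale_add E_add scale_U E_single fg_subring_mult[OF R] mult.assoc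
        intro!: lcs_carrier E_in\<close>)

text \<open>Bracketing with a single term lengthens the context by one entry. This is why the null
  subgroup is an ideal.\<close>

lemma E_fbr_single:
  assumes "f \<in> U" "\<rho> \<in> R" "c \<in> R" "valid ys" "y \<in> lcs G j"
  shows "E \<rho> ys (fbr f (Poly_Mapping.single (j, y) c)) = E (\<rho> * c) ((j, y) # ys) f"
proof (rule U_hom_eqI[OF assms(1)])
  fix i x b assume x: "x \<in> lcs G i" and b: "b \<in> R"
  have "cm x y \<in> lcs G (i + j + 1)" by (rule cm_lcs[OF x assms(5)])
  then have "E \<rho> ys (fbr (Poly_Mapping.single (i, x) b) (Poly_Mapping.single (j, y) c))
     = (if i + j + 1 + lev ys = top then ctx (cm x y) ys [^] l (\<rho> * (b * c)) else \<one>)"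
    using E_single[of "cm x y" "i + j + 1" ys \<rho> "b * c"] assms(4) by (simp add: fbr_single cmp_def)
  also have "\<dots> = E (\<rho> * c) ((j, y) # ys) (Poly_Mapping.single (i, x) b)"
    using E_single[OF x, of "(j, y) # ys" "\<rho> * c" b] assms(4,5) by (simp add: ac_simps)
  finally show "E \<rho> ys (fbr (Poly_Mapping.single (i, x) b) (Poly_Mapping.single (j, y) c))
     = E (\<rho> * c) ((j, y) # ys) (Poly_Mapping.single (i, x) b)" .
qed (use assms single_U in \<open>auto simp: fbr_add_left E_add fbr_U fg_subring_mult[OF R] intro!: lcs_carrier E_in fbr_U\<close>)

lemma E_of_int:
  assumes "f \<in> U" "\<rho> \<in> R" "valid ys"
  shows "E \<rho> ys (scale (of_int k) f) = E \<rho> ys f [^] k"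
proof (rule U_hom_eqI[OF assms(1)])
  have kR: "of_int k \<in> R" by (rule fg_subring_of_int[OF R])
  show "E \<rho> ys (scale (of_int k) (f + g)) = E \<rho> ys (scale (of_int k) f) \<otimes> E \<rho> ys (scale (of_int k) g)"
    if "f \<in> U" "g \<in> U" for f g
    using that assms kR by (simp add: scale_add E_add scale_U)
  show "E \<rho> ys (scale (of_int k) f) \<in> carrier G" if "f \<in> U" for f
    using that assms kR by (intro lcs_carrier[OF E_in] scale_U)
  show "E \<rho> ys f [^] k \<in> carrier G" if "f \<in> U" for f
    using lcs_carrier[OF E_in[OF that assms(3)]] by simp
  show "E \<rho> ys (f + g) [^] k = E \<rho> ys f [^] k \<otimes> E \<rho> ys g [^] k" if fg: "f \<in> U" "g \<in> U" for f g
    using top_int_pow_mult E_in fg assms(3) by (simp add: E_add[OF fg assms(2,3)])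
next
  fix i x c assume x: "x \<in> lcs G i" and c: "c \<in> R"
  have "l (\<rho> * (of_int k * c)) = k * l (\<rho> * c)"
    using l_of_int_mult[of "\<rho> * c" k] fg_subring_mult[OF R] assms(2) c by (simp add: ac_simps)
  moreover have "ctx x ys \<in> carrier G" if "i + lev ys = top"
    using ctx_in_A[OF x assms(3) that] lcs_carrier by blast
  ultimately show "E \<rho> ys (scale (of_int k) (Poly_Mapping.single (i, x) c)) = E \<rho> ys (Poly_Mapping.single (i, x) c) [^] k"
    using assms x by (simp add: E_single int_pow_pow mult.commute)
qed

text \<open>The quotient of \<open>U\<close> by \<open>Z\<close> is the associated graded Lie ring of \<open>G\<close>, tensored with \<open>R\<close>,
  modulo everything that does not contribute to commutators in the last term of the lower central
  series. The powers of \<open>\<gamma>\<close> in the definition make \<open>Z\<close> invariant under \<open>\<gamma>\<close>.\<close>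

definition Z :: "'a formal set" where
  "Z = {f \<in> U. \<forall>\<rho>\<in>R. \<forall>ys p. valid ys \<longrightarrow> E \<rho> ys ((gmap \<gamma> ^^ p) f) = \<one>}"

lemma Z_le_U: "Z \<subseteq> U"
  by (auto simp: Z_def)

lemma Z_sub: "add_subgroup Z"
  unfolding add_subgroup_def
proof (intro conjI ballI)
  have "(gmap \<gamma> ^^ p) 0 = (0 :: 'a formal)" for p
    using additive_0[of "gmap \<gamma> ^^ p", OF gmap_funpow_add] .
  then show "0 \<in> Z" using add_subgroup_zero[OF U_sub] by (simp add: Z_def E_0)
next
  fix f g assume fg: "f \<in> Z" "g \<in> Z"
  then have U: "f \<in> U" "g \<in> U" using Z_le_U by auto
  have "(gmap \<gamma> ^^ p) (f - g) = (gmap \<gamma> ^^ p) f - (gmap \<gamma> ^^ p) g" for p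
    using additive_diff[of "gmap \<gamma> ^^ p", OF gmap_funpow_add] .
  then show "f - g \<in> Z"
    using fg add_subgroup_diff[OF U_sub U] by (simp add: Z_def E_diff gmap_U)
qed

lemma Z_scale:
  assumes "f \<in> Z" "c \<in> R"
  shows "scale c f \<in> Z"
  using assms scale_U fg_subring_mult[OF R] by (auto simp: Z_def gmap_funpow_scale E_scale gmap_U)

lemma Z_gmap:
  assumes "f \<in> Z"
  shows "gmap \<gamma> f \<in> Z"
proof -
  have "(gmap \<gamma> ^^ p) (gmap \<gamma> f) = (gmap \<gamma> ^^ Suc p) f" for p by (simp only: funpow_Suc_right o_apply)
  moreover have "gmap \<gamma> f \<in> U" using gmap_U[of f 1] assms by (simp add: Z_def)
  ultimately show ?thesis using assms by (simp add: Z_def del: funpow.simps)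
qed

text \<open>The absence of \<open>n\<close>-torsion enters here: scaling by \<open>n\<close> raises
  the test values, which are elements of \<open>G\<close>, to the \<open>n\<close>-th power.\<close>

lemma Z_saturated:
  assumes "f \<in> U" "scale (of_int n) f \<in> Z"
  shows "f \<in> Z"
  unfolding Z_def
proof (intro CollectI conjI ballI allI impI)
  fix \<rho> ys p assume \<rho>: "\<rho> \<in> R" and ys: "valid ys"
  let ?e = "E \<rho> ys ((gmap \<gamma> ^^ p) f)"
  have "?e [^] n = E \<rho> ys ((gmap \<gamma> ^^ p) (scale (of_int n) f))"
    using E_of_int[OF gmap_U[OF assms(1)] \<rho> ys] by (simp add: gmap_funpow_scale)
  also have "\<dots> = \<one>" using assms(2) \<rho> ys by (simp add: Z_def)
  finally show "?e = \<one>"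
    using no_torsion lcs_carrier[OF E_in[OF gmap_U[OF assms(1)] ys]] by (auto simp: has_torsion_def)
qed (rule assms(1))

text \<open>Turns a group identity that holds inside all contexts of the right length into a
  relation modulo \<open>Z\<close>. The powers of \<open>\<gamma>\<close> appear because
  \<open>Z\<close> tests all images under them.\<close>

lemma Z_relation:
  assumes uvw: "u \<in> lcs G k" "v \<in> lcs G k" "w \<in> lcs G k" and c: "c \<in> R"
    and rel: "\<And>p ys. valid ys \<Longrightarrow> k + lev ys = top \<Longrightarrow>
      ctx ((\<gamma> ^^ p) u) ys = ctx ((\<gamma> ^^ p) v) ys \<otimes> ctx ((\<gamma> ^^ p) w) ys"
  shows "Poly_Mapping.single (k, u) c - Poly_Mapping.single (k, v) c - Poly_Mapping.single (k, w) c \<in> Z"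
proof -
  let ?s = "\<lambda>u. Poly_Mapping.single (k, u) c"
  have d: "(gmap \<gamma> ^^ p) (f - g) = (gmap \<gamma> ^^ p) f - (gmap \<gamma> ^^ p) g" for p f g
    using additive_diff[of "gmap \<gamma> ^^ p", OF gmap_funpow_add] .
  have "E \<rho> ys ((gmap \<gamma> ^^ p) (?s u - ?s v - ?s w)) = \<one>" if \<rho>: "\<rho> \<in> R" and ys: "valid ys" for \<rho> ys p
  proof -
    let ?t = "\<lambda>u. Poly_Mapping.single (k, (\<gamma> ^^ p) u) c"
    have l: "(\<gamma> ^^ p) u \<in> lcs G k" "(\<gamma> ^^ p) v \<in> lcs G k" "(\<gamma> ^^ p) w \<in> lcs G k"
      using uvw gamma_funpow_lcs by auto
    have tU: "?t u \<in> U" "?t v \<in> U" "?t w \<in> U" using l single_U c by auto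
    have E: "E \<rho> ys (?t u - ?t v - ?t w) = E \<rho> ys (?t u) \<otimes> inv (E \<rho> ys (?t v)) \<otimes> inv (E \<rho> ys (?t w))"
      using tU \<rho> ys add_subgroup_diff[OF U_sub] by (simp add: E_diff)
    have "E \<rho> ys (?t u) = E \<rho> ys (?t w) \<otimes> E \<rho> ys (?t v)"
    proof (cases "k + lev ys = top")
      case True
      note A = ctx_in_A[OF l(2) ys True] ctx_in_A[OF l(3) ys True]
      show ?thesis
        using True rel[OF ys True, of p] l ys lcs_top_commute[OF A(1) lcs_carrier[OF A(2)]] lcs_carrier[OF A(1)] lcs_carrier[OF A(2)]
        by (simp add: E_single int_pow_mult_distrib)
    qed (use l ys in \<open>simp add: E_single\<close>)
    moreover have "E \<rho> ys (?t v) \<in> carrier G" "E \<rho> ys (?t w) \<in> carrier G"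
      using E_in[OF _ ys] tU lcs_carrier by blast+
    ultimately have "E \<rho> ys (?t u - ?t v - ?t w) = \<one>" unfolding E by (simp add: m_assoc)
    then show ?thesis by (simp add: d gmap_funpow_single)
  qed
  moreover have "?s u - ?s v - ?s w \<in> U"
    using uvw c by (intro add_subgroup_diff[OF U_sub] single_U)
  ultimately show ?thesis by (simp add: Z_def)
qed

section \<open>Lie ring axioms modulo the null subgroup\<close>

lemma gamma_funpow_mult: "x \<in> carrier G \<Longrightarrow> y \<in> carrier G \<Longrightarrow> (\<gamma> ^^ p) (x \<otimes> y) = (\<gamma> ^^ p) x \<otimes> (\<gamma> ^^ p) y"
  using hom_mult[OF gamma_funpow_hom] .

lemma gamma_funpow_one: "(\<gamma> ^^ p) \<one> = \<one>"
  using hom_one[OF gamma_funpow_hom] group_axioms by blast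

lemma gamma_funpow_closed: "x \<in> carrier G \<Longrightarrow> (\<gamma> ^^ p) x \<in> carrier G"
  by (induction p) auto

lemma gamma_funpow_cm:
  "x \<in> carrier G \<Longrightarrow> y \<in> carrier G \<Longrightarrow> (\<gamma> ^^ p) (cm x y) = cm ((\<gamma> ^^ p) x) ((\<gamma> ^^ p) y)"
  by (induction p) (simp_all add: gamma_cm gamma_funpow_closed)

lemma Z_one: "c \<in> R \<Longrightarrow> Poly_Mapping.single (k, \<one>) c \<in> Z"
  using Z_relation[of \<one> k \<one> \<one> c] lcs_one add_subgroup_uminus[OF Z_sub]
  by (fastforce simp: gamma_funpow_one ctx_one)

lemma Z_mult:
  assumes "x \<in> lcs G k" "y \<in> lcs G k" "c \<in> R"
  shows "Poly_Mapping.single (k, x \<otimes> y) c - Poly_Mapping.single (k, x) c - Poly_Mapping.single (k, y) c \<in> Z"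
proof (rule Z_relation[OF lcs_mult[OF assms(1,2)] assms(1,2,3)])
  fix p ys assume "valid ys" "k + lev ys = top"
  from ctx_mult[OF gamma_funpow_lcs[OF assms(1)] gamma_funpow_lcs[OF assms(2)] this]
  show "ctx ((\<gamma> ^^ p) (x \<otimes> y)) ys = ctx ((\<gamma> ^^ p) x) ys \<otimes> ctx ((\<gamma> ^^ p) y) ys"
    using gamma_funpow_mult[OF lcs_carrier[OF assms(1)] lcs_carrier[OF assms(2)]] by simp
qed

lemma fbr_Z_left:
  assumes "f \<in> Z" "g \<in> U"
  shows "fbr f g \<in> Z"
proof (rule additive_U[OF assms(2) Z_sub fbr_add_right])
  fix j y c assume y: "y \<in> lcs G j" and c: "c \<in> R"
  have f: "f \<in> U" using assms(1) Z_le_U by blast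
  have s: "Poly_Mapping.single (j, y) c \<in> U" by (rule single_U[OF y c])
  have "E \<rho> ys ((gmap \<gamma> ^^ p) (fbr f (Poly_Mapping.single (j, y) c))) = \<one>"
    if \<rho>: "\<rho> \<in> R" and ys: "valid ys" for \<rho> ys p
  proof -
    have y': "(\<gamma> ^^ p) y \<in> lcs G j" by (rule gamma_funpow_lcs[OF y])
    have "E \<rho> ys ((gmap \<gamma> ^^ p) (fbr f (Poly_Mapping.single (j, y) c)))
        = E (\<rho> * c) ((j, (\<gamma> ^^ p) y) # ys) ((gmap \<gamma> ^^ p) f)"
      unfolding gmap_funpow_fbr[OF f s] gmap_funpow_single
      by (rule E_fbr_single[OF gmap_U[OF f] \<rho> c ys y'])
    also have "\<dots> = \<one>"
      using assms(1) fg_subring_mult[OF R \<rho> c] ys y' by (simp add: Z_def)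
    finally show ?thesis .
  qed
  then show "fbr f (Poly_Mapping.single (j, y) c) \<in> Z"
    using fbr_U[OF f s] by (simp add: Z_def)
qed

lemma fbr_antisym:
  assumes "f \<in> U" "g \<in> U"
  shows "fbr f g + fbr g f \<in> Z"
proof (rule additive_U[OF assms(1) Z_sub])
  fix i x a assume x: "x \<in> lcs G i" and a: "a \<in> R"
  show "fbr (Poly_Mapping.single (i, x) a) g + fbr g (Poly_Mapping.single (i, x) a) \<in> Z"
  proof (rule additive_U[OF assms(2) Z_sub])
    fix j y b assume y: "y \<in> lcs G j" and b: "b \<in> R"
    let ?k = "i + j + 1"
    let ?s = "\<lambda>u. Poly_Mapping.single (?k, u) (a * b)"
    have ab: "a * b \<in> R" by (rule fg_subring_mult[OF R a b])
    have c: "x \<in> carrier G" "y \<in> carrier G" using x y lcs_carrier by auto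
    have m: "cm x y \<in> lcs G ?k" "cm y x \<in> lcs G ?k"
      using cm_lcs[OF x y] cm_lcs[OF y x] by (simp_all add: add.commute[of j i] del: lcs.simps)
    have "?s \<one> - ?s (cm x y) - ?s (cm y x) \<in> Z"
    proof (rule Z_relation[OF lcs_one m ab])
      fix p ys assume ys: "valid ys" "?k + lev ys = top"
      let ?x = "(\<gamma> ^^ p) x" and ?y = "(\<gamma> ^^ p) y"
      have c': "?x \<in> carrier G" "?y \<in> carrier G" using c gamma_funpow_closed by auto
      have m': "cm ?x ?y \<in> lcs G ?k" "cm ?y ?x \<in> lcs G ?k"
        using gamma_funpow_lcs[OF m(1), of p] gamma_funpow_lcs[OF m(2), of p] by (simp_all only: gamma_funpow_cm c)
      have "cm ?x ?y \<otimes> cm ?y ?x = \<one>" using inv_cm[OF c'] c' by (metis cm_closed r_inv)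
      then show "ctx ((\<gamma> ^^ p) \<one>) ys = ctx ((\<gamma> ^^ p) (cm x y)) ys \<otimes> ctx ((\<gamma> ^^ p) (cm y x)) ys"
        using ctx_mult[OF m' ys] by (simp add: gamma_funpow_one gamma_funpow_cm c)
    qed
    from add_subgroup_diff[OF Z_sub Z_one[OF ab, of ?k] this]
    have "?s (cm x y) + ?s (cm y x) \<in> Z" by (simp add: algebra_simps)
    moreover have "fbr (Poly_Mapping.single (i, x) a) (Poly_Mapping.single (j, y) b) = ?s (cm x y)"
      by (simp add: fbr_single cmp_def)
    moreover have "fbr (Poly_Mapping.single (j, y) b) (Poly_Mapping.single (i, x) a) = ?s (cm y x)"
      by (simp add: fbr_single cmp_def add.commute[of j i] mult.commute[of b a])
    ultimately show "fbr (Poly_Mapping.single (i, x) a) (Poly_Mapping.single (j, y) b)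
        + fbr (Poly_Mapping.single (j, y) b) (Poly_Mapping.single (i, x) a) \<in> Z" by (simp only:)
  qed (simp add: fbr_add_left fbr_add_right algebra_simps)
qed (simp add: fbr_add_left fbr_add_right algebra_simps)

lemma fbr_Z_right:
  assumes "f \<in> Z" "g \<in> U"
  shows "fbr g f \<in> Z"
  using add_subgroup_diff[OF Z_sub fbr_antisym[of g f] fbr_Z_left[OF assms]] assms Z_le_U by auto

text \<open>Conjugation multiplies \<open>t\<close> by \<open>[g, t]\<close>, which is one level
  deeper and invisible in the context. The commutators are inverted to bring \<open>t\<close> into
  the first entry, where \<open>ctx_mult\<close> applies.\<close>

lemma ctx_cm_conj:
  assumes s: "s \<in> lcs G i" and t: "t \<in> lcs G j" and g: "g \<in> carrier G"
    and ys: "valid ys" "i + j + 1 + lev ys = top"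
  shows "ctx (cm s (g \<otimes> t \<otimes> inv g)) ys = ctx (cm s t) ys"
proof -
  let ?t = "g \<otimes> t \<otimes> inv g" and ?ys = "(i, s) # ys"
  have c: "s \<in> carrier G" "t \<in> carrier G" using s t lcs_carrier by auto
  have v: "valid ?ys" "j + lev ?ys = top" using s ys by auto
  have l: "cm g t \<in> lcs G (Suc j)" by (rule cm_lcs_Suc[OF g t])
  then have l': "cm g t \<in> lcs G j" using lcs_Suc_le by blast
  have t': "?t \<in> lcs G j" by (rule lcs_conj[OF g t])
  have "?t = cm g t \<otimes> t" using c g by (simp add: cm_def m_assoc)
  then have "ctx ?t ?ys = ctx (cm g t) ?ys \<otimes> ctx t ?ys" using ctx_mult[OF l' t v] by (simp del: ctx_simps)
  also have "ctx (cm g t) ?ys = \<one>" by (rule ctx_trivial[OF l v(1)]) (use v(2) in simp)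
  finally have eq: "ctx (cm ?t s) ys = ctx (cm t s) ys"
    using ctx_in_A[OF t v] lcs_carrier by simp
  have inv: "ctx (cm s u) ys = inv (ctx (cm u s) ys)" if u: "u \<in> lcs G j" for u
  proof -
    have "cm u s \<in> lcs G (i + j + 1)" using cm_lcs[OF u s] by (simp add: add.commute[of j i] del: lcs.simps)
    from ctx_inv[OF this ys] show ?thesis using inv_cm u c lcs_carrier by simp
  qed
  show ?thesis using inv[OF t'] inv[OF t] eq by simp
qed

text \<open>The Hall-Witt identity, with the conjugations removed by \<open>ctx_cm_conj\<close>. Two
  of its three factors are inverted to reach the derivation form of the Jacobi identity.\<close>

lemma ctx_jacobi:
  assumes x: "x \<in> lcs G i" and y: "y \<in> lcs G j" and z: "z \<in> lcs G k"
    and ys: "valid ys" "i + j + k + 2 + lev ys = top"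
  shows "ctx (cm (cm x y) z) ys = ctx (cm (cm x z) y) ys \<otimes> ctx (cm x (cm y z)) ys"
proof -
  let ?L = "i + j + k + 2"
  have c: "x \<in> carrier G" "y \<in> carrier G" "z \<in> carrier G" using x y z lcs_carrier by auto
  have xy: "cm x y \<in> lcs G (i + j + 1)" and yz: "cm y z \<in> lcs G (j + k + 1)"
    and zx: "cm z x \<in> lcs G (k + i + 1)" and xz: "cm x z \<in> lcs G (i + k + 1)"
    using cm_lcs x y z by blast+
  let ?h1 = "cm (cm x y) (y \<otimes> z \<otimes> inv y)" and ?h2 = "cm (cm y z) (z \<otimes> x \<otimes> inv z)"
    and ?h3 = "cm (cm z x) (x \<otimes> y \<otimes> inv x)"
  have l: "?h1 \<in> lcs G ?L" "?h2 \<in> lcs G ?L" "?h3 \<in> lcs G ?L"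
    using cm_lcs[OF xy lcs_conj[OF c(2) z]] cm_lcs[OF yz lcs_conj[OF c(3) x]] cm_lcs[OF zx lcs_conj[OF c(1) y]]
    by (simp_all add: ac_simps del: lcs.simps)
  have e1: "ctx ?h1 ys = ctx (cm (cm x y) z) ys"
    by (rule ctx_cm_conj[OF xy z c(2) ys(1)]) (use ys(2) in simp)
  have e2: "ctx ?h2 ys = ctx (cm (cm y z) x) ys"
    by (rule ctx_cm_conj[OF yz x c(3) ys(1)]) (use ys(2) in simp)
  have e3: "ctx ?h3 ys = ctx (cm (cm z x) y) ys"
    by (rule ctx_cm_conj[OF zx y c(1) ys(1)]) (use ys(2) in simp)
  have "\<one> = ctx (?h1 \<otimes> ?h2 \<otimes> ?h3) ys" using hall_witt[OF c] ctx_one[OF ys(1)] by simp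
  also have "\<dots> = ctx ?h1 ys \<otimes> ctx ?h2 ys \<otimes> ctx ?h3 ys"
    using ctx_mult[OF lcs_mult[OF l(1,2)] l(3) ys] ctx_mult[OF l(1,2) ys] by simp
  finally have e: "\<one> = ctx (cm (cm x y) z) ys \<otimes> ctx (cm (cm y z) x) ys \<otimes> ctx (cm (cm z x) y) ys"
    by (simp only: e1 e2 e3)
  have w: "cm x (cm y z) \<in> lcs G ?L" using cm_lcs[OF x yz] by (simp add: ac_simps del: lcs.simps)
  have i2: "ctx (cm (cm y z) x) ys = inv (ctx (cm x (cm y z)) ys)"
    using ctx_inv[OF w ys] inv_cm[of x "cm y z"] c by simp
  have i3: "ctx (cm (cm z x) y) ys = inv (ctx (cm (cm x z) y) ys)"
    using ctx_inv[OF xz, of "(j, y) # ys"] y ys inv_cm[OF c(1,3)] by simp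
  have v: "cm (cm x z) y \<in> lcs G ?L" "cm (cm x y) z \<in> lcs G ?L"
    using cm_lcs[OF xz y] cm_lcs[OF xy z] by (simp_all add: ac_simps del: lcs.simps)
  let ?u = "ctx (cm (cm x y) z) ys" and ?v = "ctx (cm (cm x z) y) ys" and ?w = "ctx (cm x (cm y z)) ys"
  have A: "?u \<in> carrier G" "?v \<in> carrier G" "?w \<in> carrier G"
    using ctx_in_A[OF v(2) ys] ctx_in_A[OF v(1) ys] ctx_in_A[OF w ys] lcs_carrier by blast+
  have "?u \<otimes> inv ?w \<otimes> inv ?v = \<one>" using e i2 i3 by simp
  then have "?u \<otimes> inv (?v \<otimes> ?w) = \<one>" using A by (simp add: inv_mult_group m_assoc)
  then show ?thesis using A by (metis inv_equality inv_inv inv_closed m_closed)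
qed

lemma fbr_jacobi:
  assumes "f \<in> U" "g \<in> U" "h \<in> U"
  shows "fbr (fbr f g) h - fbr (fbr f h) g - fbr f (fbr g h) \<in> Z"
proof (rule additive_U[OF assms(1) Z_sub])
  fix i x a assume x: "x \<in> lcs G i" and a: "a \<in> R"
  let ?f = "Poly_Mapping.single (i, x) a"
  show "fbr (fbr ?f g) h - fbr (fbr ?f h) g - fbr ?f (fbr g h) \<in> Z"
  proof (rule additive_U[OF assms(2) Z_sub])
    fix j y b assume y: "y \<in> lcs G j" and b: "b \<in> R"
    let ?g = "Poly_Mapping.single (j, y) b"
    show "fbr (fbr ?f ?g) h - fbr (fbr ?f h) ?g - fbr ?f (fbr ?g h) \<in> Z"
    proof (rule additive_U[OF assms(3) Z_sub])
      fix k z c assume z: "z \<in> lcs G k" and c: "c \<in> R"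
      let ?h = "Poly_Mapping.single (k, z) c"
      let ?L = "i + j + k + 2"
      let ?s = "\<lambda>u. Poly_Mapping.single (?L, u) (a * b * c)"
      have carr: "x \<in> carrier G" "y \<in> carrier G" "z \<in> carrier G" using x y z lcs_carrier by auto
      have xy: "cm x y \<in> lcs G (i + j + 1)" and yz: "cm y z \<in> lcs G (j + k + 1)"
        and xz: "cm x z \<in> lcs G (i + k + 1)"
        using cm_lcs x y z by blast+
      have l: "cm (cm x y) z \<in> lcs G ?L" "cm (cm x z) y \<in> lcs G ?L" "cm x (cm y z) \<in> lcs G ?L"
        using cm_lcs[OF xy z] cm_lcs[OF xz y] cm_lcs[OF x yz] by (simp_all add: ac_simps del: lcs.simps)
      have "?s (cm (cm x y) z) - ?s (cm (cm x z) y) - ?s (cm x (cm y z)) \<in> Z"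
      proof (rule Z_relation[OF l])
        show "a * b * c \<in> R" using a b c fg_subring_mult[OF R] by blast
        fix p ys assume ys: "valid ys" "?L + lev ys = top"
        show "ctx ((\<gamma> ^^ p) (cm (cm x y) z)) ys
            = ctx ((\<gamma> ^^ p) (cm (cm x z) y)) ys \<otimes> ctx ((\<gamma> ^^ p) (cm x (cm y z))) ys"
          using ctx_jacobi[OF gamma_funpow_lcs[OF x] gamma_funpow_lcs[OF y] gamma_funpow_lcs[OF z] ys]
          by (simp add: gamma_funpow_cm carr)
      qed
      moreover have "fbr (fbr ?f ?g) ?h = ?s (cm (cm x y) z)"
        "fbr (fbr ?f ?h) ?g = ?s (cm (cm x z) y)" "fbr ?f (fbr ?g ?h) = ?s (cm x (cm y z))"
        by (simp_all add: fbr_single cmp_def ac_simps)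
      ultimately show "fbr (fbr ?f ?g) ?h - fbr (fbr ?f ?h) ?g - fbr ?f (fbr ?g ?h) \<in> Z" by simp
    qed (simp add: fbr_add_left fbr_add_right algebra_simps)
  qed (simp add: fbr_add_left fbr_add_right algebra_simps)
qed (simp add: fbr_add_left fbr_add_right algebra_simps)

lemma finprod_int_pow:
  assumes "finite I" "\<And>i. i \<in> I \<Longrightarrow> a i \<in> lcs G top"
  shows "finprod A (\<lambda>i. a i [^] (m::int)) I = finprod A a I [^] m"
  using assms
proof (induction I rule: finite_induct)
  case (insert i I)
  have a: "a i \<in> lcs G top" "finprod A a I \<in> lcs G top"
    using insert.prems A.finprod_closed[of a I] by auto
  have "finprod A (\<lambda>i. a i [^] m) (insert i I) = a i [^] m \<otimes> finprod A (\<lambda>i. a i [^] m) I"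
    using A.finprod_insert[of I i "\<lambda>i. a i [^] m"] insert lcs_int_pow by auto
  moreover have "finprod A a (insert i I) = a i \<otimes> finprod A a I"
    using A.finprod_insert[of I i a] insert by auto
  ultimately show ?case
    using insert top_int_pow_mult[OF a] by simp
qed simp

lemma E_sum:
  assumes "finite I" "\<And>i. i \<in> I \<Longrightarrow> f i \<in> U" "\<rho> \<in> R" "valid ys"
  shows "E \<rho> ys (sum f I) = finprod A (\<lambda>i. E \<rho> ys (f i)) I"
  using assms
proof (induction I rule: finite_induct)
  case (insert i I)
  have "sum f I \<in> U" using insert by (intro add_subgroup_sum[OF U_sub]) auto
  then show ?case
    using insert A.finprod_insert[of I i "\<lambda>i. E \<rho> ys (f i)"] E_in[OF _ assms(4)] by (auto simp: E_add)
qed (simp add: E_0)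

lemma identity_Z:
  assumes "f \<in> U"
  shows "(\<Sum>i\<le>degree r. scale (of_int (coeff r i)) ((gmap \<gamma> ^^ i) f)) \<in> Z"
proof (rule additive_U[OF assms Z_sub])
  fix j x c assume x: "x \<in> lcs G j" and c: "c \<in> R"
  let ?S = "\<lambda>x. \<Sum>i\<le>degree r. Poly_Mapping.single (j, (\<gamma> ^^ i) x) (of_int (coeff r i) * c)"
  have cR: "of_int k * c \<in> R" for k by (rule fg_subring_mult[OF R fg_subring_of_int[OF R] c])
  have SU: "?S x \<in> U"
    by (intro add_subgroup_sum[OF U_sub] single_U gamma_funpow_lcs x cR)
  have "E \<rho> ys (?S x) = \<one>" if \<rho>: "\<rho> \<in> R" and ys: "valid ys" and x: "x \<in> lcs G j" for \<rho> ys x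
  proof -
    have g: "(\<gamma> ^^ i) x \<in> lcs G j" for i by (rule gamma_funpow_lcs[OF x])
    have "E \<rho> ys (?S x) = finprod A (\<lambda>i. E \<rho> ys (Poly_Mapping.single (j, (\<gamma> ^^ i) x) (of_int (coeff r i) * c))) {..degree r}"
      by (rule E_sum) (use \<rho> ys in \<open>auto intro!: single_U g cR\<close>)
    also have "\<dots> = \<one>"
    proof (cases "j + lev ys = top")
      case False
      then have "E \<rho> ys (Poly_Mapping.single (j, (\<gamma> ^^ i) x) (of_int (coeff r i) * c)) = \<one>" for i
        using E_single[OF g ys] by simp
      then show ?thesis using A.finprod_one by simp
    next
      case True
      have t: "ctx ((\<gamma> ^^ i) x) ys \<in> lcs G top" for i by (rule ctx_in_A[OF g ys True])
      have "l (\<rho> * (of_int k * c)) = k * l (\<rho> * c)" for k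
        using l_of_int_mult[OF fg_subring_mult[OF R \<rho> c], of k] by (simp add: ac_simps)
      then have "E \<rho> ys (Poly_Mapping.single (j, (\<gamma> ^^ i) x) (of_int (coeff r i) * c))
        = (ctx ((\<gamma> ^^ i) x) ys [^] coeff r i) [^] l (\<rho> * c)" for i
        using E_single[OF g ys] True lcs_carrier[OF t] by (simp add: int_pow_pow)
      then have "finprod A (\<lambda>i. E \<rho> ys (Poly_Mapping.single (j, (\<gamma> ^^ i) x) (of_int (coeff r i) * c))) {..degree r}
          = finprod A (\<lambda>i. ctx ((\<gamma> ^^ i) x) ys [^] coeff r i) {..degree r} [^] l (\<rho> * c)"
        using finprod_int_pow[of "{..degree r}" "\<lambda>i. ctx ((\<gamma> ^^ i) x) ys [^] coeff r i" "l (\<rho> * c)"] lcs_int_pow[OF t]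
        by simp
      then show ?thesis using ctx_identity[OF x ys True] by simp
    qed
    finally show ?thesis .
  qed
  moreover have "(gmap \<gamma> ^^ p) (?S x) = ?S ((\<gamma> ^^ p) x)" for p
    unfolding additive_sum[of "gmap \<gamma> ^^ p", OF gmap_funpow_add] gmap_funpow_single
    by (simp add: funpow_add[symmetric, THEN fun_cong, unfolded o_apply] add.commute)
  ultimately have "?S x \<in> Z"
    using SU gamma_funpow_lcs[OF x] by (simp add: Z_def)
  then show "(\<Sum>i\<le>degree r. scale (of_int (coeff r i)) ((gmap \<gamma> ^^ i) (Poly_Mapping.single (j, x) c))) \<in> Z"
    by (simp add: gmap_funpow_single)
qed (simp add: scale_add gmap_funpow_add sum.distrib)

text \<open>The empty context with \<open>\<rho> = 1\<close> is test enough: since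
  \<open>l 1 = 1\<close>, its value is \<open>x\<close> itself.\<close>

lemma top_single_Z:
  assumes "x \<in> lcs G top" "Poly_Mapping.single (top, x) 1 \<in> Z"
  shows "x = \<one>"
proof -
  have "E 1 [] ((gmap \<gamma> ^^ 0) (Poly_Mapping.single (top, x) 1)) = \<one>"
    using assms(2) fg_subring_one[OF R] valid_simps(1) unfolding Z_def by blast
  then show ?thesis using E_single[OF assms(1), of "[]" 1 1] l_1 lcs_carrier[OF assms(1)] by simp
qed

end

subsection \<open>Eigenspaces\<close>

locale eigen_setting = identity_setting +
  assumes good: "good_poly r"
    and root_R: "\<And>x. x \<in> croots r \<Longrightarrow> of_int (lead_coeff r) * x \<in> R"
    and lead_dvd: "\<exists>b\<in>R. of_int (lead_coeff r) * b = of_int n"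
    and diff_dvd: "\<And>x y. x \<in> croots r \<Longrightarrow> y \<in> croots r \<Longrightarrow> x \<noteq> y \<Longrightarrow>
      \<exists>b\<in>R. (of_int (lead_coeff r) * x - of_int (lead_coeff r) * y) * b = of_int n"
    and value_dvd: "\<And>x y. x \<in> croots r \<Longrightarrow> y \<in> croots r \<Longrightarrow> x * y \<notin> croots r \<Longrightarrow>
      of_int (lead_coeff r) ^ (2 * degree r) * poly (cpoly r) (x * y) \<in> R \<and>
      (\<exists>b\<in>R. of_int (lead_coeff r) ^ (2 * degree r) * poly (cpoly r) (x * y) * b = of_int n)"
begin

section \<open>Operators belonging to roots and to products of two roots\<close>

abbreviation a :: complex where "a \<equiv> of_int (lead_coeff r)"

abbreviation X :: "complex set" where "X \<equiv> croots r"

lemma a_R: "a \<in> R"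
  by (rule fg_subring_of_int[OF R])

text \<open>Scaling by the cofactor \<open>b\<close> turns \<open>c\<close> into \<open>n\<close>,
  and \<open>Z_saturated\<close> applies.\<close>

lemma Z_cancel:
  assumes "f \<in> U" "scale c f \<in> Z" "\<exists>b\<in>R. c * b = of_int n"
  shows "f \<in> Z"
proof -
  obtain b where b: "b \<in> R" "c * b = of_int n" using assms(3) by blast
  have "scale (b * c) f \<in> Z" using Z_scale[OF assms(2) b(1)] by (simp add: scale_scale)
  then show ?thesis using Z_saturated[OF assms(1)] b(2) by (simp add: mult.commute)
qed

lemma Z_cancel_power:
  assumes "c \<in> R" "\<exists>b\<in>R. c * b = of_int n"
  shows "f \<in> U \<Longrightarrow> scale (c ^ k) f \<in> Z \<Longrightarrow> f \<in> Z"
proof (induction k)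
  case (Suc k)
  have "scale (c ^ k) f \<in> Z"
    by (rule Z_cancel[OF _ _ assms(2)])
       (use Suc.prems assms(1) scale_U fg_subring_power[OF R] in \<open>auto simp: scale_scale\<close>)
  then show ?case using Suc by blast
qed simp

lemma scale_uminus_left: "scale (- c) f = - scale c f"
  using scale_add_left[of c "- c" f] scale_add_left[of 0 0 f] by (simp add: eq_neg_iff_add_eq_0 add.commute)

lemma scale_diff_left: "scale (c - d) f = scale c f - scale d f"
  using scale_add_left[of c "- d" f] by (simp add: scale_uminus_left)

lemma scale_diff: "scale c (f - g) = scale c f - scale c g"
  using additive_diff[of "scale c", OF scale_add] .

lemma gmap_diff: "gmap \<gamma> (f - g) = gmap \<gamma> f - gmap \<gamma> g"
  using additive_diff[of "gmap \<gamma>", OF gmap_add] .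

lemma scale_sum: "scale c (sum h I) = (\<Sum>i\<in>I. scale c (h i))"
  using additive_sum[of "scale c", OF scale_add] .

lemma fbr_diff_left: "fbr (f - g) h = fbr f h - fbr g h"
  using additive_diff[of "\<lambda>f. fbr f h", OF fbr_add_left] .

lemma fbr_diff_right: "fbr h (f - g) = fbr h f - fbr h g"
  using additive_diff[of "fbr h", OF fbr_add_right] .

text \<open>This is \<open>a (\<gamma> - x)\<close>; the factor \<open>a\<close> puts its
  coefficients into \<open>R\<close>.\<close>

definition T :: "complex \<Rightarrow> 'a formal \<Rightarrow> 'a formal" where
  "T x f = scale a (gmap \<gamma> f) - scale (a * x) f"

lemma T_add: "T x (f + g) = T x f + T x g"
  by (simp add: T_def scale_add gmap_add)

lemma T_diff: "T x (f - g) = T x f - T x g"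
  by (simp add: T_def scale_diff gmap_diff)

lemma T_scale: "T x (scale c f) = scale c (T x f)"
  by (simp add: T_def scale_diff gmap_scale scale_scale mult.commute)

lemma T_gmap: "T x (gmap \<gamma> f) = gmap \<gamma> (T x f)"
  by (simp add: T_def gmap_diff gmap_scale)

lemma T_commute: "T x (T y f) = T y (T x f)"
  by (simp add: T_def scale_diff gmap_diff gmap_scale scale_scale algebra_simps)

lemma T_funpow_diff: "(T x ^^ k) (f - g) = (T x ^^ k) f - (T x ^^ k) g"
  by (induction k) (simp_all add: T_diff)

lemma T_funpow_scale: "(T x ^^ k) (scale c f) = scale c ((T x ^^ k) f)"
  by (induction k) (simp_all add: T_scale)

lemma T_funpow_gmap: "(T x ^^ k) (gmap \<gamma> f) = gmap \<gamma> ((T x ^^ k) f)"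
  by (induction k) (simp_all add: T_gmap)

lemma gmap_U1: "f \<in> U \<Longrightarrow> gmap \<gamma> f \<in> U"
  using gmap_U[of f 1] by simp

lemma T_U: "x \<in> X \<Longrightarrow> f \<in> U \<Longrightarrow> T x f \<in> U"
  unfolding T_def by (intro add_subgroup_diff[OF U_sub] scale_U gmap_U1 a_R root_R)

lemma T_Z: "x \<in> X \<Longrightarrow> f \<in> Z \<Longrightarrow> T x f \<in> Z"
  unfolding T_def by (intro add_subgroup_diff[OF Z_sub] Z_scale Z_gmap a_R root_R)

lemma T_funpow_Z: "x \<in> X \<Longrightarrow> f \<in> Z \<Longrightarrow> (T x ^^ k) f \<in> Z"
  by (induction k) (simp_all add: T_Z)

lemma T_funpow_Z_le: "x \<in> X \<Longrightarrow> (T x ^^ k) f \<in> Z \<Longrightarrow> k \<le> k' \<Longrightarrow> (T x ^^ k') f \<in> Z"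
  using T_funpow_Z[of x "(T x ^^ k) f" "k' - k"] funpow_add[of "k' - k" k "T x"] by simp

text \<open>Generalized eigenspaces modulo \<open>Z\<close>; the exponent may vary with the
  element.\<close>

definition L :: "complex \<Rightarrow> 'a formal set" where
  "L x = (if x \<in> X then {f \<in> U. \<exists>k. (T x ^^ k) f \<in> Z} else Z)"

lemma L_in: "f \<in> U \<Longrightarrow> x \<in> X \<Longrightarrow> (T x ^^ k) f \<in> Z \<Longrightarrow> f \<in> L x"
  unfolding L_def by auto

lemma L_le_U: "L x \<subseteq> U"
  using Z_le_U by (auto simp: L_def)

lemma Z_le_L: "Z \<subseteq> L x"
proof
  fix f assume f: "f \<in> Z"
  then show "f \<in> L x" using L_in[of f x 0] Z_le_U by (cases "x \<in> X") (auto simp: L_def)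
qed

lemma L_sub: "add_subgroup (L x)"
proof (cases "x \<in> X")
  case True
  show ?thesis
    unfolding add_subgroup_def
  proof (intro conjI ballI)
    show "0 \<in> L x" using Z_le_L add_subgroup_zero[OF Z_sub] by blast
  next
    fix f g assume "f \<in> L x" "g \<in> L x"
    then obtain k k' where fg: "f \<in> U" "g \<in> U" "(T x ^^ k) f \<in> Z" "(T x ^^ k') g \<in> Z"
      using True by (auto simp: L_def)
    have "(T x ^^ max k k') (f - g) \<in> Z"
      unfolding T_funpow_diff
      using T_funpow_Z_le[OF True fg(3), of "max k k'"] T_funpow_Z_le[OF True fg(4), of "max k k'"]
      by (intro add_subgroup_diff[OF Z_sub]) auto
    then show "f - g \<in> L x" using L_in add_subgroup_diff[OF U_sub fg(1,2)] True by blast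
  qed
qed (simp add: L_def Z_sub)

lemma L_scale:
  assumes "f \<in> L x" "c \<in> R"
  shows "scale c f \<in> L x"
proof (cases "x \<in> X")
  case True
  then obtain k where k: "(T x ^^ k) f \<in> Z" "f \<in> U" using assms(1) by (auto simp: L_def)
  have "(T x ^^ k) (scale c f) \<in> Z" unfolding T_funpow_scale by (rule Z_scale[OF k(1) assms(2)])
  then show ?thesis using L_in scale_U[OF k(2) assms(2)] True by blast
qed (use assms Z_scale in \<open>simp add: L_def\<close>)

lemma L_T:
  assumes "x \<in> X" "f \<in> U" "T x f \<in> L x"
  shows "f \<in> L x"
proof -
  obtain k where "(T x ^^ k) (T x f) \<in> Z" using assms by (auto simp: L_def)
  then have "(T x ^^ Suc k) f \<in> Z" by (simp only: funpow_Suc_right o_apply)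
  then show ?thesis by (rule L_in[OF assms(2,1)])
qed

text \<open>This is \<open>a^2 (\<gamma> - x y)\<close>. With one factor \<open>a\<close> for each
  root its coefficients lie in \<open>R\<close> even if \<open>x y\<close> is not a root.\<close>

definition S :: "complex \<Rightarrow> complex \<Rightarrow> 'a formal \<Rightarrow> 'a formal" where
  "S x y f = scale (a * a) (gmap \<gamma> f) - scale (a * x * (a * y)) f"

lemma S_add: "S x y (f + g) = S x y f + S x y g"
  by (simp add: S_def scale_add gmap_add)

lemma S_scale: "S x y (scale c f) = scale c (S x y f)"
  by (simp add: S_def scale_diff gmap_scale scale_scale mult.commute)

lemma S_funpow_add: "(S x y ^^ k) (f + g) = (S x y ^^ k) f + (S x y ^^ k) g"
  by (induction k) (simp_all add: S_add)

lemma S_funpow_scale: "(S x y ^^ k) (scale c f) = scale c ((S x y ^^ k) f)"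
  by (induction k) (simp_all add: S_scale)

lemma S_U: "x \<in> X \<Longrightarrow> y \<in> X \<Longrightarrow> f \<in> U \<Longrightarrow> S x y f \<in> U"
  unfolding S_def
  by (intro add_subgroup_diff[OF U_sub] scale_U gmap_U1 a_R root_R fg_subring_mult[OF R])

lemma S_Z: "x \<in> X \<Longrightarrow> y \<in> X \<Longrightarrow> f \<in> Z \<Longrightarrow> S x y f \<in> Z"
  unfolding S_def
  by (intro add_subgroup_diff[OF Z_sub] Z_scale Z_gmap a_R root_R fg_subring_mult[OF R])

lemma S_funpow_Z: "x \<in> X \<Longrightarrow> y \<in> X \<Longrightarrow> f \<in> Z \<Longrightarrow> (S x y ^^ k) f \<in> Z"
  by (induction k) (simp_all add: S_Z)

lemma S_funpow_U: "x \<in> X \<Longrightarrow> y \<in> X \<Longrightarrow> f \<in> U \<Longrightarrow> (S x y ^^ k) f \<in> U"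
  by (induction k) (simp_all add: S_U)

text \<open>A twisted Leibniz rule: \<open>\<gamma> - x y\<close> acts on a bracket as
  \<open>\<gamma> - x\<close> on the left entry, with \<open>\<gamma>\<close> on the right one, plus
  \<open>x\<close> times \<open>\<gamma> - y\<close> on the right entry.\<close>

lemma S_fbr:
  assumes "f \<in> U" "g \<in> U"
  shows "S x y (fbr f g) = fbr (T x f) (scale a (gmap \<gamma> g)) + scale (a * x) (fbr f (T y g))"
  by (simp add: S_def T_def gmap_fbr[OF assms] fbr_diff_left fbr_diff_right fbr_scale_left fbr_scale_right
      scale_diff scale_scale mult.assoc mult.commute mult.left_commute)

text \<open>By the Leibniz rule each application of \<open>S\<close> spends one of the
  \<open>i\<close> applications that annihilate \<open>f\<close> or one of the \<open>j\<close> that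
  annihilate \<open>g\<close>.\<close>

lemma S_funpow_fbr:
  assumes xy: "x \<in> X" "y \<in> X"
  shows "f \<in> U \<Longrightarrow> g \<in> U \<Longrightarrow> (T x ^^ i) f \<in> Z \<Longrightarrow> (T y ^^ j) g \<in> Z \<Longrightarrow> (S x y ^^ (i + j)) (fbr f g) \<in> Z"
proof (induction "i + j" arbitrary: i j f g)
  case 0
  then show ?case using fbr_Z_left by simp
next
  case (Suc m)
  show ?case
  proof (cases "i = 0 \<or> j = 0")
    case True
    then have "fbr f g \<in> Z" using fbr_Z_left[of f g] fbr_Z_right[of g f] Suc.prems by auto
    then show ?thesis by (rule S_funpow_Z[OF xy])
  next
    case False
    then obtain i' j' where ij: "i = Suc i'" "j = Suc j'" by (meson not0_implies_Suc)
    let ?g = "scale a (gmap \<gamma> g)"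
    have gU: "?g \<in> U" using Suc.prems gmap_U1 scale_U a_R by blast
    have "(T x ^^ i') (T x f) \<in> Z"
      using Suc.prems(3) unfolding ij by (simp only: funpow_Suc_right o_apply)
    moreover have "(T y ^^ j) ?g \<in> Z"
      unfolding T_funpow_scale T_funpow_gmap using Suc.prems(4) a_R Z_gmap Z_scale by blast
    ultimately have 1: "(S x y ^^ m) (fbr (T x f) ?g) \<in> Z"
      using Suc.hyps(1)[of i' j "T x f" ?g] Suc.hyps(2) Suc.prems gU T_U[OF xy(1)] ij by auto
    have "(T y ^^ j') (T y g) \<in> Z"
      using Suc.prems(4) unfolding ij by (simp only: funpow_Suc_right o_apply)
    then have "(S x y ^^ m) (fbr f (T y g)) \<in> Z"
      using Suc.hyps(1)[of i j' f "T y g"] Suc.hyps(2) Suc.prems T_U[OF xy(2)] ij by auto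
    then have 2: "(S x y ^^ m) (scale (a * x) (fbr f (T y g))) \<in> Z"
      unfolding S_funpow_scale using Z_scale root_R[OF xy(1)] by blast
    have "(S x y ^^ Suc m) (fbr f g) = (S x y ^^ m) (S x y (fbr f g))"
      by (simp only: funpow_Suc_right o_apply)
    also have "\<dots> \<in> Z"
      unfolding S_fbr[OF Suc.prems(1,2)] S_funpow_add by (rule add_subgroup_add[OF Z_sub 1 2])
    finally show ?thesis unfolding Suc.hyps(2) .
  qed
qed

lemma S_eigen_funpow:
  assumes w: "w \<in> U" "S x y w \<in> Z" and xy: "x \<in> X" "y \<in> X"
  shows "scale ((a * a) ^ i) ((gmap \<gamma> ^^ i) w) - scale ((a * x * (a * y)) ^ i) w \<in> Z"
proof (induction i)
  case 0
  show ?case using add_subgroup_zero[OF Z_sub] by simp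
next
  case (Suc i)
  let ?s = "a * x * (a * y)"
  have aa: "a * a \<in> R" and s: "?s \<in> R" using xy a_R root_R fg_subring_mult[OF R] by auto
  have 1: "scale (a * a) (gmap \<gamma> (scale ((a * a) ^ i) ((gmap \<gamma> ^^ i) w) - scale (?s ^ i) w)) \<in> Z"
    using Suc Z_gmap Z_scale aa by blast
  have 2: "scale (?s ^ i) (S x y w) \<in> Z"
    using w(2) Z_scale fg_subring_power[OF R s] by blast
  from add_subgroup_add[OF Z_sub 1 2] show ?case
    by (simp add: S_def gmap_diff gmap_scale scale_diff scale_scale mult.commute)
qed

text \<open>Up to powers of \<open>a\<close>, \<open>\<gamma>\<close> acts on \<open>w\<close> as
  multiplication by \<open>x y\<close>, so the relation \<open>r(\<gamma>) = 0\<close> makes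
  \<open>a^(2 d) r(x y) w\<close> null. That coefficient divides \<open>n\<close> when
  \<open>x y\<close> is not a root.\<close>

lemma S_injective:
  assumes w: "w \<in> U" "S x y w \<in> Z" and xy: "x \<in> X" "y \<in> X" "x * y \<notin> X"
  shows "w \<in> Z"
proof -
  let ?d = "degree r" and ?s = "a * x * (a * y)"
  let ?v = "a ^ (2 * ?d) * poly (cpoly r) (x * y)"
  have Z1: "scale (a ^ (2 * ?d)) (\<Sum>i\<le>?d. scale (of_int (coeff r i)) ((gmap \<gamma> ^^ i) w)) \<in> Z"
    by (intro Z_scale identity_Z w fg_subring_power[OF R] a_R)
  \<comment> \<open>Subtracting \<open>?Q\<close> replaces \<open>\<gamma>^i\<close> by
    \<open>(x y)^i\<close> in each term; \<open>a^(2 d - 2 i)\<close> complements the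
    \<open>a^(2 i)\<close> in \<open>S_eigen_funpow\<close>.\<close>
  have Z2: "(\<Sum>i\<le>?d. scale (of_int (coeff r i) * a ^ (2 * ?d - 2 * i))
      (scale ((a * a) ^ i) ((gmap \<gamma> ^^ i) w) - scale (?s ^ i) w)) \<in> Z" (is "?Q \<in> Z")
    by (intro add_subgroup_sum[OF Z_sub] Z_scale S_eigen_funpow w xy fg_subring_mult[OF R]
        fg_subring_power[OF R] fg_subring_of_int[OF R] a_R)
  have eq: "scale (a ^ (2 * ?d)) (\<Sum>i\<le>?d. scale (of_int (coeff r i)) ((gmap \<gamma> ^^ i) w))
      - ?Q = scale ?v w"
  proof -
    have pow: "a ^ (2 * ?d) = a ^ (2 * ?d - 2 * i) * (a * a) ^ i" if "i \<le> ?d" for i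
    proof -
      have "(a * a) ^ i = a ^ (2 * i)" by (simp add: power_mult power2_eq_square)
      then show ?thesis using that by (simp flip: power_add)
    qed
    have Q: "scale (a ^ (2 * ?d)) (scale (of_int (coeff r i)) ((gmap \<gamma> ^^ i) w))
       - scale (of_int (coeff r i) * a ^ (2 * ?d - 2 * i))
          (scale ((a * a) ^ i) ((gmap \<gamma> ^^ i) w) - scale (?s ^ i) w)
       = scale (a ^ (2 * ?d) * (of_int (coeff r i) * (x * y) ^ i)) w" if "i \<le> ?d" for i
    proof -
      have "?s ^ i = (a * a) ^ i * (x * y) ^ i" by (simp add: power_mult_distrib)
      moreover have "scale (b * c) (scale e g) - scale (e * b) (scale c g - scale (c * p) w) = scale (b * c * (e * p)) w"
        for b c e p g by (simp add: scale_diff scale_scale algebra_simps)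
      ultimately show ?thesis by (simp only: pow[OF that])
    qed
    have sum: "scale (sum c I) w = (\<Sum>i\<in>I. scale (c i) w)" for c :: "nat \<Rightarrow> complex" and I
      by (rule additive_sum[of "\<lambda>c. scale c w"]) (rule scale_add_left)
    show ?thesis
      unfolding poly_cpoly sum_distrib_left sum scale_sum sum_subtractf[symmetric]
      by (rule sum.cong) (use Q in auto)
  qed
  have "scale ?v w \<in> Z" using add_subgroup_diff[OF Z_sub Z1 Z2] unfolding eq .
  then show ?thesis using Z_cancel[OF w(1)] value_dvd[OF xy] by blast
qed

text \<open>If \<open>x y\<close> is a root, \<open>S\<close> is \<open>a\<close> times the operator
  \<open>T\<close> of \<open>x y\<close>, and powers of \<open>a\<close> cancel. Otherwise
  \<open>S\<close> is injective modulo \<open>Z\<close>, so a power of it can annihilate the bracket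
  only if the bracket is null.\<close>

lemma fbr_L:
  assumes f: "f \<in> L x" and g: "g \<in> L y"
  shows "fbr f g \<in> L (x * y)"
proof (cases "x \<in> X \<and> y \<in> X")
  case False
  then have "f \<in> Z \<or> g \<in> Z" using f g by (auto simp: L_def)
  then have "fbr f g \<in> Z" using fbr_Z_left fbr_Z_right f g L_le_U by blast
  then show ?thesis using Z_le_L by blast
next
  case True
  then have xy: "x \<in> X" "y \<in> X" by auto
  obtain i j where "(T x ^^ i) f \<in> Z" "(T y ^^ j) g \<in> Z" and U: "f \<in> U" "g \<in> U"
    using f g xy by (auto simp: L_def)
  then have SZ: "(S x y ^^ (i + j)) (fbr f g) \<in> Z" using S_funpow_fbr[OF xy] by blast
  have wU: "fbr f g \<in> U" by (rule fbr_U[OF U])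
  show ?thesis
  proof (cases "x * y \<in> X")
    case True
    have "S x y = (\<lambda>w. scale a (T (x * y) w))"
      by (rule ext) (simp add: S_def T_def scale_diff scale_scale ac_simps)
    then have "(S x y ^^ k) w = scale (a ^ k) ((T (x * y) ^^ k) w)" for k w
      by (induction k) (simp_all add: T_scale scale_scale)
    then have "scale (a ^ (i + j)) ((T (x * y) ^^ (i + j)) (fbr f g)) \<in> Z" using SZ by simp
    moreover have "(T (x * y) ^^ k) (fbr f g) \<in> U" for k
      by (induction k) (simp_all add: wU T_U[OF True])
    ultimately have "(T (x * y) ^^ (i + j)) (fbr f g) \<in> Z"
      using Z_cancel_power[OF a_R lead_dvd] by blast
    then show ?thesis by (rule L_in[OF wU True])
  next
    case False
    have "(S x y ^^ k) (fbr f g) \<in> Z \<Longrightarrow> fbr f g \<in> Z" for k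
    proof (induction k)
      case (Suc k)
      have "(S x y ^^ k) (fbr f g) \<in> Z"
        by (rule S_injective[OF S_funpow_U[OF xy wU] _ xy False]) (use Suc.prems in simp)
      then show ?case by (rule Suc.IH)
    qed simp
    then show ?thesis using SZ Z_le_L by blast
  qed
qed

section \<open>The sum of the eigenspaces, up to powers of n\<close>

definition V :: "'a formal set" where
  "V = group_closure (Z \<union> (\<Union>x. L x))"

lemma V_sub: "add_subgroup V"
  unfolding V_def by (rule add_subgroup_group_closure)

lemma Z_le_V: "Z \<subseteq> V" and L_le_V: "L x \<subseteq> V"
  unfolding V_def by (auto intro: group_closure_base)

lemma V_le_U: "V \<subseteq> U"
  unfolding V_def by (rule group_closure_least) (use Z_le_U L_le_U U_sub in auto)

lemma V_scale: "f \<in> V \<Longrightarrow> c \<in> R \<Longrightarrow> scale c f \<in> V"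
  unfolding V_def
  by (rule additive_group_closure[where F = "scale c", OF _ add_subgroup_group_closure scale_add])
     (auto intro: group_closure_base Z_scale L_scale)

abbreviation N :: "nat \<Rightarrow> complex" where "N K \<equiv> of_int n ^ K"

lemma N_R: "N K \<in> R"
  by (intro fg_subring_power[OF R] fg_subring_of_int[OF R])

text \<open>On the eigenspace of \<open>y\<close> the operator \<open>T x\<close> is the nilpotent
  \<open>T y\<close> plus multiplication by \<open>a y - a x\<close>, a divisor of \<open>n\<close>.
  So it is surjective up to a power of \<open>n\<close> bounded by the order of nilpotency.\<close>

lemma T_surjective_on_L:
  assumes xy: "x \<in> X" "y \<in> X" "x \<noteq> y"
  shows "v \<in> U \<Longrightarrow> (T y ^^ k) v \<in> Z \<Longrightarrow> \<exists>h\<in>L y. scale (N k) v - T x h \<in> Z"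
proof (induction k arbitrary: v)
  case 0
  have "T x 0 = 0" using T_diff[of x 0 0] by simp
  then show ?case using 0 add_subgroup_zero[OF L_sub] by (intro bexI[of _ 0]) auto
next
  case (Suc k)
  obtain b where b: "b \<in> R" "(a * y - a * x) * b = of_int n" using diff_dvd[of y x] xy by auto
  have "(T y ^^ k) (T y v) \<in> Z" using Suc.prems(2) by (simp only: funpow_Suc_right o_apply)
  then obtain h where h: "h \<in> L y" "scale (N k) (T y v) - T x h \<in> Z"
    using Suc.IH T_U[OF xy(2) Suc.prems(1)] by blast
  have vL: "v \<in> L y" by (rule L_in[OF Suc.prems(1) xy(2) Suc.prems(2)])
  \<comment> \<open>Modulo \<open>Z\<close>, \<open>T x\<close> maps this to
    \<open>b n^k (T x v - T y v)\<close>, which is \<open>n^(k+1) v\<close>.\<close>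
  define h' where "h' = scale (b * N k) v - scale b h"
  have h'L: "h' \<in> L y"
    unfolding h'_def
    by (intro add_subgroup_diff[OF L_sub] L_scale vL h(1) fg_subring_mult[OF R] b(1) N_R)
  have "T x v - T y v = scale (a * y - a * x) v"
    by (simp add: T_def scale_diff_left)
  moreover have "b * N k * (a * y - a * x) = N (Suc k)"
    unfolding power_Suc b(2)[symmetric] by (simp only: ac_simps)
  ultimately have "scale (b * N k) (T x v - T y v) = scale (N (Suc k)) v"
    by (simp only: scale_scale)
  then have "scale (N (Suc k)) v - T x h' = - scale b (scale (N k) (T y v) - T x h)"
    by (simp add: h'_def T_diff T_scale scale_diff scale_scale algebra_simps)
  moreover have "scale b (scale (N k) (T y v) - T x h) \<in> Z" by (rule Z_scale[OF h(2) b(1)])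
  ultimately show ?case using h'L add_subgroup_uminus[OF Z_sub] by metis
qed

text \<open>Cross-multiplying the powers of \<open>n\<close> makes the property additive in
  \<open>v\<close>, so generators suffice. Elements of \<open>L x\<close> serve as their own
  remainder \<open>g\<close>; the other eigenspaces are covered by
  \<open>T_surjective_on_L\<close>.\<close>

lemma T_surjective_on_V:
  assumes x: "x \<in> X" and v: "v \<in> V"
  shows "\<exists>K. \<exists>h\<in>V. \<exists>g\<in>L x. scale (N K) v - T x h - g \<in> Z"
proof -
  let ?P = "{v. \<exists>K. \<exists>h\<in>V. \<exists>g\<in>L x. scale (N K) v - T x h - g \<in> Z}"
  have T0: "T x 0 = 0" using T_diff[of x 0 0] by simp
  have 0: "0 \<in> V" "0 \<in> L x" "0 \<in> Z"
    using add_subgroup_zero V_sub L_sub Z_sub by blast+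
  have P_sub: "add_subgroup ?P"
    unfolding add_subgroup_def
  proof (intro conjI ballI)
    have "scale (N 0) 0 - T x 0 - 0 \<in> Z" using T0 0 by simp
    then show "0 \<in> ?P" using 0 by blast
  next
    fix v w assume "v \<in> ?P" "w \<in> ?P"
    then obtain K h g K' h' g' where
      v: "h \<in> V" "g \<in> L x" "scale (N K) v - T x h - g \<in> Z" and
      w: "h' \<in> V" "g' \<in> L x" "scale (N K') w - T x h' - g' \<in> Z" by blast
    let ?h = "scale (N K') h - scale (N K) h'" and ?g = "scale (N K') g - scale (N K) g'"
    have "scale (N K') (scale (N K) v - T x h - g) - scale (N K) (scale (N K') w - T x h' - g') \<in> Z"
      by (intro add_subgroup_diff[OF Z_sub] Z_scale v w N_R)
    also have "scale (N K') (scale (N K) v - T x h - g) - scale (N K) (scale (N K') w - T x h' - g')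
       = scale (N (K + K')) (v - w) - T x ?h - ?g"
      by (simp add: T_diff T_scale scale_diff scale_add scale_scale power_add algebra_simps)
    finally have "scale (N (K + K')) (v - w) - T x ?h - ?g \<in> Z" .
    moreover have "?h \<in> V" "?g \<in> L x"
      by (intro add_subgroup_diff[OF V_sub] V_scale v w N_R, intro add_subgroup_diff[OF L_sub] L_scale v w N_R)
    ultimately show "v - w \<in> ?P" by blast
  qed
  have P_mem: "v \<in> ?P" if mem: "v \<in> Z \<union> (\<Union>y. L y)" for v
  proof -
    have "y \<in> X" if "v \<in> L y" "v \<notin> Z" for y
      using that by (auto simp: L_def split: if_splits)
    then consider "v \<in> Z" | "v \<in> L x" | y where "v \<in> L y" "y \<in> X" "x \<noteq> y"
      using mem by blast
    then show ?thesis
    proof cases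
      case 1
      then have "scale (N 0) v - T x 0 - 0 \<in> Z" using T0 by simp
      then show ?thesis using 0 by blast
    next
      case 2
      then have "scale (N 0) v - T x 0 - v \<in> Z" using T0 0 by simp
      then show ?thesis using 0 2 by blast
    next
      case 3
      then obtain k where "v \<in> U" "(T y ^^ k) v \<in> Z" by (auto simp: L_def)
      then obtain h where "h \<in> L y" "scale (N k) v - T x h - 0 \<in> Z"
        using T_surjective_on_L[OF x 3(2,3)] by auto
      then show ?thesis using 0 L_le_V by blast
    qed
  qed
  have "group_closure (Z \<union> (\<Union>x. L x)) \<subseteq> ?P"
    by (rule group_closure_least[OF subsetI[OF P_mem] P_sub])
  then have "v \<in> ?P" using v[unfolded V_def] by (rule subsetD)
  then show ?thesis by (simp only: mem_Collect_eq)
qed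

primrec Tlist :: "complex list \<Rightarrow> 'a formal \<Rightarrow> 'a formal" where
  "Tlist [] f = f"
| "Tlist (x # xs) f = Tlist xs (T x f)"

text \<open>This takes the place of projections obtained from partial fractions. Up to a power of
  \<open>n\<close>, \<open>T x f\<close> is \<open>T x h + g\<close> with \<open>h\<close> in
  \<open>V\<close> and \<open>g\<close> in \<open>L x\<close>. So \<open>T x\<close> carries a
  multiple of \<open>f\<close> minus \<open>h\<close> into \<open>L x\<close>, and that difference
  already lies in \<open>L x\<close>.\<close>

lemma Tlist_decompose:
  "set xs \<subseteq> X \<Longrightarrow> f \<in> U \<Longrightarrow> Tlist xs f \<in> Z \<Longrightarrow> \<exists>K. scale (N K) f \<in> V"
proof (induction xs arbitrary: f)
  case Nil
  then show ?case using Z_le_V by (intro exI[of _ 0]) auto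
next
  case (Cons x xs)
  have x: "x \<in> X" using Cons.prems by simp
  obtain K where K: "scale (N K) (T x f) \<in> V"
    using Cons.IH[of "T x f"] Cons.prems T_U[OF x] by auto
  obtain K' h g where h: "h \<in> V" "g \<in> L x" "scale (N K') (scale (N K) (T x f)) - T x h - g \<in> Z"
    using T_surjective_on_V[OF x K] by blast
  define f' where "f' = scale (N (K + K')) f - h"
  have f'U: "f' \<in> U"
    unfolding f'_def using V_le_U h(1) by (intro add_subgroup_diff[OF U_sub] scale_U Cons.prems N_R) blast
  have "T x f' - g = scale (N K') (scale (N K) (T x f)) - T x h - g"
    by (simp add: f'_def T_diff T_scale scale_scale power_add mult.commute)
  then have "T x f' - g \<in> L x" using h(3) Z_le_L by auto
  then have "T x f' \<in> L x" using add_subgroup_add[OF L_sub _ h(2), of "T x f' - g"] by simp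
  then have "f' \<in> V" using L_T[OF x f'U] L_le_V by blast
  then have "scale (N (K + K')) f \<in> V"
    using add_subgroup_add[OF V_sub _ h(1), of f'] by (simp add: f'_def)
  then show ?case by blast
qed

lemma Tlist_poly:
  "Tlist xs f = (\<Sum>i\<le>length xs. scale (coeff (\<Prod>x\<leftarrow>xs. [:- (a * x), 1:]) i * a ^ i) ((gmap \<gamma> ^^ i) f))"
proof (induction xs arbitrary: f)
  case Nil
  then show ?case by simp
next
  case (Cons x xs)
  let ?p = "\<Prod>x\<leftarrow>xs. [:- (a * x), 1:]" and ?m = "length xs"
  let ?g = "\<lambda>i. (gmap \<gamma> ^^ i) f"
  have deg: "degree ?p \<le> ?m"
    by (induction xs) (auto intro!: order_trans[OF degree_mult_le] simp del: mult_pCons_left)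
  have c: "coeff ([:- (a * x), 1:] * ?p) (Suc i) = coeff ?p i - a * x * coeff ?p (Suc i)"
    and c0: "coeff ([:- (a * x), 1:] * ?p) 0 = - (a * x * coeff ?p 0)" for i
    by (simp_all add: mult_pCons_left)
  have Tg: "(gmap \<gamma> ^^ i) (T x f) = scale a (?g (Suc i)) - scale (a * x) (?g i)" for i
    using additive_diff[of "gmap \<gamma> ^^ i", OF gmap_funpow_add]
    by (simp add: T_def gmap_funpow_scale funpow_swap1)
  have "Tlist (x # xs) f = (\<Sum>i\<le>?m. scale (coeff ?p i * a ^ i) (scale a (?g (Suc i)) - scale (a * x) (?g i)))"
    by (simp add: Cons.IH Tg del: funpow.simps)
  also have "\<dots> = (\<Sum>i\<le>?m. scale (coeff ?p i * a ^ Suc i) (?g (Suc i)))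
      - (\<Sum>i\<le>?m. scale (a * x * coeff ?p i * a ^ i) (?g i))"
    by (simp add: scale_diff scale_scale sum_subtractf ac_simps del: funpow.simps)
  also have "(\<Sum>i\<le>?m. scale (a * x * coeff ?p i * a ^ i) (?g i))
     = scale (a * x * coeff ?p 0) f + (\<Sum>i\<le>?m. scale (a * x * coeff ?p (Suc i) * a ^ Suc i) (?g (Suc i)))"
  proof -
    have s0: "scale 0 g = 0" for g :: "'a formal" using scale_add_left[of 0 0 g] by simp
    \<comment> \<open>The added term vanishes for degree reasons; it lets the sum be shifted by one
      index.\<close>
    have "(\<Sum>i\<le>?m. scale (a * x * coeff ?p i * a ^ i) (?g i))
        = (\<Sum>i\<le>Suc ?m. scale (a * x * coeff ?p i * a ^ i) (?g i))"
      using coeff_eq_0[of ?p "Suc ?m"] deg by (simp add: s0 del: funpow.simps)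
    also have "\<dots> = scale (a * x * coeff ?p 0) f
        + (\<Sum>i\<le>?m. scale (a * x * coeff ?p (Suc i) * a ^ Suc i) (?g (Suc i)))"
      by (subst sum.atMost_Suc_shift) simp
    finally show ?thesis .
  qed
  also have "(\<Sum>i\<le>?m. scale (coeff ?p i * a ^ Suc i) (?g (Suc i))) - (scale (a * x * coeff ?p 0) f
      + (\<Sum>i\<le>?m. scale (a * x * coeff ?p (Suc i) * a ^ Suc i) (?g (Suc i))))
    = - scale (a * x * coeff ?p 0) f
      + (\<Sum>i\<le>?m. scale ((coeff ?p i - a * x * coeff ?p (Suc i)) * a ^ Suc i) (?g (Suc i)))"
    by (simp add: left_diff_distrib scale_diff_left sum_subtractf del: funpow.simps power_Suc)
  also have "\<dots> = (\<Sum>i\<le>Suc ?m. scale (coeff ([:- (a * x), 1:] * ?p) i * a ^ i) (?g i))"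
    unfolding sum.atMost_Suc_shift c c0 by (simp add: scale_uminus_left del: funpow.simps(2) power_Suc)
  finally show ?case by simp
qed

text \<open>Roots are listed with multiplicity. The product of \<open>a t - a x\<close> over them is
  \<open>a^d\<close> times the product of \<open>t - x\<close>, so applying all \<open>T x\<close>
  and one more factor \<open>a\<close> amounts to \<open>a^d r(\<gamma>)\<close>, which is null. The
  extra \<open>a\<close> cancels because it divides \<open>n\<close>.\<close>

lemma decompose:
  assumes f: "f \<in> U"
  shows "\<exists>K. scale (N K) f \<in> V"
proof -
  let ?d = "degree r"
  obtain xs where mset: "mset xs = proots (cpoly r)" using ex_mset by blast
  have "(\<Prod>x\<leftarrow>xs. [:- x, 1:]) = (\<Prod>x\<in>#proots (cpoly r). [:- x, 1:])"
    by (simp add: prod_list_map_mset mset)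
  then have xs: "smult (lead_coeff (cpoly r)) (\<Prod>x\<leftarrow>xs. [:- x, 1:]) = cpoly r" "length xs = degree (cpoly r)"
    using complex_poly_decompose_multiset[of "cpoly r"] size_proots_complex[of "cpoly r"] mset
    by (simp, metis size_mset)
  have lc: "lead_coeff (cpoly r) = a" by (simp add: coeff_cpoly degree_cpoly)
  have len: "length xs = ?d" using xs(2) by (simp add: degree_cpoly)
  have "poly (\<Prod>x\<leftarrow>ys. [:- x, 1:]) z = 0" if "z \<in> set ys" for ys and z :: complex
    using that by (induction ys) (auto simp del: mult_pCons_left)
  then have "poly (cpoly r) x = 0" if "x \<in> set xs" for x
    using that arg_cong[OF xs(1), of "\<lambda>p. poly p x"] by simp
  then have set: "set xs \<subseteq> X" by (auto simp: croots_def)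
  let ?P = "\<Prod>x\<leftarrow>xs. [:- (a * x), 1:]" and ?Q = "\<Prod>x\<leftarrow>xs. [:- x, 1:]"
  have "pcompose (\<Prod>x\<leftarrow>ys. [:- (a * x), 1:]) (monom a 1) = smult (a ^ length ys) (\<Prod>x\<leftarrow>ys. [:- x, 1:])" for ys
  proof (induction ys)
    case (Cons y ys)
    have "pcompose [:- (a * y), 1:] (monom a 1) = smult a [:- y, 1:]"
      by (simp add: pcompose_pCons monom_Suc monom_0)
    then have "pcompose (\<Prod>x\<leftarrow>y # ys. [:- (a * x), 1:]) (monom a 1)
        = smult a [:- y, 1:] * smult (a ^ length ys) (\<Prod>x\<leftarrow>ys. [:- x, 1:])"
      using Cons by (simp add: pcompose_mult del: mult_pCons_left)
    then show ?case
      by (simp only: list.map prod_list.Cons mult_smult_left mult_smult_right smult_smult length_Cons power_Suc2)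
  qed (simp add: pcompose_1)
  from arg_cong[OF this[of xs], of "\<lambda>p. coeff p _"] have PQ: "a ^ i * coeff ?P i = a ^ ?d * coeff ?Q i" for i
    using len by simp
  have coef: "a * (coeff ?P i * a ^ i) = a ^ ?d * of_int (coeff r i)" for i
  proof -
    have "of_int (coeff r i) = a * coeff ?Q i" using xs(1) lc by (metis coeff_cpoly coeff_smult)
    then show ?thesis using PQ[of i] by (simp add: ac_simps)
  qed
  have "scale a (Tlist xs f) = scale (a ^ ?d) (\<Sum>i\<le>?d. scale (of_int (coeff r i)) ((gmap \<gamma> ^^ i) f))"
    unfolding Tlist_poly len scale_sum scale_scale coef ..
  also have "\<dots> \<in> Z"
    by (intro Z_scale identity_Z f fg_subring_power[OF R] a_R)
  finally have aZ: "scale a (Tlist xs f) \<in> Z" .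
  have "Tlist ys g \<in> U" if "set ys \<subseteq> X" "g \<in> U" for ys g
    using that by (induction ys arbitrary: g) (auto simp: T_U)
  then have "Tlist xs f \<in> Z" using Z_cancel[OF _ aZ lead_dvd] set f by blast
  then show ?thesis by (rule Tlist_decompose[OF set f])
qed

text \<open>\<open>graded_nilpotent\<close> annihilates long brackets in \<open>V\<close>, but an
  element of \<open>G\<close> enters \<open>V\<close> only after scaling by some \<open>n^K\<close>.
  These powers are carried up the lower central series of \<open>G\<close> and are cancelled in its
  last term.\<close>

theorem top_trivial:
  assumes "degree r ^ (2 ^ degree r) \<le> top"
  shows "lcs G top = {\<one>}"
proof -
  note r = good_polyD[OF good]
  obtain \<theta> where th: "\<And>x. x \<in> X \<Longrightarrow> 0 < \<theta> x \<and> \<theta> x < (1::real)"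
    "\<And>x y. x \<in> X \<Longrightarrow> y \<in> X \<Longrightarrow> x * y \<in> X \<Longrightarrow> \<theta> (x * y) = \<theta> x + \<theta> y \<or> \<theta> (x * y) = \<theta> x + \<theta> y - 1"
    using ex_cyclic_order[OF finite_croots[OF r(1)] r(2,3)] by blast
  interpret GL: graded_lie fbr Z L X \<theta>
  proof
    show "x \<notin> X \<Longrightarrow> L x = Z" for x by (simp add: L_def)
    show "\<exists>j. x * y ^ j \<notin> X" if "x \<in> X" "y \<in> X" for x y
      by (rule good_poly_arith_free[OF good that])
    show "fbr f g \<in> Z" if "f \<in> Z" "g \<in> L x" for f g x
      using fbr_Z_left that L_le_U by blast
    show "fbr f g \<in> Z" if "f \<in> L x" "g \<in> Z" for f g x
      using fbr_Z_right that L_le_U by blast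
    show "fbr f g + fbr g f \<in> Z" if "f \<in> L x" "g \<in> L y" for f g x y
      using fbr_antisym that L_le_U by blast
    show "fbr (fbr f g) h - fbr (fbr f h) g - fbr f (fbr g h) \<in> Z"
      if "f \<in> L x" "g \<in> L y" "h \<in> L z" for f g h x y z
      using fbr_jacobi that L_le_U by blast
  qed (fact fbr_add_left fbr_add_right Z_sub L_sub Z_le_L fbr_L finite_croots[OF r(1)] r th)+
  have card: "card X \<le> degree r"
  proof -
    have "card X \<le> degree (cpoly r)"
      unfolding croots_def by (rule card_poly_roots_bound) (simp add: cpoly_eq_0_iff r(1))
    then show ?thesis by (simp add: degree_cpoly)
  qed
  have "card X ^ (2 ^ card X) \<le> degree r ^ (2 ^ degree r)"
  proof (cases "degree r = 0")
    case False
    have "card X ^ (2 ^ card X) \<le> degree r ^ (2 ^ card X)" using card by (rule power_mono) simp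
    also have "\<dots> \<le> degree r ^ (2 ^ degree r)" using False card by (intro power_increasing) auto
    finally show ?thesis .
  qed (use card in simp)
  then have lcf_top: "GL.lcf top x \<subseteq> Z" for x
    using GL.lcf_antimono[of "card X ^ (2 ^ card X)" top x] GL.graded_nilpotent[of x] assms by fastforce
  \<comment> \<open>The lower central series of the ring \<open>V\<close>, summed over all
    degrees.\<close>
  define W where "W k = group_closure (Z \<union> (\<Union>x. GL.lcf k x))" for k
  have W_sub: "add_subgroup (W k)" for k unfolding W_def by (rule add_subgroup_group_closure)
  have Z_le_W: "Z \<subseteq> W k" for k unfolding W_def by (auto intro: group_closure_base)
  have V_W: "V = W 0" by (simp add: V_def W_def)
  have W_U: "W k \<subseteq> U" for k
    unfolding W_def by (rule group_closure_least) (use Z_le_U GL.lcf_le_L L_le_U U_sub in blast)+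
  have W_step: "fbr f g \<in> W (Suc k)" if f: "f \<in> W k" and g: "g \<in> W 0" for f g k
  proof (rule additive_group_closure[OF f[unfolded W_def] W_sub fbr_add_left])
    fix f assume f: "f \<in> Z \<union> (\<Union>x. GL.lcf k x)"
    show "fbr f g \<in> W (Suc k)"
    proof (rule additive_group_closure[OF g[unfolded W_def] W_sub fbr_add_right])
      fix g assume g: "g \<in> Z \<union> (\<Union>x. GL.lcf 0 x)"
      have fU: "f \<in> U" "g \<in> U" using f g Z_le_U GL.lcf_le_L L_le_U by blast+
      consider "f \<in> Z" | "g \<in> Z" | x y where "f \<in> GL.lcf k x" "g \<in> L y" using f g by auto
      then show "fbr f g \<in> W (Suc k)"
      proof cases
        case 3
        then have "fbr f g \<in> GL.lcf (Suc k) (x * y)" using GL.br_prodfam[of f "GL.lcf k" x g L y] by simp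
        then show ?thesis unfolding W_def by (blast intro: group_closure_base)
      qed (use fbr_Z_left fbr_Z_right fU Z_le_W in blast)+
    qed
  qed
  \<comment> \<open>Integer multiples suffice to bring two different powers of \<open>n\<close> to a
    common one.\<close>
  have W_scale: "scale (N K) f \<in> W k" if f: "f \<in> W k" for f K k
  proof -
    have "scale (of_int m) f \<in> W k" for m
    proof -
      have "scale (of_nat j) f \<in> W k" for j
        using scale_add_left[of 0 0 f] add_subgroup_zero[OF W_sub] f
        by (induction j) (simp_all add: scale_add_left add_subgroup_add[OF W_sub])
      then show ?thesis
        using add_subgroup_uminus[OF W_sub] by (cases m rule: int_cases2) (auto simp: scale_uminus_left)
    qed
    from this[of "n ^ K"] show ?thesis by simp
  qed
  define good_elem where "good_elem k x \<longleftrightarrow> (\<exists>K. scale (N K) (Poly_Mapping.single (k, x) 1) \<in> W k)" for k x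
  have oneR: "1 \<in> R" by (rule fg_subring_one[OF R])
  have ge_mult: "good_elem k (x \<otimes> y)" if xy: "x \<in> lcs G k" "y \<in> lcs G k" "good_elem k x" "good_elem k y" for k x y
  proof -
    let ?s = "\<lambda>u. Poly_Mapping.single (k, u) (1 :: complex)"
    obtain K K' where K: "scale (N K) (?s x) \<in> W k" "scale (N K') (?s y) \<in> W k"
      using xy by (auto simp: good_elem_def)
    let ?N = "N (K + K')"
    have "scale ?N (?s (x \<otimes> y) - ?s x - ?s y) \<in> W k"
      using Z_mult[OF xy(1,2) oneR] Z_scale N_R Z_le_W by blast
    moreover have "scale ?N (?s x) \<in> W k" "scale ?N (?s y) \<in> W k"
      using W_scale[OF K(1), of K'] W_scale[OF K(2), of K] by (simp_all add: power_add mult.commute)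
    ultimately have "scale ?N (?s (x \<otimes> y) - ?s x - ?s y) + scale ?N (?s x) + scale ?N (?s y) \<in> W k"
      by (intro add_subgroup_add[OF W_sub])
    moreover have "scale ?N (?s (x \<otimes> y) - ?s x - ?s y) + scale ?N (?s x) + scale ?N (?s y) = scale ?N (?s (x \<otimes> y))"
      unfolding scale_diff by (simp add: algebra_simps del: scale_single)
    ultimately show ?thesis unfolding good_elem_def by metis
  qed
  have ge_inv: "good_elem k (inv x)" if x: "x \<in> lcs G k" "good_elem k x" for k x
  proof -
    let ?s = "\<lambda>u. Poly_Mapping.single (k, u) (1 :: complex)"
    obtain K where K: "scale (N K) (?s x) \<in> W k"
      using x by (auto simp: good_elem_def)
    have "?s \<one> - ?s x - ?s (inv x) \<in> Z"
      using Z_mult[OF x(1) lcs_inv[OF x(1)] oneR] lcs_carrier[OF x(1)] by simp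
    from add_subgroup_diff[OF Z_sub Z_one[OF oneR, of k] this]
    have "?s x + ?s (inv x) \<in> Z" by (simp add: algebra_simps)
    then have "scale (N K) (?s x + ?s (inv x)) \<in> W k" using Z_scale N_R Z_le_W by blast
    from add_subgroup_diff[OF W_sub this K] have "scale (N K) (?s (inv x)) \<in> W k"
      by (simp add: scale_add del: scale_single)
    then show ?thesis unfolding good_elem_def by blast
  qed
  have ge: "good_elem k x" if "x \<in> lcs G k" for k x
    using that
  proof (induction k arbitrary: x)
    case 0
    then show ?case
      using decompose[OF single_U[OF 0 oneR]] unfolding good_elem_def V_W by blast
  next
    case (Suc k)
    have gen: "good_elem (Suc k) (cm u v)" if u: "u \<in> carrier G" and v: "v \<in> lcs G k" for u v
    proof -
      have u0: "u \<in> lcs G 0" using u by simp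
      have vu: "cm v u \<in> lcs G (Suc k)" by (rule cm_lcs_Suc'[OF u v])
      obtain K where K: "scale (N K) (Poly_Mapping.single (k, v) 1) \<in> W k"
        using Suc.IH[OF v] by (auto simp: good_elem_def)
      obtain K' where K': "scale (N K') (Poly_Mapping.single (0, u) 1) \<in> W 0"
        using decompose[OF single_U[OF u0 oneR]] unfolding V_W by blast
      have "scale (N (K + K')) (Poly_Mapping.single (Suc k, cm v u) 1) \<in> W (Suc k)"
        using W_step[OF K K'] by (simp add: fbr_single cmp_def power_add mult.commute)
      then have "good_elem (Suc k) (cm v u)" unfolding good_elem_def by blast
      \<comment> \<open>\<open>W_step\<close> brackets with \<open>V\<close> on the right and yields
        \<open>[v, u]\<close>, the inverse of the generator \<open>[u, v]\<close> of
        \<open>lcs\<close>.\<close>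
      from ge_inv[OF vu this] show ?thesis using inv_cm[of v u] u v lcs_carrier by simp
    qed
    have "x \<in> lcs G (Suc k) \<and> good_elem (Suc k) x" using Suc.prems unfolding lcs.simps
    proof (induction x rule: generate.induct)
      case one
      have "scale (N 0) (Poly_Mapping.single (Suc k, \<one>) 1) \<in> W (Suc k)" using Z_one[OF oneR, of "Suc k"] Z_le_W by auto
      then have "good_elem (Suc k) \<one>" unfolding good_elem_def by (rule exI)
      then show ?case using lcs_one[of "Suc k"] by simp
    next
      case (incl h)
      then show ?case using gen cm_lcs_Suc by (auto simp flip: cm_def intro: generate.incl)
    next
      case (inv h)
      then obtain u v where h: "h = cm u v" "u \<in> carrier G" "v \<in> lcs G k" by (auto simp: cm_def)
      show ?case using ge_inv[of h "Suc k"] gen[OF h(2,3)] cm_lcs_Suc[OF h(2,3)] lcs_inv[of h "Suc k"] h(1) by simp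
    next
      case (eng h1 h2)
      then show ?case using ge_mult[of h1 "Suc k" h2] lcs_mult[of h1 "Suc k" h2] by simp
    qed
    then show ?case by simp
  qed
  have W_top: "W top \<subseteq> Z"
    unfolding W_def by (rule group_closure_least) (use lcf_top Z_sub in blast)+
  show ?thesis
  proof (intro equalityI subsetI)
    fix x assume x: "x \<in> lcs G top"
    obtain K where "scale (N K) (Poly_Mapping.single (top, x) 1) \<in> Z"
      using ge[OF x] W_top by (auto simp: good_elem_def)
    then have "Poly_Mapping.single (top, x) 1 \<in> Z"
      using Z_cancel_power[of "of_int n" "Poly_Mapping.single (top, x) 1" K] single_U[OF x oneR]
        fg_subring_of_int[OF R] oneR by (metis mult.right_neutral)
    then show "x \<in> {\<one>}" using top_single_Z[OF x] by simp
  qed (simp add: lcs_one)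
qed

end

theorem theorem1p11:
  fixes G :: "('a, 'b) monoid_scheme" and \<gamma> :: "'a \<Rightarrow> 'a" and r :: "int poly"
  assumes "nilpotent_group G"
    and "\<gamma> \<in> hom G G"
    and "is_identity G \<gamma> r"
    and "good_poly r"
  shows "(\<exists>n::int. of_int n = discr_star r * prod_star r \<and> has_torsion G n)
         \<or> nilpotent_class_le G (degree r ^ (2 ^ degree r))"
proof (rule disj_imp[THEN iffD2], rule impI)
  assume no: "\<not> (\<exists>n::int. of_int n = discr_star r * prod_star r \<and> has_torsion G n)"
  let ?N = "degree r ^ (2 ^ degree r)"
  obtain n R where n: "of_int n = discr_star r * prod_star r" and R: "fg_subring R"
    "\<And>x. x \<in> croots r \<Longrightarrow> of_int (lead_coeff r) * x \<in> R"
    "\<exists>b\<in>R. of_int (lead_coeff r) * b = of_int n"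
    "\<And>x y. x \<in> croots r \<Longrightarrow> y \<in> croots r \<Longrightarrow> x \<noteq> y \<Longrightarrow>
       \<exists>b\<in>R. (of_int (lead_coeff r) * x - of_int (lead_coeff r) * y) * b = of_int n"
    "\<And>x y. x \<in> croots r \<Longrightarrow> y \<in> croots r \<Longrightarrow> x * y \<notin> croots r \<Longrightarrow>
       of_int (lead_coeff r) ^ (2 * degree r) * poly (cpoly r) (x * y) \<in> R \<and>
       (\<exists>b\<in>R. of_int (lead_coeff r) ^ (2 * degree r) * poly (cpoly r) (x * y) * b = of_int n)"
    by (rule torsion_number[OF assms(4)], rule that)
  have no_torsion: "\<not> has_torsion G n" using no n by blast
  obtain l :: "complex \<Rightarrow> int" where l: "\<And>x y. x \<in> R \<Longrightarrow> y \<in> R \<Longrightarrow> l (x + y) = l x + l y" "l 1 = 1"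
    using ex_splitting[OF R(1)] by blast
  have grp: "group G" and ex: "\<exists>c. lcs G c = {\<one>\<^bsub>G\<^esub>}"
    using assms(1) by (auto simp: nilpotent_group_def nilpotent_class_le_def)
  interpret group G by (rule grp)
  \<comment> \<open>By minimality the term before the last is nontrivial. If \<open>c\<close>
    exceeded the bound, \<open>top_trivial\<close> with \<open>t = c - 1\<close> would contradict
    this.\<close>
  define c where "c = (LEAST c. lcs G c = {\<one>\<^bsub>G\<^esub>})"
  have c: "lcs G c = {\<one>\<^bsub>G\<^esub>}" unfolding c_def using ex by (rule LeastI_ex)
  have "c \<le> ?N"
  proof (rule ccontr)
    assume "\<not> c \<le> ?N"
    then obtain t where t: "c = Suc t" "?N \<le> t" by (cases c) auto
    have top: "lcs G (Suc t) = {\<one>\<^bsub>G\<^esub>}" using c t(1) by simp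
    interpret eigen_setting G t \<gamma> r n R l
      by unfold_locales (fact top assms no_torsion R l)+
    have "lcs G t = {\<one>\<^bsub>G\<^esub>}" by (rule top_trivial[OF t(2)])
    then have "c \<le> t" unfolding c_def by (rule Least_le)
    then show False using t(1) by simp
  qed
  then show "nilpotent_class_le G ?N"
    using lcs_antimono[of c ?N] lcs_one[of ?N] c by (auto simp: nilpotent_class_le_def)
qed

end
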